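(* Let $\boldsymbol{F}^{(L)},\boldsymbol{F}^{(R)}\in\mathcal{S}(\mathcal{T}^{p,r}_{k},[0,1]^2)$ be an analysis-suitable $G^1$ two-patch parameterization of $\Omega=\Omega^{(L)}\cup\Omega^{(R)}$, with associated functions $\alpha^{(L)},\alpha^{(R)}\in\mathcal{P}^1([0,1])$ and $\beta\in\mathcal{P}^2([0,1])$. Let $d_\alpha=\max(\deg\alpha^{(L)},\deg\alpha^{(R)})\in\{0,1\}$ and let $z_\beta=|\{v_0\in\{\tau_1,\dots,\tau_k\} : \beta(v_0)=0\}|$ be the number of distinct inner knots at which $\beta$ vanishes. Then the space $\mathcal{V}^1$ of $C^1$-smooth isogeometric functions on $\Omega$ has dimension $$\dim\mathcal{V}^1 = 2\,(p+k(p-r)-1)(p+k(p-r)+1) + 2(p+k(p-r-1))+1+(1-d_\alpha)(k+1)+z_\beta ,$$ where $2(p+k(p-r)-1)(p+k(p-r)+1)=\dim \mathcal{V}^1_1$ and $2(p+k(p-r-1))+1+(1-d_\alpha)(k+1)+z_\beta=\dim\mathcal{V}^1_2$.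
   Context: Splines. Let $p\ge 3$, $1\le r\le p-2$ and $k\ge 0$ be integers and $0<\tau_1<\dots<\tau_k<1$. For a degree $q$ and regularity $s$, $\mathcal{T}^{q,s}_k$ is the open knot vector on $[0,1]$ in which $0$ and $1$ occur $q+1$ times and each inner knot $\tau_i$ occurs $q-s$ times. $\mathcal{S}(\mathcal{T}^{q,s}_k,[0,1])$ is the space of splines of degree $q$ with this knot vector ($C^s$ at the inner knots), with B-spline basis $N^{q,s}_i$, $i=0,\dots,q+k(q-s)$; $\mathcal{S}(\mathcal{T}^{q,s}_k,[0,1]^2)$ is the tensor-product space with basis $N^{q,s}_{i,j}(u,v)=N^{q,s}_i(u)N^{q,s}_j(v)$. $\mathcal{P}^m([0,1])$ is the space of polynomials of degree at most $m$. Geometry. For $S\in\{L,R\}$, $\boldsymbol{F}^{(S)}:[0,1]^2\to\Omega^{(S)}\subset\mathbb{R}^2$ is a regular (nonsingular Jacobian), bijective map with both components in $\mathcal{S}(\mathcal{T}^{p,r}_k,[0,1]^2)$; $\Omega=\Omega^{(L)}\cup\Omega^{(R)}$, and the two patches meet exactly in the common edge $\Gamma=\Omega^{(L)}\cap\Omega^{(R)}$, parameterized by $\boldsymbol{F}_0(v)=\boldsymbol{F}^{(L)}(0,v)=\boldsymbol{F}^{(R)}(0,v)$, $v\in[0,1]$. Analysis-suitable $G^1$ (AS $G^1$). The parameterization is AS $G^1$ if there exist $\alpha^{(L)},\alpha^{(R)},\beta^{(L)},\beta^{(R)}\in\mathcal{P}^1([0,1])$, with $\alpha^{(L)},\alpha^{(R)}$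 relatively prime and $\alpha^{(L)}(v)\alpha^{(R)}(v)<0$ on $[0,1]$, such that, with $\beta=\alpha^{(L)}\beta^{(R)}-\alpha^{(R)}\beta^{(L)}$, $$\alpha^{(R)}(v)D_u\boldsymbol{F}^{(L)}(0,v)-\alpha^{(L)}(v)D_u\boldsymbol{F}^{(R)}(0,v)+\beta(v)\boldsymbol{F}_0'(v)=\boldsymbol{0}\quad\text{for all } v\in[0,1].$$ The functions $\alpha^{(L)},\alpha^{(R)},\beta$ are then unique up to a common nonzero constant. Spaces. $\mathcal{V}$ is the space of $\phi:\Omega\to\mathbb{R}$ with $g^{(S)}:=\phi\circ\boldsymbol{F}^{(S)}\in\mathcal{S}(\mathcal{T}^{p,r}_k,[0,1]^2)$, $S\in\{L,R\}$; write $g^{(S)}=\sum_{i,j}d^{(S)}_{i,j}N^{p,r}_{i,j}$. $\mathcal{V}^1=\mathcal{V}\cap C^1(\Omega)$; explicitly, $\phi\in\mathcal{V}$ is in $\mathcal{V}^1$ iff $g^{(L)}(0,v)=g^{(R)}(0,v)=:g(v)$ and $\alpha^{(R)}(v)D_ug^{(L)}(0,v)-\alpha^{(L)}(v)D_ug^{(R)}(0,v)+\beta(v)g'(v)=0$ for all $v\in[0,1]$. $\mathcal{V}^1_1$ is the subspace of $\phi\in\mathcal{V}^1$ with $d^{(S)}_{i,j}=0$ for $S\in\{L,R\}$, $i\in\{0,1\}$ and all $j$; $\mathcal{V}^1_2$ is the subspace of $\phi\in\mathcal{V}^1$ with $d^{(S)}_{i,j}=0$ for $S\in\{L,R\}$,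 all $i\ge2$ and all $j$. *)

theory Defs
  imports
    "HOL-Analysis.Analysis"
    "HOL-Computational_Algebra.Polynomial"
    "HOL-Library.Function_Algebras"
begin

text \<open>Pointwise real vector space structure on functions, so that the library's \<open>dim\<close> applies
  to spaces of real-valued functions.\<close>

instantiation "fun" :: (type, real_vector) real_vector
begin

definition scaleR_fun :: "real \<Rightarrow> ('a \<Rightarrow> 'b) \<Rightarrow> 'a \<Rightarrow> 'b" where
  "scaleR_fun c f = (\<lambda>x. c *\<^sub>R f x)"

instance
  by standard (simp_all add: scaleR_fun_def fun_eq_iff algebra_simps)

end

section \<open>Splines\<close>

text \<open>The inner knots are \<open>\<tau> 1 < \<dots> < \<tau> k\<close>; each of them is repeated \<open>q - s\<close> times.\<close>

definition inner_knots :: "nat \<Rightarrow> (nat \<Rightarrow> real) \<Rightarrow> bool" where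
  "inner_knots k \<tau> \<longleftrightarrow> strict_mono_on {1..k} \<tau> \<and> (\<forall>i\<in>{1..k}. 0 < \<tau> i \<and> \<tau> i < 1)"

definition open_knots :: "nat \<Rightarrow> nat \<Rightarrow> nat \<Rightarrow> (nat \<Rightarrow> real) \<Rightarrow> real list" where
  "open_knots q s k \<tau> =
     replicate (q + 1) 0 @ concat (map (\<lambda>i. replicate (q - s) (\<tau> i)) [1..<k + 1]) @ replicate (q + 1) 1"

text \<open>Cox--de Boor recursion: \<open>bspline t q i\<close> is the \<open>i\<close>-th B-spline of degree \<open>q\<close> for the knot
  vector \<open>t\<close>. The usual convention \<open>x / 0 = 0\<close> for vanishing knot spans is the one built into
  division. The knot spans are half-open, except that the last nonempty one also contains its
  right end point, so that the B-splines are left-continuous at the last knot.\<close>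

fun bspline :: "real list \<Rightarrow> nat \<Rightarrow> nat \<Rightarrow> real \<Rightarrow> real" where
  "bspline t 0 i x =
     (if t ! i \<le> x \<and> x < t ! (i + 1) \<or> t ! i < t ! (i + 1) \<and> t ! (i + 1) = last t \<and> x = last t
      then 1 else 0)"
| "bspline t (Suc q) i x =
     (x - t ! i) / (t ! (i + q + 1) - t ! i) * bspline t q i x
     + (t ! (i + q + 2) - x) / (t ! (i + q + 2) - t ! (i + 1)) * bspline t q (i + 1) x"

definition N :: "nat \<Rightarrow> nat \<Rightarrow> nat \<Rightarrow> (nat \<Rightarrow> real) \<Rightarrow> nat \<Rightarrow> real \<Rightarrow> real" where
  "N q s k \<tau> i = bspline (open_knots q s k \<tau>) q i"

text \<open>The parameter square, and B-spline representations on it. Functions on the square are total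
  functions of which only the values on the square are ever used.\<close>

definition Q :: "(real \<times> real) set" where
  "Q = {0..1} \<times> {0..1}"

definition has_coeffs ::
  "nat \<Rightarrow> nat \<Rightarrow> nat \<Rightarrow> (nat \<Rightarrow> real) \<Rightarrow> (real \<times> real \<Rightarrow> real) \<Rightarrow> (nat \<Rightarrow> nat \<Rightarrow> real) \<Rightarrow> bool" where
  "has_coeffs q s k \<tau> g d \<longleftrightarrow>
     (\<forall>(u, v)\<in>Q. g (u, v) =
        (\<Sum>i\<le>q + k * (q - s). \<Sum>j\<le>q + k * (q - s). d i j * (N q s k \<tau> i u * N q s k \<tau> j v)))"

definition tensor_splines ::
  "nat \<Rightarrow> nat \<Rightarrow> nat \<Rightarrow> (nat \<Rightarrow> real) \<Rightarrow> (real \<times> real \<Rightarrow> real) set" where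
  "tensor_splines q s k \<tau> = {g. \<exists>d. has_coeffs q s k \<tau> g d}"

section \<open>Two-patch geometry\<close>

text \<open>Partial derivatives on the closed square, one-sided at its boundary.\<close>

definition D\<^sub>u :: "(real \<times> real \<Rightarrow> real \<times> real) \<Rightarrow> real \<times> real \<Rightarrow> real \<times> real" where
  "D\<^sub>u F = (\<lambda>(u, v). vector_derivative (\<lambda>t. F (t, v)) (at u within {0..1}))"

definition D\<^sub>v :: "(real \<times> real \<Rightarrow> real \<times> real) \<Rightarrow> real \<times> real \<Rightarrow> real \<times> real" where
  "D\<^sub>v F = (\<lambda>(u, v). vector_derivative (\<lambda>t. F (u, t)) (at v within {0..1}))"

definition jacobian_det :: "(real \<times> real \<Rightarrow> real \<times> real) \<Rightarrow> real \<times> real \<Rightarrow> real" where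
  "jacobian_det F x = fst (D\<^sub>u F x) * snd (D\<^sub>v F x) - snd (D\<^sub>u F x) * fst (D\<^sub>v F x)"

text \<open>A regular spline map, bijective onto its patch \<open>F ` Q\<close>.\<close>

definition patch_map ::
  "nat \<Rightarrow> nat \<Rightarrow> nat \<Rightarrow> (nat \<Rightarrow> real) \<Rightarrow> (real \<times> real \<Rightarrow> real \<times> real) \<Rightarrow> bool" where
  "patch_map p r k \<tau> F \<longleftrightarrow>
     (\<lambda>x. fst (F x)) \<in> tensor_splines p r k \<tau> \<and>
     (\<lambda>x. snd (F x)) \<in> tensor_splines p r k \<tau> \<and>
     inj_on F Q \<and> (\<forall>x\<in>Q. jacobian_det F x \<noteq> 0)"

definition two_patch ::
  "nat \<Rightarrow> nat \<Rightarrow> nat \<Rightarrow> (nat \<Rightarrow> real) \<Rightarrow> (real \<times> real \<Rightarrow> real \<times> real) \<Rightarrow> (real \<times> real \<Rightarrow> real \<times> real) \<Rightarrow> bool"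
  where
  "two_patch p r k \<tau> FL FR \<longleftrightarrow>
     patch_map p r k \<tau> FL \<and> patch_map p r k \<tau> FR \<and>
     (\<forall>v\<in>{0..1}. FL (0, v) = FR (0, v)) \<and>
     FL ` Q \<inter> FR ` Q = (\<lambda>v. FL (0, v)) ` {0..1}"

definition domain ::
  "(real \<times> real \<Rightarrow> real \<times> real) \<Rightarrow> (real \<times> real \<Rightarrow> real \<times> real) \<Rightarrow> (real \<times> real) set" where
  "domain FL FR = FL ` Q \<union> FR ` Q"

text \<open>\<open>AS_G1 FL FR \<alpha>L \<alpha>R \<beta>\<close>: the parameterization is analysis-suitable \<open>G\<^sup>1\<close> with associated
  functions \<open>\<alpha>L\<close>, \<open>\<alpha>R\<close>, \<open>\<beta>\<close>.\<close>

definition AS_G1 ::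
  "(real \<times> real \<Rightarrow> real \<times> real) \<Rightarrow> (real \<times> real \<Rightarrow> real \<times> real) \<Rightarrow>
   real poly \<Rightarrow> real poly \<Rightarrow> real poly \<Rightarrow> bool" where
  "AS_G1 FL FR \<alpha>L \<alpha>R \<beta> \<longleftrightarrow>
     degree \<alpha>L \<le> 1 \<and> degree \<alpha>R \<le> 1 \<and> coprime \<alpha>L \<alpha>R \<and>
     (\<forall>v\<in>{0..1}. poly \<alpha>L v * poly \<alpha>R v < 0) \<and>
     (\<exists>\<beta>L \<beta>R. degree \<beta>L \<le> 1 \<and> degree \<beta>R \<le> 1 \<and> \<beta> = \<alpha>L * \<beta>R - \<alpha>R * \<beta>L) \<and>
     (\<forall>v\<in>{0..1}.
        poly \<alpha>R v *\<^sub>R D\<^sub>u FL (0, v) - poly \<alpha>L v *\<^sub>R D\<^sub>u FR (0, v)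
        + poly \<beta> v *\<^sub>R vector_derivative (\<lambda>t. FL (0, t)) (at v within {0..1}) = 0)"

section \<open>Isogeometric spaces\<close>

text \<open>Functions \<open>\<Omega> \<rightarrow> \<real>\<close> are represented by the total functions that vanish outside \<open>\<Omega>\<close>.
  This makes the dimensions below those of the spaces of functions on \<open>\<Omega>\<close>.\<close>

definition V ::
  "nat \<Rightarrow> nat \<Rightarrow> nat \<Rightarrow> (nat \<Rightarrow> real) \<Rightarrow> (real \<times> real \<Rightarrow> real \<times> real) \<Rightarrow> (real \<times> real \<Rightarrow> real \<times> real) \<Rightarrow>
   (real \<times> real \<Rightarrow> real) set" where
  "V p r k \<tau> FL FR =
     {\<phi>. (\<forall>x. x \<notin> domain FL FR \<longrightarrow> \<phi> x = 0) \<and>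
         \<phi> \<circ> FL \<in> tensor_splines p r k \<tau> \<and> \<phi> \<circ> FR \<in> tensor_splines p r k \<tau>}"

text \<open>\<open>C\<^sup>1\<close> on a set that need not be open: there is a gradient relative to the set at each of its
  points, and it is continuous on the set.\<close>

definition C1 :: "(real \<times> real) set \<Rightarrow> (real \<times> real \<Rightarrow> real) set" where
  "C1 \<Omega> = {\<phi>. \<exists>G. continuous_on \<Omega> G \<and>
                   (\<forall>x\<in>\<Omega>. (\<phi> has_derivative (\<lambda>h. G x \<bullet> h)) (at x within \<Omega>))}"

definition V1 ::
  "nat \<Rightarrow> nat \<Rightarrow> nat \<Rightarrow> (nat \<Rightarrow> real) \<Rightarrow> (real \<times> real \<Rightarrow> real \<times> real) \<Rightarrow> (real \<times> real \<Rightarrow> real \<times> real) \<Rightarrow>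
   (real \<times> real \<Rightarrow> real) set" where
  "V1 p r k \<tau> FL FR = V p r k \<tau> FL FR \<inter> C1 (domain FL FR)"

text \<open>The subspaces of \<open>V1\<close> whose coefficients vanish in the two columns nearest to the interface,
  respectively in all other columns. As the coefficients of a spline are unique, it does not matter
  that they are quantified existentially.\<close>

definition V1\<^sub>1 ::
  "nat \<Rightarrow> nat \<Rightarrow> nat \<Rightarrow> (nat \<Rightarrow> real) \<Rightarrow> (real \<times> real \<Rightarrow> real \<times> real) \<Rightarrow> (real \<times> real \<Rightarrow> real \<times> real) \<Rightarrow>
   (real \<times> real \<Rightarrow> real) set" where
  "V1\<^sub>1 p r k \<tau> FL FR =
     {\<phi> \<in> V1 p r k \<tau> FL FR. \<forall>F\<in>{FL, FR}. \<exists>d. has_coeffs p r k \<tau> (\<phi> \<circ> F) d \<and>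
        (\<forall>i\<in>{0, 1}. \<forall>j\<le>p + k * (p - r). d i j = 0)}"

definition V1\<^sub>2 ::
  "nat \<Rightarrow> nat \<Rightarrow> nat \<Rightarrow> (nat \<Rightarrow> real) \<Rightarrow> (real \<times> real \<Rightarrow> real \<times> real) \<Rightarrow> (real \<times> real \<Rightarrow> real \<times> real) \<Rightarrow>
   (real \<times> real \<Rightarrow> real) set" where
  "V1\<^sub>2 p r k \<tau> FL FR =
     {\<phi> \<in> V1 p r k \<tau> FL FR. \<forall>F\<in>{FL, FR}. \<exists>d. has_coeffs p r k \<tau> (\<phi> \<circ> F) d \<and>
        (\<forall>i\<in>{2..p + k * (p - r)}. \<forall>j\<le>p + k * (p - r). d i j = 0)}"

end

theory Submission
  imports
    Defs
    "HOL-Computational_Algebra.Field_as_Ring"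
    "HOL-Computational_Algebra.Polynomial_Factorial"
begin

text \<open>A spline is encoded by its jump polynomials: a polynomial, followed at each inner knot by the
  multiple of \<open>(x - \<tau>\<^sub>i)\<close> to the power \<open>r + 1\<close> that is added there. Marsden's identity expresses powers and
  truncated powers by B-splines, so by counting dimensions the B-splines are a basis of the space of
  all such piecewise polynomials.

  Near \<open>u = 0\<close> the \<open>i\<close>-th B-spline is a multiple of \<open>u\<^sup>i\<close>, so the values and the \<open>u\<close>-derivatives on the
  interface depend only on the first two columns of coefficients. The inverse function rule on each
  patch turns \<open>C\<^sup>1\<close>-smoothness into the relation \<open>\<alpha>R x - \<alpha>L y + \<beta> g' = 0\<close> between the trace \<open>g\<close> and the two
  transversal derivatives \<open>x\<close>, \<open>y\<close>. Hence \<open>V1\<close> is the direct sum of \<open>V1\<^sub>1\<close>, where the relation is void, and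
  \<open>V1\<^sub>2\<close>, which is isomorphic to the space of triples \<open>(g, x, y)\<close> of univariate splines satisfying it.

  Jump polynomials are unique, so this space is the product over the knots of the spaces of jumps
  satisfying the relation. By coprimality \<open>x = \<beta>L g' + \<alpha>L w\<close> and \<open>y = \<beta>R g' + \<alpha>R w\<close>, with \<open>deg w \<le> p - d\<^sub>\<alpha>\<close>. At
  an inner knot the divisibility of \<open>x\<close> and \<open>y\<close> is a linear system of two equations in the leading
  coefficients of \<open>g\<close> and \<open>w\<close> there, whose determinant vanishes iff \<open>\<beta>\<close> does; each zero of \<open>\<beta>\<close> among
  the inner knots thus adds one dimension.\<close>

section \<open>Finite dimension\<close>

text \<open>Unlike \<open>dim\<close>, which is \<open>0\<close> on infinite-dimensional spaces and ignores whether its argument is a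
  subspace, \<open>findim U d\<close> implies that \<open>U\<close> is a subspace of finite dimension \<open>d\<close>.\<close>

definition findim :: "'a::real_vector set \<Rightarrow> nat \<Rightarrow> bool" where
  "findim U d \<longleftrightarrow> (\<exists>B. finite B \<and> independent B \<and> span B = U \<and> card B = d)"

lemma findim_dim: "findim U d \<Longrightarrow> dim U = d"
  unfolding findim_def by (metis dim_eq_card_independent dim_span)

lemma findim_subspace: "findim U d \<Longrightarrow> subspace U"
  unfolding findim_def by auto

lemma findim_zero: "findim {0} 0"
  unfolding findim_def by (rule exI[of _ "{}"]) (auto simp: independent_empty)

lemma findim_image:
  assumes "linear f" "inj_on f U" "findim U d"
  shows "findim (f ` U) d"
proof -
  obtain B where B: "finite B" "independent B" "span B = U" "card B = d"
    using assms(3) unfolding findim_def by auto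
  have inj: "inj_on f (span B)" using assms B by simp
  then have injB: "inj_on f B" by (rule inj_on_subset) (rule span_superset)
  have "independent (f ` B)"
    using B(2) inj assms(1) by (metis linear_dependent_inj_imageD)
  moreover have "span (f ` B) = f ` U" using B(3) assms(1) by (metis linear_span_image)
  moreover have "card (f ` B) = d" using injB B(4) by (simp add: card_image)
  ultimately show ?thesis using B(1) unfolding findim_def by blast
qed

text \<open>A linear left inverse of \<open>f\<close> on \<open>U\<close> carries a basis of the
  image back. This yields the dimension of a space known only through an injective image.\<close>

lemma findim_of_image:
  assumes "linear f" "inj_on f U" "subspace U" "findim (f ` U) d"
  shows "findim U d"
proof -
  obtain g where g: "linear g" "\<forall>v\<in>U. g (f v) = v"
    using linear_exists_left_inverse_on[OF assms(1,3,2)] by auto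
  have "U = g ` (f ` U)" using g(2) by (force simp: image_iff)
  moreover have "inj_on g (f ` U)" using g(2) by (auto simp: inj_on_def)
  ultimately show ?thesis using findim_image[OF g(1) _ assms(4)] by simp
qed

text \<open>Induction on \<open>A\<close>: if the new vector were \<open>a = x + y\<close> with
  \<open>x\<close> in \<open>span A\<close> and \<open>y\<close> in \<open>span B\<close>, then
  \<open>y = a - x\<close> would lie in both spans, so \<open>y = 0\<close> and \<open>a\<close>
  would be in \<open>span A\<close>.\<close>

lemma independent_Un_direct:
  assumes "finite A" "independent A" "independent B" "span A \<inter> span B \<subseteq> {0}"
  shows "independent (A \<union> B)"
  using assms(1,2,4)
proof (induction A)
  case empty
  then show ?case using assms(3) by simp
next
  case (insert a A)
  have sub: "span A \<subseteq> span (insert a A)" by (rule span_mono) auto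
  have aA: "a \<notin> span A" and iA: "independent A"
    using insert.prems(1) insert.hyps(2) by (auto simp: independent_insert)
  have "a \<notin> span (A \<union> B)"
  proof
    assume "a \<in> span (A \<union> B)"
    then obtain x y where xy: "x \<in> span A" "y \<in> span B" "a = x + y"
      unfolding span_Un by auto
    have "a \<in> span (insert a A)" by (simp add: span_base)
    then have "y \<in> span (insert a A)"
      using xy sub span_diff[of a "insert a A" x] by auto
    then have "y = 0" using insert.prems(2) xy by auto
    then show False using aA xy by simp
  qed
  moreover have "independent (A \<union> B)" using insert.IH[OF iA] insert.prems(2) sub by blast
  ultimately show ?case by (simp add: independent_insertI)
qed

lemma findim_direct_sum:
  assumes "findim A a" "findim B b" "A \<inter> B \<subseteq> {0}"
  shows "findim {x + y | x y. x \<in> A \<and> y \<in> B} (a + b)"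
proof -
  obtain X where X: "finite X" "independent X" "span X = A" "card X = a"
    using assms(1) unfolding findim_def by auto
  obtain Y where Y: "finite Y" "independent Y" "span Y = B" "card Y = b"
    using assms(2) unfolding findim_def by auto
  have "independent (X \<union> Y)"
    using independent_Un_direct[OF X(1,2) Y(2)] X(3) Y(3) assms(3) by simp
  moreover have "X \<inter> Y = {}"
  proof -
    have "X \<inter> Y \<subseteq> {0}" using X(3) Y(3) assms(3) span_superset[of X] span_superset[of Y] by auto
    moreover have "0 \<notin> X" using X(2) dependent_zero by auto
    ultimately show ?thesis by auto
  qed
  then have "card (X \<union> Y) = a + b" using X Y by (simp add: card_Un_disjoint)
  moreover have "span (X \<union> Y) = {x + y | x y. x \<in> A \<and> y \<in> B}"
    unfolding span_Un X(3) Y(3) ..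
  ultimately show ?thesis unfolding findim_def using X(1) Y(1) by (meson finite_UnI)
qed

lemma findim_Times:
  assumes "findim A a" "findim B b"
  shows "findim (A \<times> B) (a + b)"
proof -
  have 0: "0 \<in> A" "0 \<in> B" using assms findim_subspace subspace_0 by auto
  have "findim ((\<lambda>x. (x, 0)) ` A) a"
    by (rule findim_image[OF _ _ assms(1)]) (auto simp: linear_iff inj_on_def)
  moreover have "findim ((\<lambda>x. (0, x)) ` B) b"
    by (rule findim_image[OF _ _ assms(2)]) (auto simp: linear_iff inj_on_def)
  ultimately have "findim {x + y | x y. x \<in> (\<lambda>x. (x, 0)) ` A \<and> y \<in> (\<lambda>x. (0, x)) ` B} (a + b)"
    by (rule findim_direct_sum) (auto simp: zero_prod_def)
  moreover have "{x + y | x y. x \<in> (\<lambda>x. (x, 0)) ` A \<and> y \<in> (\<lambda>x. (0, x)) ` B} = A \<times> B"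
    by force
  ultimately show ?thesis by simp
qed

text \<open>A finite product of spaces, encoded as functions that vanish off the index set.
  Induction splits off the coordinate \<open>j\<close>, embedded by \<open>e\<close>, as a direct
  summand.\<close>

lemma findim_Pi:
  assumes "finite I" "\<And>i. i \<in> I \<Longrightarrow> findim (U i) (d i)"
  shows "findim {f. (\<forall>i\<in>I. f i \<in> U i) \<and> (\<forall>i. i \<notin> I \<longrightarrow> f i = 0)} (\<Sum>i\<in>I. d i)"
  using assms
proof (induction I)
  case empty
  have "{f :: 'a \<Rightarrow> 'b. \<forall>i. f i = 0} = {0}" by (auto simp: fun_eq_iff)
  then show ?case using findim_zero by simp
next
  case (insert j I)
  define P where "P = (\<lambda>I. {f. (\<forall>i\<in>I. f i \<in> U i) \<and> (\<forall>i. i \<notin> I \<longrightarrow> f i = 0)})"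
  define e :: "'b \<Rightarrow> 'a \<Rightarrow> 'b" where "e = (\<lambda>x i. if i = j then x else 0)"
  have 0: "0 \<in> U i" if "i \<in> insert j I" for i
    using insert.prems[OF that] findim_subspace subspace_0 by auto
  have "findim (e ` U j) (d j)"
    by (rule findim_image)
       (auto simp: e_def linear_iff fun_eq_iff inj_on_def scaleR_fun_def insert.prems
             dest: spec[of _ j] split: if_splits)
  moreover have "findim (P I) (\<Sum>i\<in>I. d i)" unfolding P_def by (rule insert.IH) (use insert.prems in auto)
  moreover have "e ` U j \<inter> P I \<subseteq> {0}"
    using insert.hyps by (auto simp: e_def P_def fun_eq_iff)
  ultimately have "findim {x + y | x y. x \<in> e ` U j \<and> y \<in> P I} (d j + (\<Sum>i\<in>I. d i))"
    by (rule findim_direct_sum)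
  moreover have "{x + y | x y. x \<in> e ` U j \<and> y \<in> P I} = P (insert j I)" (is "?L = ?R")
  proof
    show "?L \<subseteq> ?R" using insert.hyps by (auto simp: e_def P_def)
    show "?R \<subseteq> ?L"
    proof
      fix f assume f: "f \<in> ?R"
      have "f = e (f j) + f(j := 0)" by (auto simp: e_def fun_eq_iff)
      moreover have "f(j := 0) \<in> P I" using f insert.hyps by (auto simp: P_def)
      moreover have "f j \<in> U j" using f by (auto simp: P_def)
      ultimately show "f \<in> ?L" by blast
    qed
  qed
  ultimately show ?case using insert.hyps by (simp add: P_def)
qed

lemma findim_real: "findim (UNIV :: real set) 1"
  unfolding findim_def by (rule exI[of _ "{1}"]) (auto simp: span_singleton independent_insert)

text \<open>Fewer than \<open>n\<close> distinct vectors cannot span a space of dimension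
  \<open>n\<close>, and \<open>n\<close> vectors span at most that dimension. So one inclusion
  already gives equality, injectivity and independence.\<close>

lemma findim_spanning:
  fixes b :: "nat \<Rightarrow> 'a::real_vector"
  assumes "findim U n" "U \<subseteq> span (b ` {..<n})"
  shows "span (b ` {..<n}) = U \<and> inj_on b {..<n} \<and> independent (b ` {..<n})"
proof -
  obtain B where B: "finite B" "independent B" "span B = U" "card B = n"
    using assms(1) unfolding findim_def by auto
  let ?T = "b ` {..<n}"
  have T: "finite ?T" by simp
  have BT: "B \<subseteq> span ?T" using B(3) assms(2) span_superset by auto
  have card: "card ?T = n"
    using independent_span_bound[OF T B(2) BT] B(4) card_image_le[of "{..<n}" b] by simp
  have "?T \<subseteq> U"
  proof
    fix x assume x: "x \<in> ?T"
    show "x \<in> U"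
    proof (rule ccontr)
      assume "x \<notin> U"
      then have "independent (insert x B)" "x \<notin> B"
        using B independent_insertI[of x B] span_base[of x B] by auto
      moreover have "insert x B \<subseteq> span ?T" using x BT by (auto intro: span_base)
      ultimately have "card (insert x B) \<le> card ?T" using independent_span_bound[OF T] by blast
      then show False using B(1,4) card \<open>x \<notin> B\<close> by simp
    qed
  qed
  then have sp: "span ?T = U"
    using assms(2) findim_subspace[OF assms(1)] by (metis span_minimal subset_antisym)
  moreover have "inj_on b {..<n}" using card by (simp add: inj_on_iff_eq_card)
  moreover have "independent ?T"
  proof (rule ccontr)
    assume "\<not> independent ?T"
    then obtain a where a: "a \<in> ?T" "a \<in> span (?T - {a})" by (auto simp: dependent_def)
    have "span (?T - {a}) = span ?T" using a by (metis insert_Diff span_redundant)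
    then have "B \<subseteq> span (?T - {a})" using BT by simp
    then have "card B \<le> card (?T - {a})" using independent_span_bound[OF _ B(2)] T by blast
    then show False using a card B(4) T by (metis card_Diff1_less not_less)
  qed
  ultimately show ?thesis by simp
qed

section \<open>Polynomials as a real vector space\<close>

instantiation poly :: (real_field) real_vector
begin

definition scaleR_poly :: "real \<Rightarrow> 'a poly \<Rightarrow> 'a poly" where
  "scaleR_poly c p = smult (of_real c) p"

instance
  by standard (simp_all add: scaleR_poly_def smult_add_right smult_add_left)

end

lemma scaleR_real_poly [simp]: "c *\<^sub>R (p :: real poly) = smult c p"
  by (simp add: scaleR_poly_def)

text \<open>Phrased by coefficients rather than by \<open>degree\<close>, so that
  \<open>m = 0\<close> gives the zero space and the dimension is always \<open>m\<close>.\<close>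

definition poly_below :: "nat \<Rightarrow> real poly set" where
  "poly_below m = {p. \<forall>i\<ge>m. coeff p i = 0}"

lemma poly_below_Suc: "poly_below (Suc m) = {p. degree p \<le> m}"
  by (auto simp: poly_below_def Suc_le_eq intro: degree_le coeff_eq_0)

lemma poly_below_iff: "p \<in> poly_below m \<longleftrightarrow> p = 0 \<or> degree p < m"
proof (cases m)
  case 0
  then show ?thesis by (simp add: poly_below_def poly_eq_iff)
next
  case (Suc n)
  then show ?thesis unfolding Suc poly_below_Suc by (auto simp: less_Suc_eq_le)
qed

lemma findim_fun: "finite I \<Longrightarrow> findim {f :: 'i \<Rightarrow> real. \<forall>i. i \<notin> I \<longrightarrow> f i = 0} (card I)"
  using findim_Pi[of I "\<lambda>_. UNIV :: real set" "\<lambda>_. 1"] findim_real by simp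

lemma findim_poly_below: "findim (poly_below m) m"
proof -
  define h :: "(nat \<Rightarrow> real) \<Rightarrow> real poly" where "h = (\<lambda>f. \<Sum>i<m. monom (f i) i)"
  have c: "coeff (h f) j = (if j < m then f j else 0)" for f j
    by (simp add: h_def coeff_sum sum.delta)
  let ?S = "{f :: nat \<Rightarrow> real. \<forall>i. i \<notin> {..<m} \<longrightarrow> f i = 0}"
  have lin: "linear h" by (auto simp: linear_iff poly_eq_iff c scaleR_fun_def)
  have inj: "inj_on h ?S"
  proof (rule inj_onI)
    fix f g assume a: "f \<in> ?S" "g \<in> ?S" "h f = h g"
    show "f = g"
    proof
      fix j show "f j = g j" using a(1,2) arg_cong[OF a(3), of "\<lambda>p. coeff p j"]
        by (cases "j < m") (auto simp: c)
    qed
  qed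
  have "h ` ?S = poly_below m"
  proof
    show "h ` ?S \<subseteq> poly_below m" by (auto simp: poly_below_def c)
    show "poly_below m \<subseteq> h ` ?S"
    proof
      fix p assume p: "p \<in> poly_below m"
      have "p = h (coeff p)" using p by (auto simp: poly_eq_iff c poly_below_def)
      moreover have "coeff p \<in> ?S" using p by (auto simp: poly_below_def)
      ultimately show "p \<in> h ` ?S" by blast
    qed
  qed
  then show ?thesis using findim_image[OF lin inj findim_fun] by simp
qed

text \<open>Multiplication by \<open>b\<close> is an isomorphism from the possible cofactors onto
  the multiples of \<open>b\<close>.\<close>

lemma findim_dvd_poly:
  assumes "m \<le> q + 1" "b \<noteq> 0" "degree b = m"
  shows "findim {a :: real poly. degree a \<le> q \<and> b dvd a} (q + 1 - m)"
proof -
  have lin: "linear ((*) b)" by (auto simp: linear_iff algebra_simps)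
  have inj: "inj_on ((*) b) (poly_below (q + 1 - m))" using assms by (auto simp: inj_on_def)
  have "(*) b ` poly_below (q + 1 - m) = {a. degree a \<le> q \<and> b dvd a}"
  proof
    show "(*) b ` poly_below (q + 1 - m) \<subseteq> {a. degree a \<le> q \<and> b dvd a}"
    proof (clarsimp simp: poly_below_iff)
      fix h :: "real poly" assume "h = 0 \<or> degree h < Suc q - m"
      then show "degree (b * h) \<le> q" using assms by (cases "h = 0") (auto simp: degree_mult_eq)
    qed
    show "{a. degree a \<le> q \<and> b dvd a} \<subseteq> (*) b ` poly_below (q + 1 - m)"
    proof
      fix a assume a: "a \<in> {a. degree a \<le> q \<and> b dvd a}"
      then obtain h where h: "a = b * h" by auto
      have "h \<in> poly_below (q + 1 - m)"
        using a h assms by (cases "h = 0") (auto simp: poly_below_iff degree_mult_eq)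
      then show "a \<in> (*) b ` poly_below (q + 1 - m)" using h by auto
    qed
  qed
  then show ?thesis using findim_image[OF lin inj findim_poly_below] by simp
qed

section \<open>Piecewise polynomials\<close>

definition trunc :: "real \<Rightarrow> real poly \<Rightarrow> real \<Rightarrow> real" where
  "trunc a b x = (if a \<le> x then poly b x else 0)"

lemma continuous_trunc:
  assumes "poly b a = 0"
  shows "continuous_on UNIV (trunc a b)"
proof -
  have "continuous_on UNIV (\<lambda>x. if x \<le> a then 0 else poly b x)"
    by (rule continuous_on_cases_le) (auto intro!: continuous_intros simp: assms)
  moreover have "trunc a b = (\<lambda>x. if x \<le> a then 0 else poly b x)"
    using assms by (auto simp: trunc_def fun_eq_iff)
  ultimately show ?thesis by (simp only:)
qed

text \<open>At \<open>a\<close> the two one-sided derivatives are \<open>0\<close> and the value of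
  \<open>pderiv b\<close>, which agree because \<open>a\<close> is a double root of
  \<open>b\<close>.\<close>

lemma has_derivative_trunc:
  assumes "poly b a = 0" "poly (pderiv b) a = 0"
  shows "(trunc a b has_vector_derivative trunc a (pderiv b) x) (at x)"
proof -
  have cl: "closure {..<a} = {..a}" by (rule closure_lessThan)
  have "((\<lambda>x. if x \<in> {a..} then poly b x else 0) has_vector_derivative
      (if x \<in> {a..} then poly (pderiv b) x else 0)) (at x within UNIV)"
    by (rule has_vector_derivative_If_within_closures[where T = "{..<a}"])
       (auto simp: cl assms intro!: has_real_derivative_iff_has_vector_derivative[THEN iffD1]
          poly_DERIV[THEN DERIV_subset])
  then show ?thesis unfolding trunc_def by simp
qed

locale knots =
  fixes k :: nat and \<tau> :: "nat \<Rightarrow> real"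
  assumes inner_knots: "inner_knots k \<tau>"
begin

text \<open>The polynomial \<open>c 0\<close> followed by the jumps \<open>c i\<close> at the inner knots.\<close>

definition pw :: "(nat \<Rightarrow> real poly) \<Rightarrow> real \<Rightarrow> real" where
  "pw c x = poly (c 0) x + (\<Sum>i\<in>{1..k}. trunc (\<tau> i) (c i) x)"

abbreviation M :: "nat \<Rightarrow> real poly" where "M i \<equiv> [:- \<tau> i, 1:]"

text \<open>Divisibility by the power \<open>s + 1\<close> keeps \<open>s\<close> derivatives
  continuous across the knot. Index \<open>0\<close> belongs to the leading polynomial, which is not
  attached to a knot.\<close>

definition jumps :: "nat \<Rightarrow> nat \<Rightarrow> nat \<Rightarrow> real poly set" where
  "jumps q s i = {a. degree a \<le> q \<and> (i = 0 \<or> M i ^ (s + 1) dvd a)}"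

definition pfam :: "nat \<Rightarrow> nat \<Rightarrow> (nat \<Rightarrow> real poly) set" where
  "pfam q s = {c. (\<forall>i\<in>{..k}. c i \<in> jumps q s i) \<and> (\<forall>i. i \<notin> {..k} \<longrightarrow> c i = 0)}"

lemma tau_01: "i \<in> {1..k} \<Longrightarrow> 0 < \<tau> i \<and> \<tau> i < 1"
  using inner_knots by (auto simp: inner_knots_def)

lemma tau_less: "1 \<le> i \<Longrightarrow> i < j \<Longrightarrow> j \<le> k \<Longrightarrow> \<tau> i < \<tau> j"
  using inner_knots by (auto simp: inner_knots_def strict_mono_on_def)

lemma pw_0: "pw (\<lambda>i. 0) x = 0" "pw 0 x = 0"
  by (simp_all add: pw_def trunc_def cong: if_cong)

lemma pw_add: "pw (\<lambda>i. c i + d i) x = pw c x + pw d x"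
  by (simp add: pw_def trunc_def sum.distrib[symmetric] if_distrib cong: if_cong)

lemma pw_mult: "pw (\<lambda>i. b * c i) x = poly b x * pw c x"
  by (simp add: pw_def trunc_def sum_distrib_left algebra_simps if_distrib cong: if_cong)

lemma pw_smult: "pw (\<lambda>i. smult b (c i)) x = b * pw c x"
  using pw_mult[of "[:b:]" c x] by simp

lemma pw_diff: "pw (\<lambda>i. c i - d i) x = pw c x - pw d x"
  using pw_add[of c "\<lambda>i. smult (-1) (d i)" x] pw_smult[of "-1" d x] by simp

lemma pw_sum: "finite I \<Longrightarrow> pw (\<lambda>i. \<Sum>j\<in>I. c j i) x = (\<Sum>j\<in>I. pw (c j) x)"
  by (induction I rule: finite_induct) (auto simp: pw_add pw_0)

text \<open>From left to right: between knot \<open>i\<close> and the next one, earlier jumps vanish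
  by induction and later ones have not begun, so \<open>c i\<close> is a polynomial with infinitely
  many zeros. This makes jump polynomials unique.\<close>

lemma pw_eq_0:
  assumes "\<And>x. x \<in> {0..1} \<Longrightarrow> pw c x = 0" "i \<le> k"
  shows "c i = 0"
  using assms(2)
proof (induction i rule: less_induct)
  case (less i)
  define lo where "lo = (if i = 0 then 0 else \<tau> i)"
  define up where "up = (if i < k then \<tau> (i + 1) else 1)"
  have lu: "0 \<le> lo" "lo < up" "up \<le> 1"
    using less.prems tau_01[of i] tau_01[of "i+1"] tau_less[of i "i + 1"]
    by (auto simp: lo_def up_def)
  have "poly (c i) x = 0" if x: "x \<in> {lo..<up}" for x
  proof -
    have tr: "trunc (\<tau> j) (c j) x = (if j = i then poly (c i) x else 0)" if j: "j \<in> {1..k}" for j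
    proof (cases j i rule: linorder_cases)
      case less
      then show ?thesis using less.IH[of j] j by (simp add: trunc_def)
    next
      case equal
      then show ?thesis using x j by (auto simp: trunc_def lo_def)
    next
      case greater
      then have "\<tau> (i + 1) \<le> \<tau> j" using tau_less[of "i + 1" j] j by (cases "j = i + 1") auto
      then show ?thesis using greater x j by (auto simp: trunc_def up_def)
    qed
    have "pw c x = poly (c 0) x + (\<Sum>j\<in>{1..k}. if j = i then poly (c i) x else 0)"
      unfolding pw_def using tr by simp
    also have "\<dots> = poly (c i) x"
      using less.IH[of 0] less.prems by (cases "i = 0") auto
    finally show ?thesis using assms(1)[of x] x lu by simp
  qed
  then have "{lo..<up} \<subseteq> {x. poly (c i) x = 0}" by auto
  moreover have "infinite {lo..<up}" using lu by (simp add: infinite_Ico)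
  ultimately show ?case using poly_roots_finite finite_subset by blast
qed

lemma findim_jumps: "s \<le> q \<Longrightarrow> findim (jumps q s i) (if i = 0 then q + 1 else q - s)"
  using findim_dvd_poly[of "s + 1" q "M i ^ (s + 1)"] findim_dvd_poly[of 0 q 1]
  by (auto simp: jumps_def degree_power_eq simp del: power_Suc)

text \<open>The leading polynomial has \<open>q + 1\<close> free coefficients and each knot adds
  \<open>q - s\<close>. The total is the number of B-splines for this degree and regularity.\<close>

lemma findim_pfam:
  assumes "s \<le> q"
  shows "findim (pfam q s) (q + 1 + k * (q - s))"
proof -
  have "(\<Sum>i\<in>{..k}. if i = 0 then q + 1 else q - s) = q + 1 + k * (q - s)"
    by (simp add: sum.atMost_shift)
  then show ?thesis
    unfolding pfam_def
    using findim_Pi[of "{..k}" "jumps q s" "\<lambda>i. if i = 0 then q + 1 else q - s"]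
      findim_jumps[OF assms] by simp
qed

lemma pfam_dvd: "c \<in> pfam q s \<Longrightarrow> i \<in> {1..k} \<Longrightarrow> M i ^ (s + 1) dvd c i"
  unfolding pfam_def jumps_def by (drule CollectD) (auto simp del: power_Suc dest!: bspec[of _ _ i])

lemma pfam_root: "c \<in> pfam q s \<Longrightarrow> i \<in> {1..k} \<Longrightarrow> poly (c i) (\<tau> i) = 0"
  unfolding poly_eq_0_iff_dvd by (rule dvd_trans[OF dvd_power pfam_dvd]) auto

lemma pfam_pderiv_root:
  assumes "c \<in> pfam q s" "1 \<le> s" "i \<in> {1..k}"
  shows "poly (pderiv (c i)) (\<tau> i) = 0"
proof -
  have "M i ^ (s + 1) dvd c i" using assms pfam_dvd by auto
  then obtain h where "c i = M i ^ (Suc s) * h" by auto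
  then show ?thesis using assms by (simp add: lemma_order_pderiv1 del: power_Suc)
qed

lemma continuous_pw:
  assumes "\<And>i. i \<in> {1..k} \<Longrightarrow> poly (c i) (\<tau> i) = 0"
  shows "continuous_on UNIV (pw c)"
proof -
  have "continuous_on UNIV (\<lambda>x. poly (c 0) x + (\<Sum>i\<in>{1..k}. trunc (\<tau> i) (c i) x))"
    using assms by (intro continuous_intros continuous_trunc) auto
  then show ?thesis unfolding pw_def[abs_def] .
qed

lemma has_derivative_pw:
  assumes "c \<in> pfam q s" "1 \<le> s"
  shows "(pw c has_real_derivative pw (\<lambda>i. pderiv (c i)) x) (at x)"
proof -
  have "((\<lambda>x. poly (c 0) x + (\<Sum>i\<in>{1..k}. trunc (\<tau> i) (c i) x)) has_vector_derivative
      poly (pderiv (c 0)) x + (\<Sum>i\<in>{1..k}. trunc (\<tau> i) (pderiv (c i)) x)) (at x)"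
    using pfam_root[OF assms(1)] pfam_pderiv_root[OF assms]
    by (intro has_vector_derivative_add has_vector_derivative_sum has_derivative_trunc
        has_real_derivative_iff_has_vector_derivative[THEN iffD1] poly_DERIV) auto
  then show ?thesis
    unfolding pw_def[abs_def] has_real_derivative_iff_has_vector_derivative .
qed

end

section \<open>Marsden's identity\<close>

locale knot_list =
  fixes t :: "real list" and p :: nat
  assumes sorted: "sorted t"
    and length: "2 * p + 2 \<le> length t"
    and clamped: "t ! 0 = t ! p" "t ! (length t - p - 1) = last t"
    and nontrivial: "t ! 0 < last t"
begin

lemma nth_mono: "i \<le> j \<Longrightarrow> j < length t \<Longrightarrow> t ! i \<le> t ! j"
  using sorted by (rule sorted_nth_mono)

lemma last_eq: "last t = t ! (length t - 1)"
  using length by (intro last_conv_nth) auto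

lemma le_last: "i < length t \<Longrightarrow> t ! i \<le> last t"
  unfolding last_eq by (rule nth_mono) auto

text \<open>Both lower-degree B-splines in the recursion have empty spans too. This removes the
  boundary terms in Marsden's identity.\<close>

lemma bspline_empty_span:
  "i + q + 1 < length t \<Longrightarrow> t ! i = t ! (i + q + 1) \<Longrightarrow> bspline t q i x = 0"
proof (induction q arbitrary: i)
  case 0
  then show ?case by simp
next
  case (Suc q)
  have le: "t ! i \<le> t ! (i + 1)" "t ! i \<le> t ! (i + q + 1)"
    "t ! (i + 1) \<le> t ! (i + 1 + q + 1)" "t ! (i + q + 1) \<le> t ! (i + 1 + q + 1)"
    using Suc.prems(1) by (auto intro!: nth_mono)
  have eq: "t ! i = t ! (i + 1 + q + 1)" using Suc.prems(2) by simp
  have "t ! i = t ! (i + q + 1)" "t ! (i + 1) = t ! (i + 1 + q + 1)"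
    using le eq by linarith+
  then show ?case using Suc.IH[of i] Suc.IH[of "i + 1"] Suc.prems by simp
qed

text \<open>The alternative at \<open>last t\<close> reflects the convention that the last nonempty
  span contains its right end point.\<close>

lemma bspline_support:
  "i + q + 1 < length t \<Longrightarrow> bspline t q i x \<noteq> 0 \<Longrightarrow>
    t ! i \<le> x \<and> (x < t ! (i + q + 1) \<or> x = last t \<and> t ! (i + q + 1) = last t)"
proof (induction q arbitrary: i)
  case 0
  then show ?case by (auto split: if_splits)
next
  case (Suc q)
  have *: "t ! i \<le> t ! (i + 1)" "t ! (i + q + 1) \<le> t ! (i + q + 2)" "t ! (i + q + 2) \<le> last t"
    using Suc.prems(1) by (auto intro!: nth_mono le_last)
  have "bspline t q i x \<noteq> 0 \<or> bspline t q (i + 1) x \<noteq> 0" using Suc.prems(2) by auto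
  then show ?case
  proof
    assume "bspline t q i x \<noteq> 0"
    then show ?thesis using Suc.IH[of i] Suc.prems(1) * by auto
  next
    assume "bspline t q (i + 1) x \<noteq> 0"
    then show ?thesis using Suc.IH[of "i + 1"] Suc.prems(1) * by auto
  qed
qed

lemma sum_bspline_0:
  assumes "t ! 0 \<le> x" "x \<le> last t"
  shows "(\<Sum>i<length t - 1. bspline t 0 i x) = 1"
proof -
  \<comment> \<open>The B-splines of degree 0 are differences of consecutive values of
    \<open>H\<close>, so their sum telescopes. The condition \<open>t ! i < last t\<close> makes
    this true at the right end point as well.\<close>
  define H :: "nat \<Rightarrow> real" where "H = (\<lambda>i. if t ! i \<le> x \<and> t ! i < last t then 1 else 0)"
  have "bspline t 0 i x = H i - H (Suc i)" if "i < length t - 1" for i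
  proof -
    have i: "Suc i < length t" using that by linarith
    have *: "(if a \<le> x \<and> x < b \<or> a < b \<and> b = z \<and> x = z then 1 else 0 :: real)
        = (if a \<le> x \<and> a < z then 1 else 0) - (if b \<le> x \<and> b < z then 1 else 0)"
      if "a \<le> b" "b \<le> z" "x \<le> z" for a b z :: real
      using that by smt
    have "t ! i \<le> t ! Suc i" using i by (intro nth_mono) auto
    from *[OF this le_last[OF i] assms(2)] show ?thesis by (simp add: H_def)
  qed
  then have "(\<Sum>i<length t - 1. bspline t 0 i x) = (\<Sum>i<length t - 1. H i - H (Suc i))"
    by (intro sum.cong) auto
  also have "\<dots> = H 0 - H (length t - 1)" by (rule sum_lessThan_telescope')
  also have "\<dots> = 1" using assms nontrivial by (simp add: H_def last_eq)
  finally show ?thesis .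
qed

text \<open>Induction on the degree: expand by the recursion and regroup by lower-degree B-splines.
  The two contributions to each of them combine to the factor \<open>c - x\<close>, and the first
  and last ones vanish by clamping.\<close>

lemma marsden:
  assumes "t ! 0 \<le> x" "x \<le> last t"
  shows "q \<le> p \<Longrightarrow>
    (\<Sum>i<length t - q - 1. (\<Prod>l<q. c - t ! (i + 1 + l)) * bspline t q i x) = (c - x) ^ q"
proof (induction q)
  case 0
  then show ?case using sum_bspline_0[OF assms] by simp
next
  case (Suc q)
  define n where "n = length t - Suc q - 1"
  have n: "length t - q - 1 = Suc n" "n + q + 1 = length t - 1" "0 < n"
    using Suc.prems length by (auto simp: n_def)
  define \<psi> where "\<psi> = (\<lambda>q i. \<Prod>l<q. c - t ! (i + 1 + l))"
  define w where "w = (\<lambda>i. (x - t ! i) / (t ! (i + q + 1) - t ! i))"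
  define v where "v = (\<lambda>i. (t ! (i + q + 1) - x) / (t ! (i + q + 1) - t ! i))"
  \<comment> \<open>\<open>F i\<close> and \<open>G i\<close> are the contributions of the
    \<open>i\<close>-th lower-degree B-spline to the B-splines \<open>i\<close> and
    \<open>i - 1\<close> of degree \<open>Suc q\<close>. The truncated \<open>0 - 1\<close> in
    \<open>G 0\<close> is harmless, since that B-spline vanishes.\<close>
  define F where "F = (\<lambda>i. \<psi> (Suc q) i * (w i * bspline t q i x))"
  define G where "G = (\<lambda>i. \<psi> (Suc q) (i - 1) * (v i * bspline t q i x))"
  have "t ! 0 = t ! (0 + q + 1)"
    using nth_mono[of 0 "q + 1"] nth_mono[of "q + 1" p] clamped(1) Suc.prems length by auto
  then have B0: "bspline t q 0 x = 0" using bspline_empty_span[of 0 q] Suc.prems length by auto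
  have "length t - p - 1 \<le> n" "n < length t" using Suc.prems length by (auto simp: n_def)
  then have "t ! n = t ! (n + q + 1)"
    using nth_mono[of "length t - p - 1" n] le_last[of n] clamped(2)
    unfolding n(2) last_eq by auto
  then have Bn: "bspline t q n x = 0" using bspline_empty_span[of n q] n by auto
  have FG: "F i + G i = (c - x) * (\<psi> q i * bspline t q i x)" if i: "i < Suc n" for i
  proof (cases "i = 0 \<or> i = n \<or> t ! i = t ! (i + q + 1)")
    case True
    then have "bspline t q i x = 0"
      using B0 Bn bspline_empty_span[of i q] i n by auto
    then show ?thesis by (simp add: F_def G_def)
  next
    case False
    then obtain j where j: "i = Suc j" by (cases i) auto
    have p1: "\<psi> (Suc q) i = \<psi> q i * (c - t ! (i + q + 1))" by (simp add: \<psi>_def)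
    have p2: "\<psi> (Suc q) (i - 1) = (c - t ! i) * \<psi> q i"
      unfolding \<psi>_def j by (simp add: prod.lessThan_Suc_shift del: prod.lessThan_Suc)
    have "t ! (i + q + 1) - t ! i \<noteq> 0" using False by auto
    then have "(c - t ! (i + q + 1)) * w i + (c - t ! i) * v i = c - x"
      unfolding w_def v_def by (simp add: divide_simps) (simp add: algebra_simps)
    then have "\<psi> q i * bspline t q i x * ((c - t ! (i + q + 1)) * w i + (c - t ! i) * v i)
        = \<psi> q i * bspline t q i x * (c - x)" by simp
    then show ?thesis unfolding F_def G_def p1 p2 by (simp add: algebra_simps)
  qed
  have "(\<Sum>i<n. \<psi> (Suc q) i * bspline t (Suc q) i x) = (\<Sum>i<n. F i) + (\<Sum>i<n. G (Suc i))"
    unfolding sum.distrib[symmetric]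
    by (rule sum.cong) (auto simp: F_def G_def w_def v_def algebra_simps)
  also have "(\<Sum>i<n. F i) = (\<Sum>i<Suc n. F i)" using Bn by (simp add: F_def)
  also have "(\<Sum>i<n. G (Suc i)) = (\<Sum>i<Suc n. G i)"
    using B0 by (simp add: sum.lessThan_Suc_shift G_def del: sum.lessThan_Suc)
  also have "(\<Sum>i<Suc n. F i) + (\<Sum>i<Suc n. G i) = (\<Sum>i<Suc n. (c - x) * (\<psi> q i * bspline t q i x))"
    unfolding sum.distrib[symmetric] by (rule sum.cong) (auto simp: FG)
  also have "\<dots> = (c - x) * (\<Sum>i<Suc n. \<psi> q i * bspline t q i x)"
    by (simp only: sum_distrib_left)
  also have "\<dots> = (c - x) ^ Suc q" using Suc.IH Suc.prems n(1) by (simp add: \<psi>_def)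
  finally show ?case unfolding \<psi>_def n_def .
qed

text \<open>The dual polynomial of the \<open>i\<close>-th B-spline; its variable is the offset of
  the Marsden parameter from \<open>c\<close>.\<close>

definition \<psi> :: "real \<Rightarrow> nat \<Rightarrow> real poly" where
  "\<psi> c i = (\<Prod>l<p. [:c - t ! (i + 1 + l), 1:])"

text \<open>Marsden's identity for all parameters is an identity of polynomials in the offset, with
  right-hand side the \<open>p\<close>-th power of \<open>[:c - x, 1:]\<close>. The claim compares
  its coefficients of order \<open>p - m\<close>.\<close>

lemma marsden_coeff:
  assumes "t ! 0 \<le> x" "x \<le> last t" "m \<le> p"
  shows "(\<Sum>i<length t - p - 1. coeff (\<psi> c i) (p - m) * bspline t p i x)
    = of_nat (p choose m) * (c - x) ^ m"
proof -
  have "(\<Sum>i<length t - p - 1. smult (bspline t p i x) (\<psi> c i)) = [:c - x, 1:] ^ p"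
  proof (rule poly_ext)
    fix y
    have "poly (\<Sum>i<length t - p - 1. smult (bspline t p i x) (\<psi> c i)) y
        = (\<Sum>i<length t - p - 1. (\<Prod>l<p. (y + c) - t ! (i + 1 + l)) * bspline t p i x)"
      by (auto simp: poly_sum poly_prod \<psi>_def mult.commute intro!: sum.cong prod.cong)
    also have "\<dots> = (y + c - x) ^ p" using marsden[OF assms(1,2)] by blast
    finally show "poly (\<Sum>i<length t - p - 1. smult (bspline t p i x) (\<psi> c i)) y
        = poly ([:c - x, 1:] ^ p) y"
      by (simp add: algebra_simps)
  qed
  then have "coeff (\<Sum>i<length t - p - 1. smult (bspline t p i x) (\<psi> c i)) (p - m)
      = coeff ([:c - x, 1:] ^ p) (p - m)" by simp
  then show ?thesis using assms(3)
    by (simp add: coeff_sum coeff_linear_poly_power binomial_symmetric[OF assms(3), symmetric] mult.commute)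
qed

text \<open>The B-splines that start left of a knot \<open>c\<close> of multiplicity \<open>\<mu>\<close> but do not vanish right of it
  have all copies of \<open>c\<close> as inner knots, so that their dual polynomials have a \<open>\<mu>\<close>-fold zero at \<open>0\<close>.\<close>

lemma truncated_marsden:
  assumes x: "t ! 0 \<le> x" "x \<le> last t" and m: "m \<le> p" "p - m < \<mu>"
    and c: "\<And>l. l < \<mu> \<Longrightarrow> t ! (i0 + l) = c" "i0 + \<mu> \<le> length t" "c < last t"
  shows "(\<Sum>i<length t - p - 1. (if i0 \<le> i then coeff (\<psi> c i) (p - m) else 0) * bspline t p i x)
    = of_nat (p choose m) * (if c \<le> x then (c - x) ^ m else 0)"
proof (cases "c \<le> x")
  case True
  have z: "coeff (\<psi> c i) (p - m) * bspline t p i x = 0" if i: "i < length t - p - 1" "i < i0" for i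
  proof (cases "bspline t p i x = 0")
    case False
    moreover have "i + p + 1 < length t" using i by linarith
    ultimately have "c < t ! (i + p + 1)" using bspline_support[of i p x] c(3) True by auto
    moreover have "t ! (i + p + 1) \<le> c" if "i + p + 1 \<le> i0 + \<mu> - 1"
      using nth_mono[OF that] c(1)[of "\<mu> - 1"] c(2) m by auto
    ultimately have ge: "i0 + \<mu> \<le> i + p + 1" by linarith
    \<comment> \<open>These are the positions of the \<mu> copies of \<open>c\<close> among the
      factors of \<open>\<psi> c i\<close>. Each such factor is the bare variable, so coefficients
      of order below \<mu> vanish.\<close>
    define J where "J = {i0 - i - 1..<i0 - i - 1 + \<mu>}"
    have J: "J \<subseteq> {..<p}" using ge i by (auto simp: J_def)
    have "(\<Prod>l\<in>J. [:c - t ! (i + 1 + l), 1:]) = (\<Prod>l\<in>J. monom 1 1)"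
    proof (rule prod.cong)
      fix l assume l: "l \<in> J"
      have "t ! (i0 + (i + 1 + l - i0)) = c" using l i by (intro c(1)) (auto simp: J_def)
      moreover have "i0 + (i + 1 + l - i0) = i + 1 + l" using l i by (auto simp: J_def)
      ultimately show "[:c - t ! (i + 1 + l), 1:] = monom 1 1" by (simp add: monom_Suc)
    qed simp
    then have "\<psi> c i = monom 1 \<mu> * (\<Prod>l\<in>{..<p} - J. [:c - t ! (i + 1 + l), 1:])"
      unfolding \<psi>_def using prod.subset_diff[OF J, of "\<lambda>l. [:c - t ! (i + 1 + l), 1:]"]
      by (simp add: J_def monom_power mult.commute)
    then have "coeff (\<psi> c i) (p - m) = 0" using m by (simp add: coeff_monom_mult)
    then show ?thesis by simp
  qed simp
  have "(\<Sum>i<length t - p - 1. (if i0 \<le> i then coeff (\<psi> c i) (p - m) else 0) * bspline t p i x)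
      = (\<Sum>i<length t - p - 1. coeff (\<psi> c i) (p - m) * bspline t p i x)"
  proof (rule sum.cong)
    fix i assume "i \<in> {..<length t - p - 1}"
    then show "(if i0 \<le> i then coeff (\<psi> c i) (p - m) else 0) * bspline t p i x
        = coeff (\<psi> c i) (p - m) * bspline t p i x"
      using z[of i] by (cases "i0 \<le> i") auto
  qed simp
  then show ?thesis using marsden_coeff[OF x m(1)] True by simp
next
  case False
  have "bspline t p i x = 0" if i: "i < length t - p - 1" "i0 \<le> i" for i
  proof (rule ccontr)
    assume "bspline t p i x \<noteq> 0"
    moreover have "i + p + 1 < length t" "i < length t" using i by linarith+
    ultimately have "t ! i \<le> x" "t ! i0 \<le> t ! i"
      using bspline_support[of i p x] nth_mono[of i0 i] i(2) by blast+
    moreover have "t ! i0 = c" using c(1)[of 0] m by simp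
    ultimately show False using False by simp
  qed
  then have "(\<Sum>i<length t - p - 1. (if i0 \<le> i then coeff (\<psi> c i) (p - m) else 0) * bspline t p i x) = 0"
    by (intro sum.neutral ballI) simp
  then show ?thesis using False by simp
qed

end

section \<open>Univariate splines\<close>

locale splines = knots +
  fixes p r :: nat
  assumes r: "1 \<le> r" "r \<le> p - 2" and p: "3 \<le> p"
begin

abbreviation n :: nat where "n \<equiv> p + k * (p - r)"

abbreviation B :: "nat \<Rightarrow> real \<Rightarrow> real" where "B \<equiv> N p r k \<tau>"

definition t :: "real list" where "t = open_knots p r k \<tau>"

section \<open>The open knot vector\<close>

definition mid :: "nat \<Rightarrow> real list" where
  "mid j = concat (map (\<lambda>i. replicate (p - r) (\<tau> i)) [1..<j + 1])"

lemma mid_Suc: "mid (Suc j) = mid j @ replicate (p - r) (\<tau> (Suc j))"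
  by (simp add: mid_def)

lemma length_mid: "length (mid j) = j * (p - r)"
  by (induction j) (auto simp: mid_Suc, simp add: mid_def)

lemma set_mid: "set (mid j) \<subseteq> \<tau> ` {1..j}"
  by (auto simp: mid_def)

lemma sorted_mid: "j \<le> k \<Longrightarrow> sorted (mid j)"
proof (induction j)
  case 0
  then show ?case by (simp add: mid_def)
next
  case (Suc j)
  have "x \<le> \<tau> (Suc j)" if "x \<in> set (mid j)" for x
    using that set_mid[of j] tau_less[of _ "Suc j"] Suc.prems by (force intro: less_imp_le)
  then show ?case using Suc by (simp add: mid_Suc sorted_append)
qed

lemma mid_nth: "j \<le> k \<Longrightarrow> 1 \<le> i \<Longrightarrow> i \<le> j \<Longrightarrow> l < p - r \<Longrightarrow> mid j ! ((i - 1) * (p - r) + l) = \<tau> i"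
proof (induction j)
  case 0
  then show ?case by simp
next
  case (Suc j)
  show ?case
  proof (cases "i = Suc j")
    case True
    then show ?thesis using Suc.prems by (simp add: mid_Suc nth_append length_mid)
  next
    case False
    then have "Suc (i - 1) \<le> j" using Suc.prems by auto
    then have "Suc (i - 1) * (p - r) \<le> j * (p - r)" by (rule mult_le_mono1)
    then have "(i - 1) * (p - r) + l < j * (p - r)" using Suc.prems unfolding mult_Suc by linarith
    then show ?thesis using Suc.IH Suc.prems False by (simp add: mid_Suc nth_append length_mid)
  qed
qed

lemma t_eq: "t = replicate (p + 1) 0 @ mid k @ replicate (p + 1) 1"
  by (simp add: t_def open_knots_def mid_def)

lemma length_t: "length t = n + p + 2"
  by (simp add: t_eq length_mid)

lemma t_0: "i \<le> p \<Longrightarrow> t ! i = 0"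
  by (simp add: t_eq nth_append del: replicate_Suc)

lemma t_1: "n < i \<Longrightarrow> i < length t \<Longrightarrow> t ! i = 1"
  by (simp add: t_eq nth_append length_mid del: replicate_Suc)

lemma t_mid: "i \<in> {1..k} \<Longrightarrow> l < p - r \<Longrightarrow> t ! (p + 1 + (i - 1) * (p - r) + l) = \<tau> i"
proof -
  assume i: "i \<in> {1..k}" and l: "l < p - r"
  have "Suc (i - 1) * (p - r) \<le> k * (p - r)" using i by (intro mult_le_mono1) auto
  then have "(i - 1) * (p - r) + l < k * (p - r)" using l by simp
  then show ?thesis using mid_nth[of k i l] i l
    by (simp add: t_eq nth_append length_mid add.assoc)
qed

lemma last_t: "last t = 1"
  by (simp add: t_eq)

lemma mid_bounds: "x \<in> set (mid k) \<Longrightarrow> 0 < x \<and> x < 1"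
  using set_mid[of k] tau_01 by auto

lemma t_pos: "i > p \<Longrightarrow> i < length t \<Longrightarrow> 0 < t ! i"
  using mid_bounds[of "mid k ! (i - p - 1)"]
  by (auto simp: t_eq nth_append length_mid simp del: replicate_Suc)

sublocale knot_list t p
proof
  show "sorted t"
    using sorted_mid[of k] mid_bounds by (force simp: t_eq sorted_append)
  show "2 * p + 2 \<le> length t" by (simp add: length_t)
  show "t ! 0 = t ! p" by (simp add: t_0)
  have "t ! (length t - p - 1) = 1" by (rule t_1) (auto simp: length_t)
  then show "t ! (length t - p - 1) = last t" by (simp add: last_t)
  show "t ! 0 < last t" by (simp add: t_0 last_t)
qed

lemma B_eq: "B i = bspline t p i"
  by (simp add: N_def t_def)

section \<open>Powers and truncated powers as splines\<close>

definition spline :: "(nat \<Rightarrow> real) \<Rightarrow> real \<Rightarrow> real" where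
  "spline x v = (\<Sum>i\<le>n. x i * B i v)"

lemma lessThan_n: "{..<length t - p - 1} = {..n}"
  by (auto simp: length_t)

text \<open>Marsden's identity at \<open>c = 0\<close> represents \<open>C * v ^ m\<close>, where
  \<open>C\<close> is the binomial coefficient with the sign from
  \<open>(0 - v) ^ m\<close>.\<close>

lemma power_is_spline:
  assumes "m \<le> p"
  shows "\<exists>x. \<forall>v\<in>{0..1}. spline x v = v ^ m"
proof (intro exI ballI)
  fix v :: real assume v: "v \<in> {0..1}"
  define C :: real where "C = of_nat (p choose m) * (-1) ^ m"
  have "C \<noteq> 0" using assms by (simp add: C_def)
  have "spline (\<lambda>i. coeff (\<psi> 0 i) (p - m) / C) v
      = (\<Sum>i\<le>n. coeff (\<psi> 0 i) (p - m) * bspline t p i v) / C"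
    by (simp add: spline_def B_eq sum_divide_distrib)
  also have "(\<Sum>i\<le>n. coeff (\<psi> 0 i) (p - m) * bspline t p i v) = of_nat (p choose m) * (0 - v) ^ m"
    unfolding lessThan_n[symmetric] using marsden_coeff[of v m 0] v assms by (simp add: t_0 last_t)
  also have "\<dots> = C * v ^ m" by (simp add: C_def power_minus')
  finally show "spline (\<lambda>i. coeff (\<psi> 0 i) (p - m) / C) v = v ^ m" using \<open>C \<noteq> 0\<close> by simp
qed

text \<open>The knot \<open>\<tau> j\<close> has \<open>p - r\<close> copies starting at index
  \<open>i0\<close>; the truncated identity then needs \<open>p - m < p - r\<close>, which is
  \<open>r < m\<close>.\<close>

lemma trunc_power_is_spline:
  assumes "r < m" "m \<le> p" "j \<in> {1..k}"
  shows "\<exists>x. \<forall>v\<in>{0..1}. spline x v = trunc (\<tau> j) (M j ^ m) v"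
proof (intro exI ballI)
  fix v :: real assume v: "v \<in> {0..1}"
  define i0 where "i0 = p + 1 + (j - 1) * (p - r)"
  define C :: real where "C = of_nat (p choose m) * (-1) ^ m"
  have "C \<noteq> 0" using assms by (simp add: C_def)
  have "Suc (j - 1) * (p - r) \<le> k * (p - r)" using assms by (intro mult_le_mono1) auto
  then have i0: "i0 + (p - r) \<le> length t" by (simp add: i0_def length_t)
  let ?x = "\<lambda>i. (if i0 \<le> i then coeff (\<psi> (\<tau> j) i) (p - m) else 0)"
  have "spline (\<lambda>i. ?x i / C) v = (\<Sum>i\<le>n. ?x i * bspline t p i v) / C"
    by (simp add: spline_def B_eq sum_divide_distrib)
  also have "(\<Sum>i\<le>n. ?x i * bspline t p i v)
      = of_nat (p choose m) * (if \<tau> j \<le> v then (\<tau> j - v) ^ m else 0)"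
    unfolding lessThan_n[symmetric]
    using v assms i0 tau_01[of j] t_mid[of j]
    by (intro truncated_marsden[where \<mu> = "p - r"]) (auto simp: t_0 last_t i0_def)
  also have "\<dots> = C * trunc (\<tau> j) (M j ^ m) v"
    using power_minus'[of "v - \<tau> j" m] by (simp add: C_def trunc_def poly_power)
  finally show "spline (\<lambda>i. ?x i / C) v = trunc (\<tau> j) (M j ^ m) v" using \<open>C \<noteq> 0\<close> by simp
qed

lemma r_less: "r < p"
  using r(2) p by linarith

lemma spline_add: "spline (\<lambda>i. x i + y i) v = spline x v + spline y v"
  by (simp add: spline_def distrib_right sum.distrib)

lemma spline_scale: "spline (\<lambda>i. c * x i) v = c * spline x v"
  by (simp add: spline_def sum_distrib_left mult.assoc)

definition is_spline :: "(real \<Rightarrow> real) \<Rightarrow> bool" where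
  "is_spline f \<longleftrightarrow> (\<exists>x. \<forall>v\<in>{0..1}. spline x v = f v)"

lemma is_spline_add: "is_spline f \<Longrightarrow> is_spline g \<Longrightarrow> is_spline (\<lambda>v. f v + g v)"
  unfolding is_spline_def
proof (elim exE)
  fix x y assume "\<forall>v\<in>{0..1}. spline x v = f v" "\<forall>v\<in>{0..1}. spline y v = g v"
  then show "\<exists>x. \<forall>v\<in>{0..1}. spline x v = f v + g v"
    by (intro exI[of _ "\<lambda>i. x i + y i"]) (simp add: spline_add)
qed

lemma is_spline_scale: "is_spline f \<Longrightarrow> is_spline (\<lambda>v. c * f v)"
  unfolding is_spline_def
proof (elim exE)
  fix x assume "\<forall>v\<in>{0..1}. spline x v = f v"
  then show "\<exists>x. \<forall>v\<in>{0..1}. spline x v = c * f v"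
    by (intro exI[of _ "\<lambda>i. c * x i"]) (simp add: spline_scale)
qed

lemma is_spline_sum:
  "finite I \<Longrightarrow> (\<And>i. i \<in> I \<Longrightarrow> is_spline (f i)) \<Longrightarrow> is_spline (\<lambda>v. \<Sum>i\<in>I. f i v)"
proof (induction I rule: finite_induct)
  case empty
  have "spline (\<lambda>_. 0) v = 0" for v by (simp add: spline_def)
  then show ?case by (auto simp: is_spline_def)
next
  case (insert j I)
  then show ?case by (simp add: is_spline_add)
qed

lemma is_spline_poly:
  assumes "degree a \<le> p"
  shows "is_spline (poly a)"
proof -
  have "is_spline (\<lambda>v. \<Sum>i\<le>degree a. coeff a i * v ^ i)"
    using power_is_spline assms
    by (intro is_spline_sum is_spline_scale) (auto simp: is_spline_def)
  then show ?thesis by (simp add: poly_altdef[abs_def])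
qed

lemma is_spline_trunc:
  assumes j: "j \<in> {1..k}" and a: "degree a \<le> p" "M j ^ (r + 1) dvd a"
  shows "is_spline (trunc (\<tau> j) a)"
proof (cases "a = 0")
  case True
  have "trunc (\<tau> j) a = poly 0" using True by (auto simp: trunc_def fun_eq_iff)
  then show ?thesis using is_spline_poly[of 0] by simp
next
  case False
  obtain h where h: "a = M j ^ (r + 1) * h" using a(2) by (rule dvdE)
  \<comment> \<open>The cofactor recentred at the knot: this expands \<open>a\<close> in powers of
    \<open>v - \<tau> j\<close>, whose exponents run from \<open>r + 1\<close> to at most
    \<open>p\<close>.\<close>
  define h' where "h' = pcompose h [:\<tau> j, 1:]"
  have "degree a = r + 1 + degree h"
    using False unfolding h by (subst degree_mult_eq) (auto simp: degree_power_eq simp del: power_Suc)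
  then have deg: "degree h' + r + 1 \<le> p" using a(1) by (simp add: h'_def degree_pcompose)
  have "poly h v = poly h' (v - \<tau> j)" for v by (simp add: h'_def poly_pcompose)
  then have "poly a v = (\<Sum>i\<le>degree h'. coeff h' i * (v - \<tau> j) ^ (r + 1 + i))" for v
    unfolding h poly_mult poly_power
    by (simp add: poly_altdef[of h'] power_add sum_distrib_left mult_ac)
  then have eq: "trunc (\<tau> j) a = (\<lambda>v. \<Sum>i\<le>degree h'. coeff h' i * trunc (\<tau> j) (M j ^ (r + 1 + i)) v)"
    by (auto simp: fun_eq_iff trunc_def poly_power simp del: power_Suc)
  have "is_spline (trunc (\<tau> j) (M j ^ (r + 1 + i)))" if "i \<le> degree h'" for i
    unfolding is_spline_def using that deg by (intro trunc_power_is_spline j) auto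
  then show ?thesis unfolding eq by (intro is_spline_sum is_spline_scale) auto
qed

lemma is_spline_pw:
  assumes "c \<in> pfam p r"
  shows "is_spline (pw c)"
proof -
  have "degree (c i) \<le> p" for i
    using assms by (cases "i \<le> k") (auto simp: pfam_def jumps_def)
  then have "is_spline (\<lambda>v. poly (c 0) v + (\<Sum>i\<in>{1..k}. trunc (\<tau> i) (c i) v))"
    using pfam_dvd[OF assms]
    by (intro is_spline_add is_spline_sum is_spline_poly is_spline_trunc) auto
  then show ?thesis by (simp add: pw_def[abs_def])
qed

section \<open>B-splines as a basis of the piecewise polynomials\<close>

text \<open>Cutting off outside the unit interval turns equality on the interval into equality of
  vectors in the function space.\<close>

definition restr :: "(real \<Rightarrow> real) \<Rightarrow> real \<Rightarrow> real" where
  "restr f v = (if v \<in> {0..1} then f v else 0)"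

lemma restr_eq_iff: "restr f = restr g \<longleftrightarrow> (\<forall>v\<in>{0..1}. f v = g v)"
proof (intro iffI ballI)
  fix v :: real assume "restr f = restr g" "v \<in> {0..1}"
  then show "f v = g v" unfolding restr_def by (metis (full_types))
next
  assume *: "\<forall>v\<in>{0..1}. f v = g v"
  show "restr f = restr g"
  proof
    fix v show "restr f v = restr g v"
      using bspec[OF *, of v] by (cases "v \<in> {0..1}") (simp_all only: restr_def if_True if_False)
  qed
qed

lemma subspace_pfam: "subspace (pfam p r)"
  by (rule findim_subspace[OF findim_pfam[OF less_imp_le[OF r_less]]])

lemma sum_fun_apply: "(\<Sum>i\<in>I. f i) v = (\<Sum>i\<in>I. f i v)" for f :: "'i \<Rightarrow> 'v \<Rightarrow> real"
  by (induction I rule: infinite_finite_induct) auto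

text \<open>Curry--Schoenberg: the \<open>n + 1\<close> B-splines span a space that contains the \<open>(n + 1)\<close>-dimensional
  space of piecewise polynomials, so they are a basis of it.\<close>

lemma curry_schoenberg:
  "span ((\<lambda>i. restr (B i)) ` {..<n + 1}) = (\<lambda>c. restr (pw c)) ` pfam p r
    \<and> inj_on (\<lambda>i. restr (B i)) {..<n + 1} \<and> independent ((\<lambda>i. restr (B i)) ` {..<n + 1})"
proof (rule findim_spanning)
  have lin: "linear (\<lambda>c. restr (pw c))"
    by (auto simp: linear_iff fun_eq_iff restr_def pw_add pw_smult scaleR_fun_def plus_fun_def)
  have inj: "inj_on (\<lambda>c. restr (pw c)) (pfam p r)"
  proof (rule inj_onI)
    fix c d assume cd: "c \<in> pfam p r" "d \<in> pfam p r" "restr (pw c) = restr (pw d)"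
    have "c i - d i = 0" if "i \<le> k" for i
      using that cd(3) by (intro pw_eq_0[of "\<lambda>i. c i - d i"]) (auto simp: restr_eq_iff pw_diff)
    then show "c = d" using cd(1,2) by (auto simp: fun_eq_iff pfam_def atMost_def) (metis not_le)
  qed
  have "findim (pfam p r) (n + 1)" using findim_pfam[of r p] r_less by simp
  then show "findim ((\<lambda>c. restr (pw c)) ` pfam p r) (n + 1)"
    using findim_image[OF lin inj] by blast
  show "(\<lambda>c. restr (pw c)) ` pfam p r \<subseteq> span ((\<lambda>i. restr (B i)) ` {..<n + 1})"
  proof
    fix f assume "f \<in> (\<lambda>c. restr (pw c)) ` pfam p r"
    then obtain c where c: "c \<in> pfam p r" "f = restr (pw c)" by auto
    then obtain x where "\<forall>v\<in>{0..1}. spline x v = pw c v"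
      using is_spline_pw unfolding is_spline_def by blast
    then have "f v = (\<Sum>i\<le>n. (x i *\<^sub>R restr (B i)) v)" for v
      unfolding c(2) restr_def scaleR_fun_def spline_def by auto
    then have "f = (\<Sum>i\<le>n. x i *\<^sub>R restr (B i))"
      by (simp add: fun_eq_iff sum_fun_apply)
    then show "f \<in> span ((\<lambda>i. restr (B i)) ` {..<n + 1})"
      by (simp only:) (intro span_sum span_scale span_base imageI, simp)
  qed
qed

lemma spline_eq_0:
  assumes "\<And>v. v \<in> {0..1} \<Longrightarrow> spline x v = 0" "i \<le> n"
  shows "x i = 0"
proof -
  let ?b = "\<lambda>i. restr (B i)"
  \<comment> \<open>Independence speaks of a set of functions, so the coefficients must be indexed
    by functions. Injectivity of \<open>?b\<close> lets the index be recovered.\<close>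
  define u where "u = (\<lambda>f. x (inv_into {..<n + 1} ?b f))"
  have inj: "inj_on ?b {..<n + 1}" and ind: "independent (?b ` {..<n + 1})"
    using curry_schoenberg by auto
  have ub: "u (?b j) = x j" if "j \<in> {..<n + 1}" for j
    unfolding u_def by (simp only: inv_into_f_f[OF inj that])
  have "(\<Sum>f\<in>?b ` {..<n + 1}. u f *\<^sub>R f) = (\<Sum>j<n + 1. u (?b j) *\<^sub>R ?b j)"
    using inj by (simp add: sum.reindex)
  also have "\<dots> = (\<Sum>j<n + 1. x j *\<^sub>R ?b j)" using ub by (intro sum.cong) auto
  also have "\<dots> = restr (spline x)"
  proof
    show "(\<Sum>j<n + 1. x j *\<^sub>R ?b j) v = restr (spline x) v" for v
      by (cases "v < 0"; cases "1 < v") (auto simp add: sum_fun_apply scaleR_fun_def restr_def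
          spline_def lessThan_Suc_atMost simp del: sum.lessThan_Suc)
  qed
  also have "\<dots> = 0" using assms(1) by (simp add: fun_eq_iff restr_def)
  finally have 0: "(\<Sum>f\<in>?b ` {..<n + 1}. u f *\<^sub>R f) = 0" .
  have "?b i \<in> ?b ` {..<n + 1}" using assms(2) by (intro imageI) simp
  from independentD[OF ind _ subset_refl 0 this] have "u (?b i) = 0" by simp
  then show ?thesis using ub[of i] assms(2) by simp
qed

text \<open>For \<open>i \<le> n\<close> such a family exists by the basis property, and uniqueness
  of jump polynomials leaves no real choice.\<close>

definition Bfam :: "nat \<Rightarrow> nat \<Rightarrow> real poly" where
  "Bfam i = (SOME c. c \<in> pfam p r \<and> (\<forall>v\<in>{0..1}. B i v = pw c v))"

lemma Bfam:
  assumes "i \<le> n"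
  shows "Bfam i \<in> pfam p r" "v \<in> {0..1} \<Longrightarrow> B i v = pw (Bfam i) v"
proof -
  have "restr (B i) \<in> (\<lambda>i. restr (B i)) ` {..<n + 1}"
    by (rule image_eqI[of _ _ i]) (use assms in simp_all)
  then have "restr (B i) \<in> (\<lambda>c. restr (pw c)) ` pfam p r"
    unfolding curry_schoenberg[THEN conjunct1, symmetric] by (rule span_base)
  then have "\<exists>c. c \<in> pfam p r \<and> (\<forall>v\<in>{0..1}. B i v = pw c v)"
    by (auto simp: restr_eq_iff)
  from someI_ex[OF this]
  show "Bfam i \<in> pfam p r" "v \<in> {0..1} \<Longrightarrow> B i v = pw (Bfam i) v"
    unfolding Bfam_def by blast+
qed

text \<open>The jump polynomials of \<open>spline x\<close>. Summing the fixed families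
  \<open>Bfam i\<close> makes them linear in \<open>x\<close> by construction.\<close>

definition famof :: "(nat \<Rightarrow> real) \<Rightarrow> nat \<Rightarrow> real poly" where
  "famof x = (\<Sum>i\<le>n. x i *\<^sub>R Bfam i)"

lemma famof_pfam: "famof x \<in> pfam p r"
  unfolding famof_def
  by (intro subspace_sum[OF subspace_pfam] subspace_scale[OF subspace_pfam] Bfam) simp

lemma famof_nth: "famof x m = (\<Sum>i\<le>n. smult (x i) (Bfam i m))"
proof -
  have "(\<Sum>i\<in>I. x i *\<^sub>R Bfam i) m = (\<Sum>i\<in>I. smult (x i) (Bfam i m))" for I
    by (induction I rule: infinite_finite_induct) (simp_all add: scaleR_fun_def)
  then show ?thesis by (simp only: famof_def)
qed

lemma pw_famof: "v \<in> {0..1} \<Longrightarrow> pw (famof x) v = spline x v"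
  unfolding famof_nth[abs_def] spline_def
  by (simp add: pw_sum pw_smult) (intro sum.cong refl, simp add: Bfam(2))

lemma linear_famof: "linear famof"
proof -
  have "smult c (\<Sum>i\<in>I. f i) = (\<Sum>i\<in>I. smult c (f i))" for c and I and f :: "nat \<Rightarrow> real poly"
    by (induction I rule: infinite_finite_induct) (simp_all add: smult_add_right)
  then show ?thesis
    by (simp add: linear_iff fun_eq_iff famof_nth scaleR_fun_def sum.distrib smult_add_left)
qed

lemma pfam_eq_iff:
  assumes "c \<in> pfam q s" "d \<in> pfam q' s'"
  shows "c = d \<longleftrightarrow> (\<forall>v\<in>{0..1}. pw c v = pw d v)"
proof
  assume eq: "\<forall>v\<in>{0..1}. pw c v = pw d v"
  have "c i - d i = 0" if "i \<le> k" for i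
    using that eq by (intro pw_eq_0[of "\<lambda>i. c i - d i"]) (auto simp: pw_diff)
  then show "c = d" using assms by (auto simp: fun_eq_iff pfam_def atMost_def) (metis not_le)
qed simp

text \<open>Splines exhaust the piecewise polynomials. Normalizing the coefficients to
  \<open>0\<close> beyond \<open>n\<close> makes them unique.\<close>

lemma pfam_famof:
  assumes "c \<in> pfam p r"
  shows "\<exists>x. (\<forall>i. i \<notin> {..n} \<longrightarrow> x i = 0) \<and> famof x = c"
proof -
  obtain x where x: "\<forall>v\<in>{0..1}. spline x v = pw c v"
    using is_spline_pw[OF assms] unfolding is_spline_def by blast
  let ?x = "\<lambda>i. if i \<le> n then x i else 0"
  have "spline ?x v = spline x v" for v by (simp add: spline_def)
  then have "famof ?x = c" using pfam_eq_iff[OF famof_pfam assms] x by (simp add: pw_famof)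
  then show ?thesis by (intro exI[of _ ?x]) auto
qed

text \<open>The derivative is kept in jump form, so that the interface relation can later be
  compared jump by jump.\<close>

definition dspline :: "(nat \<Rightarrow> real) \<Rightarrow> real \<Rightarrow> real" where
  "dspline x v = pw (\<lambda>i. pderiv (famof x i)) v"

lemma has_derivative_spline:
  assumes "v \<in> {0..1}"
  shows "(spline x has_real_derivative dspline x v) (at v within {0..1})"
proof -
  have "(pw (famof x) has_real_derivative dspline x v) (at v within {0..1})"
    unfolding dspline_def
    using has_derivative_pw[OF famof_pfam] r(1) by (auto intro: DERIV_subset)
  then show ?thesis
    by (rule has_field_derivative_transform_within[OF _ zero_less_one assms]) (simp add: pw_famof)
qed

lemma continuous_dspline: "continuous_on UNIV (dspline x)"
proof -
  have "continuous_on UNIV (pw (\<lambda>i. pderiv (famof x i)))"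
    by (intro continuous_pw pfam_pderiv_root[OF famof_pfam r(1)])
  then show ?thesis by (simp add: dspline_def[abs_def])
qed

lemma dspline_sum: "dspline x v = (\<Sum>i\<le>n. x i * dspline (\<lambda>j. if j = i then 1 else 0) v)"
proof -
  have "famof (\<lambda>j. if j = i then 1 else 0) m = Bfam i m" if "i \<le> n" for i m
  proof -
    have "famof (\<lambda>j. if j = i then 1 else 0) m = (\<Sum>j\<le>n. if j = i then Bfam j m else 0)"
      unfolding famof_nth by (rule sum.cong) auto
    then show ?thesis using that by simp
  qed
  then have "(\<Sum>i\<le>n. x i * dspline (\<lambda>j. if j = i then 1 else 0) v)
      = (\<Sum>i\<le>n. x i * pw (\<lambda>m. pderiv (Bfam i m)) v)"
    unfolding dspline_def by (intro sum.cong) auto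
  also have "\<dots> = pw (\<lambda>m. \<Sum>i\<le>n. smult (x i) (pderiv (Bfam i m))) v"
    by (simp add: pw_sum pw_smult)
  also have "(\<lambda>m. \<Sum>i\<le>n. smult (x i) (pderiv (Bfam i m))) = (\<lambda>m. pderiv (famof x m))"
  proof
    have "pderiv (\<Sum>i\<in>I. f i) = (\<Sum>i\<in>I. pderiv (f i))" for I and f :: "nat \<Rightarrow> real poly"
      by (induction I rule: infinite_finite_induct) (simp_all add: pderiv_add)
    then show "(\<Sum>i\<le>n. smult (x i) (pderiv (Bfam i m))) = pderiv (famof x m)" for m
      by (simp add: famof_nth pderiv_smult)
  qed
  finally show ?thesis by (simp add: dspline_def)
qed

section \<open>Values and derivatives at the left end point\<close>

text \<open>The knot \<open>p + 1\<close> is the first one right of \<open>0\<close>. For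
  \<open>i \<le> p\<close> the first factor of the recursion is a multiple of \<open>x\<close>,
  which raises the order of the zero by one with each degree; B-splines with \<open>p < i\<close>
  start too late to matter.\<close>

lemma bspline_near_0:
  "i + q + 1 < length t \<Longrightarrow>
    \<exists>P. \<forall>x. 0 \<le> x \<longrightarrow> x < t ! (p + 1) \<longrightarrow> bspline t q i x = x ^ (i + q - p) * poly P x"
proof (induction q arbitrary: i)
  case 0
  have t1: "t ! (p + 1) \<le> 1" using le_last[of "p + 1"] by (simp add: last_t length_t)
  consider "i < p" | "i = p" | "p < i" by linarith
  then show ?case
  proof cases
    case 1
    then have "t ! i = t ! (i + 0 + 1)" by (simp add: t_0)
    then have "bspline t 0 i x = 0" for x by (rule bspline_empty_span[OF 0])
    then show ?thesis by (intro exI[of _ 0]) simp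
  next
    case 2
    then show ?thesis by (intro exI[of _ 1]) (auto simp: t_0)
  next
    case 3
    have "t ! (p + 1) \<le> t ! i" using 3 0 by (intro nth_mono) auto
    then have "bspline t 0 i x = 0" if "x < t ! (p + 1)" for x
      using that t1 by (auto simp: last_t)
    then show ?thesis by (intro exI[of _ 0]) simp
  qed
next
  case (Suc q)
  show ?case
  proof (cases "p < i")
    case True
    then have "t ! (p + 1) \<le> t ! i" using Suc.prems by (intro nth_mono) auto
    then have "bspline t (Suc q) i x = 0" if "x < t ! (p + 1)" for x
      using bspline_support[OF Suc.prems, of x] that by (cases "bspline t (Suc q) i x = 0") auto
    then show ?thesis by (intro exI[of _ 0]) (simp del: bspline.simps)
  next
    case False
    obtain P where P: "\<And>x. 0 \<le> x \<Longrightarrow> x < t ! (p + 1) \<Longrightarrow>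
        bspline t q i x = x ^ (i + q - p) * poly P x"
      using Suc.IH[of i] Suc.prems by auto
    obtain R where R: "\<And>x. 0 \<le> x \<Longrightarrow> x < t ! (p + 1) \<Longrightarrow>
        bspline t q (i + 1) x = x ^ (i + 1 + q - p) * poly R x"
      using Suc.IH[of "i + 1"] Suc.prems by auto
    define a where "a = 1 / (t ! (i + q + 1) - t ! i)"
    define b where "b = 1 / (t ! (i + q + 2) - t ! (i + 1))"
    define d where "d = t ! (i + q + 2)"
    have eq: "bspline t (Suc q) i x = a * x * (x ^ (i + q - p) * poly P x)
        + b * (d - x) * (x ^ (i + Suc q - p) * poly R x)" if "0 \<le> x" "x < t ! (p + 1)" for x
      using P[OF that] R[OF that] t_0[of i] False by (simp add: a_def b_def d_def)
    show ?thesis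
    \<comment> \<open>Truncated subtraction: the exponent grows with the degree only from here on,
      and is \<open>0\<close> before.\<close>
    proof (cases "p \<le> i + q")
      case True
      then have "i + Suc q - p = Suc (i + q - p)" by simp
      then show ?thesis
        by (intro exI[of _ "smult a P + smult b ([:d, -1:] * R)"])
          (simp add: eq algebra_simps del: bspline.simps)
    next
      case False
      then have "i + q - p = 0" "i + Suc q - p = 0" by simp_all
      then show ?thesis
        by (intro exI[of _ "smult a ([:0, 1:] * P) + smult b ([:d, -1:] * R)"])
          (simp add: eq algebra_simps del: bspline.simps)
    qed
  qed
qed

lemma B_near_0:
  assumes "i \<le> n"
  shows "\<exists>P e. 0 < e \<and> (\<forall>x. 0 \<le> x \<longrightarrow> x < e \<longrightarrow> B i x = x ^ i * poly P x)"
  using bspline_near_0[of i p] assms t_pos[of "p + 1"] by (auto simp: length_t B_eq)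

lemma B_0: "1 \<le> i \<Longrightarrow> i \<le> n \<Longrightarrow> B i 0 = 0"
  using B_near_0[of i] by force

abbreviation \<delta> :: "nat \<Rightarrow> nat \<Rightarrow> real" where "\<delta> i j \<equiv> (if j = i then 1 else 0)"

definition dB :: "nat \<Rightarrow> real \<Rightarrow> real" where
  "dB i v = dspline (\<delta> i) v"

lemma has_derivative_B:
  assumes "i \<le> n" "v \<in> {0..1}"
  shows "(B i has_real_derivative dB i v) (at v within {0..1})"
proof -
  have "spline (\<delta> i) = B i"
  proof
    fix v
    have "spline (\<delta> i) v = (\<Sum>j\<le>n. if j = i then B j v else 0)"
      unfolding spline_def by (rule sum.cong) auto
    then show "spline (\<delta> i) v = B i v" using assms(1) by simp
  qed
  then show ?thesis using has_derivative_spline[OF assms(2), of "\<delta> i"] by (simp add: dB_def)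
qed

lemma continuous_dB: "continuous_on UNIV (dB i)"
  unfolding dB_def[abs_def] by (rule continuous_dspline)

lemma dspline_eq: "dspline x v = (\<Sum>i\<le>n. x i * dB i v)"
  unfolding dB_def by (rule dspline_sum)

lemma derivative_unique:
  fixes f :: "real \<Rightarrow> real"
  assumes "(f has_real_derivative a) (at v within {0..1})"
    "(f has_real_derivative b) (at v within {0..1})" "v \<in> {0..1}"
  shows "a = b"
  using assms vector_derivative_unique_within_closed_interval[of 0 1 v f a b]
  by (simp add: has_real_derivative_iff_has_vector_derivative cbox_interval)

lemma dB_0: "2 \<le> i \<Longrightarrow> i \<le> n \<Longrightarrow> dB i 0 = 0"
proof -
  assume i: "2 \<le> i" "i \<le> n"
  obtain P e where P: "0 < e" "\<And>x. 0 \<le> x \<Longrightarrow> x < e \<Longrightarrow> B i x = x ^ i * poly P x"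
    using B_near_0[OF i(2)] by blast
  have "((\<lambda>x. x ^ i * poly P x) has_real_derivative 0) (at 0 within {0..1})"
    by (rule derivative_eq_intros poly_DERIV[THEN DERIV_subset] | rule refl)+ (use i in \<open>auto simp: power_0_left\<close>)
  then have "(B i has_real_derivative 0) (at 0 within {0..1})"
    by (rule has_field_derivative_transform_within[OF _ P(1)]) (auto simp: P(2) dist_real_def)
  then show ?thesis using derivative_unique has_derivative_B[OF i(2), of 0] by auto
qed

lemma sum_first:
  fixes f :: "nat \<Rightarrow> real"
  assumes "\<And>i. m \<le> i \<Longrightarrow> i \<le> n \<Longrightarrow> f i = 0" "m \<le> n"
  shows "(\<Sum>i\<le>n. f i) = (\<Sum>i<m. f i)"
  using assms by (intro sum.mono_neutral_right) auto

lemma n_ge: "3 \<le> n"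
  using p by simp

lemma spline_0: "spline x 0 = x 0 * B 0 0"
  unfolding spline_def using sum_first[of 1 "\<lambda>i. x i * B i 0"] B_0 n_ge by auto

lemma dspline_0: "dspline x 0 = x 0 * dB 0 0 + x 1 * dB 1 0"
  unfolding dspline_eq using sum_first[of 2 "\<lambda>i. x i * dB i 0"] dB_0 n_ge
  by (auto simp: numeral_2_eq_2)

text \<open>The constant \<open>1\<close> is a spline, and its value at \<open>0\<close> is a
  multiple of \<open>B 0 0\<close>.\<close>

lemma B_0_0: "B 0 0 \<noteq> 0"
proof -
  obtain x where "\<forall>v\<in>{0..1}. spline x v = v ^ 0" using power_is_spline[of 0] by auto
  then have "spline x 0 = 1" by simp
  then show ?thesis unfolding spline_0 by auto
qed

text \<open>The identity function is a spline. It vanishes at \<open>0\<close>, so its coefficient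
  \<open>0\<close> does too, and its derivative \<open>1\<close> is a multiple of
  \<open>dB 1 0\<close>.\<close>

lemma dB_1_0: "dB 1 0 \<noteq> 0"
proof -
  obtain x where x: "\<forall>v\<in>{0..1}. spline x v = v ^ 1" using power_is_spline[of 1] p by auto
  then have "spline x 0 = 0" by simp
  then have "x 0 = 0" using B_0_0 unfolding spline_0 by simp
  have "((\<lambda>v. v) has_real_derivative dspline x 0) (at 0 within {0..1})"
    by (rule has_field_derivative_transform_within[OF has_derivative_spline zero_less_one])
       (use x in auto)
  then have "dspline x 0 = 1"
    by (rule derivative_unique) (auto intro: DERIV_subset)
  then show ?thesis unfolding dspline_0 using \<open>x 0 = 0\<close> by auto
qed

end

section \<open>Continuous differentiability on parameterized patches\<close>

text \<open>At a point outside a closed set the filter within that set is trivial, so a limit along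
  the union is the conjunction of the two limits.\<close>

lemma has_derivative_Un_closed:
  fixes f :: "'a::real_normed_vector \<Rightarrow> 'b::real_normed_vector"
  assumes "x \<in> A \<union> B" "closed A" "closed B"
    and A: "x \<in> A \<Longrightarrow> (f has_derivative D) (at x within A)"
    and B: "x \<in> B \<Longrightarrow> (f has_derivative D) (at x within B)"
  shows "(f has_derivative D) (at x within (A \<union> B))"
proof -
  have *: "(f has_derivative D) (at x within X)"
    if "closed X" "bounded_linear D" "x \<in> X \<Longrightarrow> (f has_derivative D) (at x within X)" for X
  proof (cases "x \<in> X")
    case False
    then have "at x within X = bot"
      using that(1) by (simp add: at_within_eq_bot_iff)
    then show ?thesis using that(2) by (simp add: has_derivative_def)
  qed (use that in simp)
  have D: "bounded_linear D"
    using assms(1) A B by (auto dest: has_derivative_bounded_linear)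
  have "(f has_derivative D) (at x within A)" by (rule *[OF assms(2) D A])
  moreover have "(f has_derivative D) (at x within B)" by (rule *[OF assms(3) D B])
  ultimately show ?thesis unfolding has_derivative_within by (simp add: Lim_Un)
qed

definition det2 :: "real \<times> real \<Rightarrow> real \<times> real \<Rightarrow> real" where
  "det2 a b = fst a * snd b - snd a * fst b"

text \<open>The gradient whose derivatives along the tangent vectors \<open>a\<close> and
  \<open>b\<close> are \<open>s\<close> and \<open>t\<close>.\<close>

definition cramer :: "real \<times> real \<Rightarrow> real \<times> real \<Rightarrow> real \<Rightarrow> real \<Rightarrow> real \<times> real" where
  "cramer a b s t = ((s * snd b - t * snd a) / det2 a b, (t * fst a - s * fst b) / det2 a b)"

lemma cramer:
  assumes "det2 a b \<noteq> 0"
  shows "cramer a b s t \<bullet> a = s" "cramer a b s t \<bullet> b = t"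
proof -
  obtain a1 a2 b1 b2 where ab: "a = (a1, a2)" "b = (b1, b2)" by (cases a, cases b)
  have D: "a1 * b2 - a2 * b1 \<noteq> 0" using assms by (simp add: det2_def ab)
  have "(s * b2 - t * a2) * a1 + (t * a1 - s * b1) * a2 = s * (a1 * b2 - a2 * b1)"
    "(s * b2 - t * a2) * b1 + (t * a1 - s * b1) * b2 = t * (a1 * b2 - a2 * b1)"
    by algebra+
  then show "cramer a b s t \<bullet> a = s" "cramer a b s t \<bullet> b = t"
    using D unfolding cramer_def det2_def ab inner_Pair fst_conv snd_conv inner_real_def
    by (simp_all only: times_divide_eq_left add_divide_distrib[symmetric]
        nonzero_mult_div_cancel_right not_False_eq_True)
qed

lemma cramer_unique:
  assumes "det2 a b \<noteq> 0" "G \<bullet> a = s" "G \<bullet> b = t"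
  shows "G = cramer a b s t"
proof -
  obtain a1 a2 b1 b2 g1 g2 where ab: "a = (a1, a2)" "b = (b1, b2)" "G = (g1, g2)"
    by (cases a, cases b, cases G)
  have D: "a1 * b2 - a2 * b1 \<noteq> 0" using assms by (simp add: det2_def ab)
  have s: "s = g1 * a1 + g2 * a2" "t = g1 * b1 + g2 * b2"
    using assms by (simp_all add: ab)
  have "s * b2 - t * a2 = g1 * (a1 * b2 - a2 * b1)" "t * a1 - s * b1 = g2 * (a1 * b2 - a2 * b1)"
    unfolding s by algebra+
  then show ?thesis using D by (simp add: cramer_def det2_def ab)
qed

lemma compact_Q: "compact Q"
  by (simp add: Q_def compact_Times)

text \<open>Cramer's rule for the inverse of the Jacobian with columns \<open>a\<close> and
  \<open>b\<close>, in the form that the inverse function rule asks for.\<close>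

lemma det2_linear_inverse:
  assumes "det2 a b \<noteq> 0"
  defines "K \<equiv> \<lambda>h. (det2 h b / det2 a b, det2 a h / det2 a b)"
  shows "linear K" "K \<circ> (\<lambda>h. fst h *\<^sub>R a + snd h *\<^sub>R b) = id"
proof -
  show "linear K"
    by (auto simp: K_def linear_iff det2_def algebra_simps add_divide_distrib diff_divide_distrib)
  have "det2 (x *\<^sub>R a + y *\<^sub>R b) b = x * det2 a b" "det2 a (x *\<^sub>R a + y *\<^sub>R b) = y * det2 a b" for x y
    by (simp_all add: det2_def algebra_simps)
  then show "K \<circ> (\<lambda>h. fst h *\<^sub>R a + snd h *\<^sub>R b) = id"
    using assms(1) by (simp add: K_def fun_eq_iff)
qed

section \<open>Gradients on a single patch\<close>

locale patch =
  fixes F Fu Fv :: "real \<times> real \<Rightarrow> real \<times> real"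
  assumes F: "x \<in> Q \<Longrightarrow> (F has_derivative (\<lambda>h. fst h *\<^sub>R Fu x + snd h *\<^sub>R Fv x)) (at x within Q)"
    and cont: "continuous_on Q Fu" "continuous_on Q Fv"
    and inj: "inj_on F Q"
    and det: "x \<in> Q \<Longrightarrow> det2 (Fu x) (Fv x) \<noteq> 0"
begin

abbreviation H :: "real \<times> real \<Rightarrow> real \<times> real" where "H \<equiv> the_inv_into Q F"

lemma H: "x \<in> Q \<Longrightarrow> H (F x) = x"
  using inj by (rule the_inv_into_f_f)

lemma continuous_F: "continuous_on Q F"
  by (rule has_derivative_continuous_on[OF F])

lemma continuous_H: "continuous_on (F ` Q) H"
  using continuous_F compact_Q inj by (rule continuous_on_inv_into)

lemma closed_patch: "closed (F ` Q)"
  by (rule compact_imp_closed[OF compact_continuous_image[OF continuous_F compact_Q]])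

text \<open>The inverse is continuous because \<open>F\<close> is continuous and injective on the
  compact square; with an invertible Jacobian this suffices also at boundary points.\<close>

lemma has_derivative_H:
  assumes x: "x \<in> Q"
  shows "(H has_derivative (\<lambda>h. (det2 h (Fv x) / det2 (Fu x) (Fv x), det2 (Fu x) h / det2 (Fu x) (Fv x))))
    (at (F x) within F ` Q)"
proof (rule has_derivative_inverse_within[OF F[OF x] _ x])
  show "continuous (at (F x) within F ` Q) H"
    using continuous_H x by (auto simp: continuous_on_eq_continuous_within)
qed (use det2_linear_inverse[OF det[OF x]] H in auto)

lemma has_gradient:
  assumes g: "\<And>x. x \<in> Q \<Longrightarrow> (g has_derivative (\<lambda>h. fst h * gu x + snd h * gv x)) (at x within Q)"
    and \<phi>: "\<And>x. x \<in> Q \<Longrightarrow> \<phi> (F x) = g x" and x: "x \<in> Q"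
  shows "(\<phi> has_derivative (\<lambda>h. cramer (Fu x) (Fv x) (gu x) (gv x) \<bullet> h)) (at (F x) within F ` Q)"
proof -
  let ?D = "det2 (Fu x) (Fv x)"
  have HQ: "H ` (F ` Q) = Q" using H by force
  have "(g has_derivative (\<lambda>h. fst h * gu x + snd h * gv x)) (at (H (F x)) within H ` (F ` Q))"
    using g[OF x] x by (simp add: HQ H)
  from diff_chain_within[OF has_derivative_H[OF x] this]
  have "(g \<circ> H has_derivative
      (\<lambda>h. det2 h (Fv x) / ?D * gu x + det2 (Fu x) h / ?D * gv x)) (at (F x) within F ` Q)"
    by (simp add: o_def)
  moreover have "(\<lambda>h. det2 h (Fv x) / ?D * gu x + det2 (Fu x) h / ?D * gv x)
      = (\<lambda>h. cramer (Fu x) (Fv x) (gu x) (gv x) \<bullet> h)"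
  proof
    fix h :: "real \<times> real"
    have "det2 h (Fv x) * gu x + det2 (Fu x) h * gv x
        = (gu x * snd (Fv x) - gv x * snd (Fu x)) * fst h + (gv x * fst (Fu x) - gu x * fst (Fv x)) * snd h"
      by (simp add: det2_def algebra_simps)
    then show "det2 h (Fv x) / ?D * gu x + det2 (Fu x) h / ?D * gv x
        = cramer (Fu x) (Fv x) (gu x) (gv x) \<bullet> h"
      by (simp add: cramer_def inner_prod_def add_divide_distrib[symmetric])
  qed
  ultimately have "(g \<circ> H has_derivative (\<lambda>h. cramer (Fu x) (Fv x) (gu x) (gv x) \<bullet> h))
      (at (F x) within F ` Q)" by simp
  then show ?thesis
    by (rule has_derivative_transform_within[OF _ zero_less_one]) (use x H \<phi> in auto)
qed

lemma gradient_unique: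
  assumes "(g has_derivative (\<lambda>h. fst h * s + snd h * t)) (at x within Q)"
    and \<phi>: "\<And>x. x \<in> Q \<Longrightarrow> \<phi> (F x) = g x" and x: "x \<in> Q"
    and "(\<phi> has_derivative (\<lambda>h. G \<bullet> h)) (at (F x) within F ` Q)"
  shows "G \<bullet> Fu x = s" "G \<bullet> Fv x = t"
proof -
  \<comment> \<open>Derivatives within a nondegenerate closed box are unique, even at its edges and
    corners.\<close>
  have Q: "Q = cbox (0, 0) (1, 1)" by (simp add: Q_def cbox_Pair_eq)
  have "(\<phi> \<circ> F has_derivative (\<lambda>h. G \<bullet> h) \<circ> (\<lambda>h. fst h *\<^sub>R Fu x + snd h *\<^sub>R Fv x)) (at x within Q)"
    by (rule diff_chain_within[OF F[OF x] assms(4)])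
  then have "(g has_derivative (\<lambda>h. G \<bullet> h) \<circ> (\<lambda>h. fst h *\<^sub>R Fu x + snd h *\<^sub>R Fv x)) (at x within Q)"
    by (rule has_derivative_transform_within[OF _ zero_less_one x]) (simp add: \<phi>)
  then have "(\<lambda>h. G \<bullet> h) \<circ> (\<lambda>h. fst h *\<^sub>R Fu x + snd h *\<^sub>R Fv x) = (\<lambda>h. fst h * s + snd h * t)"
    using assms(1) x unfolding Q
    by (intro frechet_derivative_unique_within_closed_interval[of "(0, 0)" "(1, 1)"])
      (auto simp: Basis_prod_def)
  note eq = fun_cong[OF this]
  show "G \<bullet> Fu x = s" "G \<bullet> Fv x = t" using eq[of "(1, 0)"] eq[of "(0, 1)"] by simp_all
qed

lemma continuous_gradient:
  assumes "continuous_on Q gu" "continuous_on Q gv"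
  shows "continuous_on (F ` Q) (\<lambda>y. cramer (Fu (H y)) (Fv (H y)) (gu (H y)) (gv (H y)))"
proof -
  have "continuous_on Q (\<lambda>x. cramer (Fu x) (Fv x) (gu x) (gv x))"
    unfolding cramer_def det2_def
    using assms cont det by (intro continuous_intros) (auto simp: det2_def)
  moreover have "H ` (F ` Q) \<subseteq> Q" using H by force
  ultimately show ?thesis by (rule continuous_on_compose2[OF _ continuous_H])
qed

end

section \<open>Smoothness across the interface\<close>

locale two_patches = L: patch FL FLu FLv + R: patch FR FRu FRv
  for FL FLu FLv FR FRu FRv +
  fixes aL aR b :: "real \<Rightarrow> real"
  assumes interface: "v \<in> {0..1} \<Longrightarrow> FL (0, v) = FR (0, v)" "v \<in> {0..1} \<Longrightarrow> FLv (0, v) = FRv (0, v)"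
    and meet: "FL ` Q \<inter> FR ` Q = (\<lambda>v. FL (0, v)) ` {0..1}"
    and G1: "v \<in> {0..1} \<Longrightarrow> aR v *\<^sub>R FLu (0, v) - aL v *\<^sub>R FRu (0, v) + b v *\<^sub>R FLv (0, v) = 0"
    and aL: "v \<in> {0..1} \<Longrightarrow> aL v \<noteq> 0"
begin

lemma Q_0: "v \<in> {0..1} \<Longrightarrow> (0, v) \<in> Q"
  by (simp add: Q_def)

text \<open>Forward, the geometric relation \<open>G1\<close> is paired with the common gradient.
  Backward, the relation and \<open>aL v \<noteq> 0\<close> show that the left gradient has the
  tangential products that determine the right one; so the two agree on the interface and glue over
  the closed patches.\<close>

lemma C1_iff:
  assumes gL: "\<And>x. x \<in> Q \<Longrightarrow> (gL has_derivative (\<lambda>h. fst h * gLu x + snd h * gLv x)) (at x within Q)"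
    and gR: "\<And>x. x \<in> Q \<Longrightarrow> (gR has_derivative (\<lambda>h. fst h * gRu x + snd h * gRv x)) (at x within Q)"
    and cg: "continuous_on Q gLu" "continuous_on Q gLv" "continuous_on Q gRu" "continuous_on Q gRv"
    and \<phi>: "\<And>x. x \<in> Q \<Longrightarrow> \<phi> (FL x) = gL x" "\<And>x. x \<in> Q \<Longrightarrow> \<phi> (FR x) = gR x"
    and gv: "\<And>v. v \<in> {0..1} \<Longrightarrow> gLv (0, v) = gRv (0, v)"
  shows "\<phi> \<in> C1 (FL ` Q \<union> FR ` Q) \<longleftrightarrow>
    (\<forall>v\<in>{0..1}. aR v * gLu (0, v) - aL v * gRu (0, v) + b v * gLv (0, v) = 0)"
proof
  assume "\<phi> \<in> C1 (FL ` Q \<union> FR ` Q)"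
  then obtain G where G: "\<And>x. x \<in> FL ` Q \<union> FR ` Q \<Longrightarrow>
      (\<phi> has_derivative (\<lambda>h. G x \<bullet> h)) (at x within FL ` Q \<union> FR ` Q)"
    by (auto simp: C1_def)
  show "\<forall>v\<in>{0..1}. aR v * gLu (0, v) - aL v * gRu (0, v) + b v * gLv (0, v) = 0"
  proof
    fix v :: real assume v: "v \<in> {0..1}"
    define y where "y = FL (0, v)"
    have y: "y = FR (0, v)" "y \<in> FL ` Q \<union> FR ` Q" using interface(1)[OF v] Q_0[OF v] by (auto simp: y_def)
    have "(\<phi> has_derivative (\<lambda>h. G y \<bullet> h)) (at y within FL ` Q)"
      "(\<phi> has_derivative (\<lambda>h. G y \<bullet> h)) (at y within FR ` Q)"
      by (rule has_derivative_subset[OF G[OF y(2)]], simp)+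
    then have u: "G y \<bullet> FLu (0, v) = gLu (0, v)" "G y \<bullet> FRu (0, v) = gRu (0, v)"
      "G y \<bullet> FLv (0, v) = gLv (0, v)"
      using L.gradient_unique[where g = gL, OF gL[OF Q_0[OF v]] \<phi>(1) Q_0[OF v], of "G y"]
        R.gradient_unique[where g = gR, OF gR[OF Q_0[OF v]] \<phi>(2) Q_0[OF v], of "G y"] y(1)
      by (simp_all add: y_def)
    have "G y \<bullet> (aR v *\<^sub>R FLu (0, v) - aL v *\<^sub>R FRu (0, v) + b v *\<^sub>R FLv (0, v)) = 0"
      unfolding G1[OF v] by simp
    then show "aR v * gLu (0, v) - aL v * gRu (0, v) + b v * gLv (0, v) = 0"
      by (simp add: inner_add_right inner_diff_right u)
  qed
next
  assume rel: "\<forall>v\<in>{0..1}. aR v * gLu (0, v) - aL v * gRu (0, v) + b v * gLv (0, v) = 0"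
  define GL where "GL = (\<lambda>x. cramer (FLu x) (FLv x) (gLu x) (gLv x))"
  define GR where "GR = (\<lambda>x. cramer (FRu x) (FRv x) (gRu x) (gRv x))"
  have eq: "GL (0, v) = GR (0, v)" if v: "v \<in> {0..1}" for v
    unfolding GR_def
  proof (rule cramer_unique)
    have L: "GL (0, v) \<bullet> FLu (0, v) = gLu (0, v)" "GL (0, v) \<bullet> FLv (0, v) = gLv (0, v)"
      unfolding GL_def by (rule cramer[OF L.det[OF Q_0[OF v]]])+
    have "GL (0, v) \<bullet> (aR v *\<^sub>R FLu (0, v) - aL v *\<^sub>R FRu (0, v) + b v *\<^sub>R FLv (0, v)) = 0"
      unfolding G1[OF v] by simp
    then have "aR v * gLu (0, v) - aL v * (GL (0, v) \<bullet> FRu (0, v)) + b v * gLv (0, v) = 0"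
      by (simp add: inner_add_right inner_diff_right L)
    then have "aL v * (GL (0, v) \<bullet> FRu (0, v)) = aL v * gRu (0, v)" using bspec[OF rel v] by linarith
    then show "GL (0, v) \<bullet> FRu (0, v) = gRu (0, v)" using aL[OF v] by simp
    show "GL (0, v) \<bullet> FRv (0, v) = gRv (0, v)" using L(2) gv[OF v] interface(2)[OF v] by simp
    show "det2 (FRu (0, v)) (FRv (0, v)) \<noteq> 0" by (rule R.det[OF Q_0[OF v]])
  qed
  define G where "G = (\<lambda>y. if y \<in> FL ` Q then GL (L.H y) else GR (R.H y))"
  have GL: "G y = GL (L.H y)" if "y \<in> FL ` Q" for y using that by (simp add: G_def)
  have GR: "G y = GR (R.H y)" if y: "y \<in> FR ` Q" for y
  proof (cases "y \<in> FL ` Q")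
    case True
    then have "y \<in> FL ` Q \<inter> FR ` Q" using y by simp
    then obtain v where v: "v \<in> {0..1}" "y = FL (0, v)" unfolding meet by auto
    have "L.H y = (0, v)" unfolding v(2) by (rule L.H[OF Q_0[OF v(1)]])
    moreover have "R.H y = (0, v)"
      unfolding v(2) interface(1)[OF v(1)] by (rule R.H[OF Q_0[OF v(1)]])
    ultimately show ?thesis using GL[OF True] eq[OF v(1)] by simp
  qed (simp add: G_def)
  have "continuous_on (FL ` Q) G"
    by (rule continuous_on_eq[OF L.continuous_gradient[OF cg(1,2)]]) (simp only: GL GL_def)
  moreover have "continuous_on (FR ` Q) G"
    by (rule continuous_on_eq[OF R.continuous_gradient[OF cg(3,4)]]) (simp only: GR GR_def)
  ultimately have "continuous_on (FL ` Q \<union> FR ` Q) G"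
    by (rule continuous_on_closed_Un[OF L.closed_patch R.closed_patch])
  moreover have "(\<phi> has_derivative (\<lambda>h. G y \<bullet> h)) (at y within FL ` Q \<union> FR ` Q)"
    if y: "y \<in> FL ` Q \<union> FR ` Q" for y
  proof (rule has_derivative_Un_closed[OF y L.closed_patch R.closed_patch])
    assume "y \<in> FL ` Q"
    then obtain x where x: "x \<in> Q" "y = FL x" by auto
    have "(\<phi> has_derivative (\<lambda>h. GL x \<bullet> h)) (at (FL x) within FL ` Q)"
      unfolding GL_def by (rule L.has_gradient[OF gL \<phi>(1) x(1)])
    then show "(\<phi> has_derivative (\<lambda>h. G y \<bullet> h)) (at y within FL ` Q)"
      using x GL[of y] by (simp add: L.H)
  next
    assume "y \<in> FR ` Q"
    then obtain x where x: "x \<in> Q" "y = FR x" by auto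
    have "(\<phi> has_derivative (\<lambda>h. GR x \<bullet> h)) (at (FR x) within FR ` Q)"
      unfolding GR_def by (rule R.has_gradient[OF gR \<phi>(2) x(1)])
    then show "(\<phi> has_derivative (\<lambda>h. G y \<bullet> h)) (at y within FR ` Q)"
      using x GR[of y] by (simp add: R.H)
  qed
  ultimately show "\<phi> \<in> C1 (FL ` Q \<union> FR ` Q)" unfolding C1_def by blast
qed

end

text \<open>Restriction to the coordinate segments identifies \<open>D\<^sub>u\<close> and
  \<open>D\<^sub>v\<close> with the derivatives of the tensor-product representation.\<close>

lemma partial_derivatives:
  assumes "(F has_derivative (\<lambda>h. fst h *\<^sub>R a + snd h *\<^sub>R b)) (at x within Q)" "x \<in> Q"
  shows "D\<^sub>u F x = a" "D\<^sub>v F x = b"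
proof -
  obtain u v where x: "x = (u, v)" "u \<in> {0..1}" "v \<in> {0..1}" using assms(2) by (auto simp: Q_def)
  have d: "((\<lambda>t. (t, v)) has_derivative (\<lambda>s. (s, 0))) (at u within {0..1})"
    "((\<lambda>t. (u, t)) has_derivative (\<lambda>s. (0, s))) (at v within {0..1})"
    by (auto intro!: derivative_eq_intros)
  have f: "(F has_derivative (\<lambda>h. fst h *\<^sub>R a + snd h *\<^sub>R b)) (at (u, v) within (\<lambda>t. (t, v)) ` {0..1})"
    "(F has_derivative (\<lambda>h. fst h *\<^sub>R a + snd h *\<^sub>R b)) (at (u, v) within (\<lambda>t. (u, t)) ` {0..1})"
    by (rule has_derivative_subset[OF assms(1)[unfolded x(1)]]; use x in \<open>auto simp: Q_def\<close>)+
  have "((\<lambda>t. F (t, v)) has_derivative (\<lambda>s. s *\<^sub>R a)) (at u within {0..1})"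
    "((\<lambda>t. F (u, t)) has_derivative (\<lambda>s. s *\<^sub>R b)) (at v within {0..1})"
    using has_derivative_in_compose[OF d(1) f(1)] has_derivative_in_compose[OF d(2) f(2)] by simp_all
  then show "D\<^sub>u F x = a" "D\<^sub>v F x = b"
    unfolding x(1) D\<^sub>u_def D\<^sub>v_def prod.case has_vector_derivative_def[symmetric]
    using vector_derivative_within_closed_interval[of 0 1] x(2,3) by simp_all
qed

context splines
begin

section \<open>Tensor-product splines\<close>

definition tens :: "(nat \<Rightarrow> nat \<Rightarrow> real) \<Rightarrow> real \<times> real \<Rightarrow> real" where
  "tens d x = (\<Sum>i\<le>n. \<Sum>j\<le>n. d i j * (B i (fst x) * B j (snd x)))"

definition tens_u :: "(nat \<Rightarrow> nat \<Rightarrow> real) \<Rightarrow> real \<times> real \<Rightarrow> real" where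
  "tens_u d x = (\<Sum>i\<le>n. \<Sum>j\<le>n. d i j * (dB i (fst x) * B j (snd x)))"

definition tens_v :: "(nat \<Rightarrow> nat \<Rightarrow> real) \<Rightarrow> real \<times> real \<Rightarrow> real" where
  "tens_v d x = (\<Sum>i\<le>n. \<Sum>j\<le>n. d i j * (B i (fst x) * dB j (snd x)))"

lemma tens_eq: "tens d (u, v) = spline (\<lambda>i. spline (d i) v) u"
  by (simp add: tens_def spline_def sum_distrib_left sum_distrib_right mult_ac)

lemma tens_u_eq: "tens_u d (u, v) = dspline (\<lambda>i. spline (d i) v) u"
  by (simp add: tens_u_def dspline_eq spline_def sum_distrib_left sum_distrib_right mult_ac)

lemma tens_v_eq: "tens_v d (u, v) = spline (\<lambda>i. dspline (d i) v) u"
  by (simp add: tens_v_def dspline_eq spline_def sum_distrib_left sum_distrib_right mult_ac)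

lemma has_coeffs_iff: "has_coeffs p r k \<tau> g d \<longleftrightarrow> (\<forall>x\<in>Q. g x = tens d x)"
  unfolding has_coeffs_def tens_def by (auto simp: case_prod_beta)

lemma has_derivative_tens:
  assumes "x \<in> Q"
  shows "(tens d has_derivative (\<lambda>h. fst h * tens_u d x + snd h * tens_v d x)) (at x within Q)"
proof -
  have x: "fst x \<in> {0..1}" "snd x \<in> {0..1}" using assms by (auto simp: Q_def)
  have im: "fst ` Q \<subseteq> {0..1}" "snd ` Q \<subseteq> {0..1}" by (auto simp: Q_def)
  have D: "(B i has_derivative (\<lambda>h. h * dB i v)) (at v within {0..1})" if "i \<le> n" "v \<in> {0..1}" for i v
  proof -
    have "(\<lambda>h. h * dB i v) = (*) (dB i v)" by (auto simp: mult.commute)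
    then show ?thesis using has_derivative_B[OF that] unfolding has_field_derivative_def by (simp only:)
  qed
  have 1: "((\<lambda>y. B i (fst y)) has_derivative (\<lambda>h. fst h * dB i (fst x))) (at x within Q)" if "i \<le> n" for i
    by (rule has_derivative_in_compose[of fst fst _ _ "B i"])
       (auto intro: derivative_intros has_derivative_subset[OF D[OF that x(1)] im(1)])
  have 2: "((\<lambda>y. B i (snd y)) has_derivative (\<lambda>h. snd h * dB i (snd x))) (at x within Q)" if "i \<le> n" for i
    by (rule has_derivative_in_compose[of snd snd _ _ "B i"])
       (auto intro: derivative_intros has_derivative_subset[OF D[OF that x(2)] im(2)])
  have "((\<lambda>y. \<Sum>i\<le>n. \<Sum>j\<le>n. d i j * (B i (fst y) * B j (snd y))) has_derivative
      (\<lambda>h. \<Sum>i\<le>n. \<Sum>j\<le>n. d i j * (B i (fst x) * (snd h * dB j (snd x)) + fst h * dB i (fst x) * B j (snd x))))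
      (at x within Q)"
    by (intro has_derivative_sum has_derivative_mult_right has_derivative_mult 1 2) auto
  moreover have "(\<Sum>i\<le>n. \<Sum>j\<le>n. d i j * (B i (fst x) * (snd h * dB j (snd x)) + fst h * dB i (fst x) * B j (snd x)))
      = fst h * tens_u d x + snd h * tens_v d x" for h :: "real \<times> real"
    unfolding tens_u_def tens_v_def sum_distrib_left sum.distrib[symmetric]
    by (intro sum.cong refl) (simp add: algebra_simps)
  ultimately show ?thesis unfolding tens_def[abs_def] by simp
qed

lemma continuous_B: "i \<le> n \<Longrightarrow> continuous_on {0..1} (B i)"
  by (rule DERIV_continuous_on[OF has_derivative_B])

lemma continuous_tens:
  "continuous_on Q (tens_u d)" "continuous_on Q (tens_v d)"
proof -
  have "continuous_on Q (\<lambda>x. B i (fst x))" "continuous_on Q (\<lambda>x. B i (snd x))" if "i \<le> n" for i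
    by (rule continuous_on_compose2[OF continuous_B[OF that]];
        auto simp: Q_def intro: continuous_intros)+
  moreover have "continuous_on Q (\<lambda>x. dB i (fst x))" "continuous_on Q (\<lambda>x. dB i (snd x))" for i
    by (rule continuous_on_compose2[OF continuous_dB]; auto intro: continuous_intros)+
  ultimately show "continuous_on Q (tens_u d)" "continuous_on Q (tens_v d)"
    unfolding tens_u_def[abs_def] tens_v_def[abs_def]
    by (auto intro!: continuous_on_sum continuous_on_mult continuous_on_const)
qed

lemma spline_unique:
  assumes "\<And>v. v \<in> {0..1} \<Longrightarrow> spline x v = spline y v" "i \<le> n"
  shows "x i = y i"
proof -
  have "spline (\<lambda>i. x i - y i) v = spline x v - spline y v" for v
    by (simp add: spline_def left_diff_distrib sum_subtractf)
  then show ?thesis using spline_eq_0[of "\<lambda>i. x i - y i" i] assms by simp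
qed

text \<open>Univariate uniqueness is applied in \<open>u\<close> with \<open>v\<close> fixed, and
  then in \<open>v\<close>.\<close>

lemma tens_unique:
  assumes "\<And>x. x \<in> Q \<Longrightarrow> tens d x = tens e x" "i \<le> n" "j \<le> n"
  shows "d i j = e i j"
proof -
  have "spline (d i) v = spline (e i) v" if "v \<in> {0..1}" for v
    by (rule spline_unique[of "\<lambda>i. spline (d i) v" "\<lambda>i. spline (e i) v"])
       (use assms(1,2) that in \<open>auto simp: tens_eq[symmetric] Q_def\<close>)
  then show ?thesis using assms(3) by (rule spline_unique)
qed

lemma dspline_cong:
  assumes "\<And>v. v \<in> {0..1} \<Longrightarrow> spline x v = spline y v"
  shows "dspline x v = dspline y v"
  unfolding dspline_eq using spline_unique[OF assms] by (intro sum.cong) auto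

lemma tens_0:
  "tens d (0, v) = spline (d 0) v * B 0 0"
  "tens_v d (0, v) = dspline (d 0) v * B 0 0"
  "tens_u d (0, v) = spline (d 0) v * dB 0 0 + spline (d 1) v * dB 1 0"
  unfolding tens_eq tens_u_eq tens_v_eq spline_0[of "\<lambda>i. spline (d i) v"]
    spline_0[of "\<lambda>i. dspline (d i) v"] dspline_0 by (rule refl)+

text \<open>As \<open>B 0 0\<close> is nonzero, the values at \<open>u = 0\<close> determine
  \<open>spline (d 0)\<close>, hence its derivative.\<close>

lemma tens_v_cong:
  assumes "\<And>v. v \<in> {0..1} \<Longrightarrow> tens d (0, v) = tens e (0, v)"
  shows "tens_v d (0, v) = tens_v e (0, v)"
proof -
  have "spline (d 0) v = spline (e 0) v" if "v \<in> {0..1}" for v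
    using assms[OF that] B_0_0 by (simp add: tens_0)
  then have "dspline (d 0) v = dspline (e 0) v" by (rule dspline_cong)
  then show ?thesis unfolding tens_0 by simp
qed

lemma patch_map_patch:
  assumes "patch_map p r k \<tau> F"
  obtains d e where "\<And>x. x \<in> Q \<Longrightarrow> F x = (tens d x, tens e x)"
    "patch F (\<lambda>x. (tens_u d x, tens_u e x)) (\<lambda>x. (tens_v d x, tens_v e x))"
proof -
  obtain d e where de: "\<forall>x\<in>Q. fst (F x) = tens d x" "\<forall>x\<in>Q. snd (F x) = tens e x"
    using assms by (auto simp: patch_map_def tensor_splines_def has_coeffs_iff)
  have F: "F x = (tens d x, tens e x)" if "x \<in> Q" for x
    using de that by (auto simp: prod_eq_iff)
  have D: "(F has_derivative (\<lambda>h. fst h *\<^sub>R (tens_u d x, tens_u e x) + snd h *\<^sub>R (tens_v d x, tens_v e x)))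
      (at x within Q)" if x: "x \<in> Q" for x
  proof -
    have "((\<lambda>x. (tens d x, tens e x)) has_derivative
        (\<lambda>h. (fst h * tens_u d x + snd h * tens_v d x, fst h * tens_u e x + snd h * tens_v e x))) (at x within Q)"
      by (rule has_derivative_Pair[OF has_derivative_tens[OF x] has_derivative_tens[OF x]])
    then have "(F has_derivative
        (\<lambda>h. (fst h * tens_u d x + snd h * tens_v d x, fst h * tens_u e x + snd h * tens_v e x))) (at x within Q)"
      by (rule has_derivative_transform_within[OF _ zero_less_one x]) (simp add: F)
    then show ?thesis by simp
  qed
  have "patch F (\<lambda>x. (tens_u d x, tens_u e x)) (\<lambda>x. (tens_v d x, tens_v e x))"
  proof
    show "inj_on F Q" using assms by (simp add: patch_map_def)
    show "det2 (tens_u d x, tens_u e x) (tens_v d x, tens_v e x) \<noteq> 0" if "x \<in> Q" for x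
      using assms that partial_derivatives[OF D[OF that] that]
      by (auto simp: patch_map_def jacobian_det_def det2_def)
  qed (intro D continuous_on_Pair continuous_tens | assumption)+
  then show thesis using that F by blast
qed

end

section \<open>The interface relation in terms of coefficients\<close>

locale geometry = splines +
  fixes FL FR :: "real \<times> real \<Rightarrow> real \<times> real" and \<alpha>L \<alpha>R \<beta> :: "real poly"
  assumes two_patch: "two_patch p r k \<tau> FL FR"
    and AS_G1: "AS_G1 FL FR \<alpha>L \<alpha>R \<beta>"
begin

lemma interface: "v \<in> {0..1} \<Longrightarrow> FL (0, v) = FR (0, v)"
  using two_patch by (simp add: two_patch_def)

lemma meet: "FL ` Q \<inter> FR ` Q = (\<lambda>v. FL (0, v)) ` {0..1}"
  using two_patch by (simp add: two_patch_def)

lemma alpha_neg: "v \<in> {0..1} \<Longrightarrow> poly \<alpha>L v * poly \<alpha>R v < 0"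
  using AS_G1 by (simp add: AS_G1_def)

lemma inj: "inj_on FL Q" "inj_on FR Q"
  using two_patch by (auto simp: two_patch_def patch_map_def)

text \<open>The derivative along the interface is taken from the left patch; when the traces agree,
  the right patch has the same one.\<close>

definition interface_relation :: "(nat \<Rightarrow> nat \<Rightarrow> real) \<Rightarrow> (nat \<Rightarrow> nat \<Rightarrow> real) \<Rightarrow> bool" where
  "interface_relation d e \<longleftrightarrow> (\<forall>v\<in>{0..1}.
    poly \<alpha>R v * tens_u d (0, v) - poly \<alpha>L v * tens_u e (0, v) + poly \<beta> v * tens_v d (0, v) = 0)"

lemma C1_iff:
  assumes \<phi>: "\<And>x. x \<in> Q \<Longrightarrow> \<phi> (FL x) = tens d x" "\<And>x. x \<in> Q \<Longrightarrow> \<phi> (FR x) = tens e x"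
  shows "\<phi> \<in> C1 (domain FL FR) \<longleftrightarrow> interface_relation d e"
proof -
  obtain a1 a2 where L: "\<And>x. x \<in> Q \<Longrightarrow> FL x = (tens a1 x, tens a2 x)"
    "patch FL (\<lambda>x. (tens_u a1 x, tens_u a2 x)) (\<lambda>x. (tens_v a1 x, tens_v a2 x))"
    using patch_map_patch two_patch unfolding two_patch_def by blast
  obtain b1 b2 where R: "\<And>x. x \<in> Q \<Longrightarrow> FR x = (tens b1 x, tens b2 x)"
    "patch FR (\<lambda>x. (tens_u b1 x, tens_u b2 x)) (\<lambda>x. (tens_v b1 x, tens_v b2 x))"
    using patch_map_patch two_patch unfolding two_patch_def by blast
  interpret L: patch FL "\<lambda>x. (tens_u a1 x, tens_u a2 x)" "\<lambda>x. (tens_v a1 x, tens_v a2 x)" by (rule L(2))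
  interpret R: patch FR "\<lambda>x. (tens_u b1 x, tens_u b2 x)" "\<lambda>x. (tens_v b1 x, tens_v b2 x)" by (rule R(2))
  have Q0: "(0, v) \<in> Q" if "v \<in> {0..1}" for v using that by (simp add: Q_def)
  have "tens a1 (0, v) = tens b1 (0, v) \<and> tens a2 (0, v) = tens b2 (0, v)" if "v \<in> {0..1}" for v
    using interface[OF that] L(1)[OF Q0[OF that]] R(1)[OF Q0[OF that]] by simp
  then have ab: "tens_v a1 (0, v) = tens_v b1 (0, v)" "tens_v a2 (0, v) = tens_v b2 (0, v)" for v
    using tens_v_cong[of a1 b1 v] tens_v_cong[of a2 b2 v] by auto
  interpret two_patches FL "\<lambda>x. (tens_u a1 x, tens_u a2 x)" "\<lambda>x. (tens_v a1 x, tens_v a2 x)"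
    FR "\<lambda>x. (tens_u b1 x, tens_u b2 x)" "\<lambda>x. (tens_v b1 x, tens_v b2 x)"
    "poly \<alpha>L" "poly \<alpha>R" "poly \<beta>"
  proof
    fix v :: real assume v: "v \<in> {0..1}"
    show "FL (0, v) = FR (0, v)" by (rule interface[OF v])
    show "(tens_v a1 (0, v), tens_v a2 (0, v)) = (tens_v b1 (0, v), tens_v b2 (0, v))"
      using ab by simp
    show "poly \<alpha>L v \<noteq> 0" using alpha_neg[OF v] by auto
    have "vector_derivative (\<lambda>t. FL (0, t)) (at v within {0..1}) = D\<^sub>v FL (0, v)"
      by (simp add: D\<^sub>v_def)
    then show "poly \<alpha>R v *\<^sub>R (tens_u a1 (0, v), tens_u a2 (0, v))
        - poly \<alpha>L v *\<^sub>R (tens_u b1 (0, v), tens_u b2 (0, v))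
        + poly \<beta> v *\<^sub>R (tens_v a1 (0, v), tens_v a2 (0, v)) = 0"
      using AS_G1 v unfolding AS_G1_def
        partial_derivatives[OF L.F[OF Q0[OF v]] Q0[OF v], symmetric]
        partial_derivatives[OF R.F[OF Q0[OF v]] Q0[OF v], symmetric] by metis
  qed (rule meet)
  show ?thesis unfolding domain_def interface_relation_def
  proof (rule C1_iff[where gL = "tens d" and gR = "tens e" and gLu = "tens_u d" and gLv = "tens_v d" and gRu = "tens_u e" and gRv = "tens_v e"])
    fix v :: real assume "v \<in> {0..1}"
    show "tens_v d (0, v) = tens_v e (0, v)"
    \<comment> \<open>Both traces are values of the single function \<phi> at the same interface
      point.\<close>
    proof (rule tens_v_cong)
      fix w :: real assume w: "w \<in> {0..1}"
      show "tens d (0, w) = tens e (0, w)"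
        using \<phi>(1)[OF Q0[OF w]] \<phi>(2)[OF Q0[OF w]] interface[OF w] by simp
    qed
  qed (intro has_derivative_tens continuous_tens \<phi> | assumption)+
qed

end

section \<open>The local gluing spaces\<close>

lemma subspace_poly_below: "subspace (poly_below m)"
  using findim_poly_below by (rule findim_subspace)

lemma poly_below_mult_iff:
  assumes "b \<noteq> 0"
  shows "b * a \<in> poly_below (m + degree b) \<longleftrightarrow> a \<in> poly_below m"
  using assms by (cases "a = 0") (auto simp: poly_below_iff degree_mult_eq)

text \<open>A polynomial is its value at \<xi> plus a multiple of the linear factor; the degree
  bound falls on the quotient alone, as constants always satisfy it.\<close>

lemma poly_below_linear_iff:
  "[:- \<xi>, 1:] * a + [:c:] \<in> poly_below (Suc m) \<longleftrightarrow> a \<in> poly_below m"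
proof -
  have c: "[:c:] \<in> poly_below (Suc m)" by (simp add: poly_below_Suc)
  have "[:- \<xi>, 1:] * a + [:c:] \<in> poly_below (Suc m) \<longleftrightarrow> [:- \<xi>, 1:] * a \<in> poly_below (Suc m)"
  proof
    assume "[:- \<xi>, 1:] * a + [:c:] \<in> poly_below (Suc m)"
    from subspace_diff[OF subspace_poly_below this c]
    show "[:- \<xi>, 1:] * a \<in> poly_below (Suc m)" by (simp only: add_diff_cancel_right')
  qed (rule subspace_add[OF subspace_poly_below _ c])
  also have "\<dots> \<longleftrightarrow> a \<in> poly_below m" using poly_below_mult_iff[of "[:- \<xi>, 1:]" a m] by simp
  finally show ?thesis .
qed

lemma power_dvd_pderiv:
  fixes a :: "real poly"
  assumes "[:- \<xi>, 1:] ^ Suc m dvd a"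
  shows "[:- \<xi>, 1:] ^ m dvd pderiv a"
proof -
  obtain h where h: "a = [:- \<xi>, 1:] ^ Suc m * h" using assms by (rule dvdE)
  have "[:- \<xi>, 1:] ^ m dvd [:- \<xi>, 1:] ^ Suc m * pderiv h" by (simp del: mult_pCons_left)
  moreover have "[:- \<xi>, 1:] ^ m dvd smult (of_nat (Suc m)) (h * [:- \<xi>, 1:] ^ m)"
    by (intro dvd_smult) simp
  ultimately show ?thesis unfolding h lemma_order_pderiv1 by (rule dvd_add)
qed

locale gluing = splines +
  fixes \<alpha>L \<alpha>R \<beta>L \<beta>R \<beta> :: "real poly"
  assumes deg: "degree \<alpha>L \<le> 1" "degree \<alpha>R \<le> 1" "degree \<beta>L \<le> 1" "degree \<beta>R \<le> 1"
    and coprime: "coprime \<alpha>L \<alpha>R"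
    and neg: "v \<in> {0..1} \<Longrightarrow> poly \<alpha>L v * poly \<alpha>R v < 0"
    and \<beta>: "\<beta> = \<alpha>L * \<beta>R - \<alpha>R * \<beta>L"
begin

definition d\<alpha> :: nat where "d\<alpha> = max (degree \<alpha>L) (degree \<alpha>R)"

lemma alpha_nz: "v \<in> {0..1} \<Longrightarrow> poly \<alpha>L v \<noteq> 0" "v \<in> {0..1} \<Longrightarrow> poly \<alpha>R v \<noteq> 0"
  using neg by fastforce+

lemma alpha_nonzero: "\<alpha>L \<noteq> 0" "\<alpha>R \<noteq> 0"
  using alpha_nz[of 0] by auto

text \<open>The interface relation at a single index; index \<open>0\<close> stands for the leading
  polynomials.\<close>

definition glued :: "nat \<Rightarrow> (real poly \<times> real poly \<times> real poly) set" where
  "glued i = {(a, x, y). a \<in> jumps p r i \<and> x \<in> jumps p r i \<and> y \<in> jumps p r i \<and>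
     \<alpha>R * x - \<alpha>L * y + \<beta> * pderiv a = 0}"

text \<open>A triple \<open>(a, x, y)\<close> consists of the jumps of the trace and of the two transversal derivatives
  across the knot \<open>i\<close>. Since \<open>\<alpha>L\<close> and \<open>\<alpha>R\<close> are coprime, \<open>\<alpha>L\<close> divides \<open>x - \<beta>L * pderiv a\<close>, and the quotient \<open>w\<close>
  also determines \<open>y\<close>.\<close>

definition param :: "real poly \<times> real poly \<Rightarrow> real poly \<times> real poly \<times> real poly" where
  "param z = (fst z, \<beta>L * pderiv (fst z) + \<alpha>L * snd z, \<beta>R * pderiv (fst z) + \<alpha>R * snd z)"

definition params :: "nat \<Rightarrow> (real poly \<times> real poly) set" where
  "params i = {(a, w). a \<in> jumps p r i \<and> \<beta>L * pderiv a + \<alpha>L * w \<in> jumps p r i \<and>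
     \<beta>R * pderiv a + \<alpha>R * w \<in> jumps p r i}"

lemma linear_param: "linear param"
  by (auto simp: linear_iff param_def pderiv_add pderiv_smult smult_add_right algebra_simps)

lemma inj_param: "inj param"
  using alpha_nonzero by (auto simp: inj_def param_def prod_eq_iff)

lemma glued_eq: "glued i = param ` params i"
proof
  show "param ` params i \<subseteq> glued i"
    by (auto simp: param_def params_def glued_def) (simp add: \<beta> algebra_simps)
  show "glued i \<subseteq> param ` params i"
  proof clarify
    fix a x y assume g: "(a, x, y) \<in> glued i"
    then have "\<alpha>R * x - \<alpha>L * y + \<beta> * pderiv a = 0" by (simp add: glued_def)
    \<comment> \<open>Inserting \<open>\<beta> = \<alpha>L * \<beta>R - \<alpha>R * \<beta>L\<close>
      turns the relation into an equality of products, to which coprimality applies.\<close>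
    then have eq: "\<alpha>R * (x - \<beta>L * pderiv a) = \<alpha>L * (y - \<beta>R * pderiv a)"
      unfolding \<beta> by (simp add: algebra_simps)
    then have "\<alpha>L dvd \<alpha>R * (x - \<beta>L * pderiv a)" by simp
    then have "\<alpha>L dvd x - \<beta>L * pderiv a"
      using coprime by (simp add: coprime_dvd_mult_right_iff)
    then obtain w where w: "x - \<beta>L * pderiv a = \<alpha>L * w" by (rule dvdE)
    have "\<alpha>L * (\<alpha>R * w) = \<alpha>L * (y - \<beta>R * pderiv a)"
      using eq unfolding w by (simp add: mult.left_commute)
    then have "y - \<beta>R * pderiv a = \<alpha>R * w" using alpha_nonzero by simp
    then have xy: "x = \<beta>L * pderiv a + \<alpha>L * w" "y = \<beta>R * pderiv a + \<alpha>R * w"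
      using w by (simp_all add: algebra_simps)
    then have "(a, w) \<in> params i" using g by (simp add: glued_def params_def)
    moreover have "(a, x, y) = param (a, w)" by (simp add: param_def xy)
    ultimately show "(a, x, y) \<in> param ` params i" by (rule rev_image_eqI)
  qed
qed

text \<open>Differentiation compensates a linear factor, so the \<beta>-terms have degree at most
  \<open>p\<close>. The bound on \<open>w\<close> comes from whichever of \<open>\<alpha>L\<close>
  and \<open>\<alpha>R\<close> has the larger degree.\<close>

lemma poly_below_param_iff:
  assumes a: "a \<in> poly_below (p + 1)"
  shows "\<beta>L * pderiv a + \<alpha>L * w \<in> poly_below (p + 1) \<and> \<beta>R * pderiv a + \<alpha>R * w \<in> poly_below (p + 1)
    \<longleftrightarrow> w \<in> poly_below (p + 1 - d\<alpha>)"
proof -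
  have "b * pderiv a \<in> poly_below (p + 1)" if "degree b \<le> 1" for b
  proof -
    have "degree a \<le> p" using a by (simp add: poly_below_Suc)
    then have "degree (b * pderiv a) \<le> 1 + (p - 1)"
      using that degree_mult_le[of b "pderiv a"] degree_pderiv[of a] by linarith
    then show ?thesis using p by (simp add: poly_below_Suc)
  qed
  then have "b * pderiv a + c \<in> poly_below (p + 1) \<longleftrightarrow> c \<in> poly_below (p + 1)" if "degree b \<le> 1" for b c
    using that subspace_add[OF subspace_poly_below, of "b * pderiv a" "p + 1" c]
      subspace_diff[OF subspace_poly_below, of "b * pderiv a + c" "p + 1" "b * pderiv a"] by auto
  moreover have "c * w \<in> poly_below (p + 1) \<longleftrightarrow> w \<in> poly_below (p + 1 - degree c)"
    if "c \<noteq> 0" "degree c \<le> 1" for c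
    using poly_below_mult_iff[OF that(1), of w "p + 1 - degree c"] that(2) by simp
  moreover have "w \<in> poly_below (p + 1 - degree \<alpha>L) \<and> w \<in> poly_below (p + 1 - degree \<alpha>R)
      \<longleftrightarrow> w \<in> poly_below (p + 1 - d\<alpha>)"
    by (auto simp: poly_below_iff d\<alpha>_def max_def)
  ultimately show ?thesis using deg alpha_nonzero by simp
qed

lemma jumps_iff: "a \<in> jumps p r i \<longleftrightarrow> a \<in> poly_below (p + 1) \<and> (i = 0 \<or> M i ^ (r + 1) dvd a)"
  by (simp add: jumps_def poly_below_Suc del: power_Suc)

lemma findim_params_0: "findim (params 0) (2 * p + 2 - d\<alpha>)"
proof -
  have "params 0 = poly_below (p + 1) \<times> poly_below (p + 1 - d\<alpha>)"
    using poly_below_param_iff by (auto simp: params_def jumps_iff)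
  moreover have "findim (poly_below (p + 1) \<times> poly_below (p + 1 - d\<alpha>)) (p + 1 + (p + 1 - d\<alpha>))"
    by (intro findim_Times findim_poly_below)
  moreover have "p + 1 + (p + 1 - d\<alpha>) = 2 * p + 2 - d\<alpha>" using deg p by (simp add: d\<alpha>_def)
  ultimately show ?thesis by (simp only:)
qed

text \<open>At an inner knot \<open>\<xi>\<close>, write \<open>a = (x - \<xi>)\<^bsup>r+1\<^esup> A\<close> and \<open>w = (x - \<xi>)\<^sup>r C\<close>. The two sides of the interface
  impose two linear equations on \<open>(A \<xi>, C \<xi>)\<close>, whose determinant is a multiple of \<open>\<beta> \<xi>\<close>.\<close>

definition \<kappa> :: "real \<Rightarrow> real" where
  "\<kappa> \<xi> = - real (Suc r) * poly \<beta>L \<xi> / poly \<alpha>L \<xi>"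

lemma params_knot_iff:
  fixes A C :: "real poly"
  assumes "i \<noteq> 0" "i \<in> {1..k}"
  defines "\<xi> \<equiv> \<tau> i"
  shows "(M i ^ (r + 1) * A, M i ^ r * C) \<in> params i \<longleftrightarrow>
    A \<in> poly_below (p - r) \<and> C \<in> poly_below (p + 1 - d\<alpha> - r) \<and>
    (poly \<beta> \<xi> = 0 \<or> poly A \<xi> = 0) \<and> poly C \<xi> = \<kappa> \<xi> * poly A \<xi>"
proof -
  define m where "m = M i"
  have m: "m \<noteq> 0" "degree m = 1" "m = [:- \<xi>, 1:]" by (simp_all add: m_def \<xi>_def)
  have \<xi>: "\<xi> \<in> {0..1}" using tau_01[OF assms(2)] by (simp add: \<xi>_def)
  have nz: "poly \<alpha>L \<xi> \<noteq> 0" "poly \<alpha>R \<xi> \<noteq> 0" using alpha_nz \<xi> by auto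
  let ?a = "m ^ (r + 1) * A" and ?w = "m ^ r * C"
  have "p + 1 = (p - r) + degree (m ^ (r + 1))"
    using m r_less by (simp add: degree_power_eq del: power_Suc)
  then have 1: "?a \<in> poly_below (p + 1) \<longleftrightarrow> A \<in> poly_below (p - r)"
    using poly_below_mult_iff[of "m ^ (r + 1)" A "p - r"] m(1) by simp
  have e2: "p + 1 - d\<alpha> = (p + 1 - d\<alpha> - r) + degree (m ^ r)"
    using m r_less deg by (simp add: degree_power_eq d\<alpha>_def)
  have 2: "?w \<in> poly_below (p + 1 - d\<alpha>) \<longleftrightarrow> C \<in> poly_below (p + 1 - d\<alpha> - r)"
    using poly_below_mult_iff[of "m ^ r" C "p + 1 - d\<alpha> - r"] m(1) unfolding e2[symmetric] by simp
  \<comment> \<open>The factor \<open>m ^ r\<close> splits off from both terms, and divisibility of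
    the rest by \<open>m\<close> is a zero at \<xi>.\<close>
  have eval: "m ^ (r + 1) dvd b * pderiv ?a + c * ?w \<longleftrightarrow>
      real (Suc r) * poly b \<xi> * poly A \<xi> + poly c \<xi> * poly C \<xi> = 0" for b c
  proof -
    have "pderiv ?a = m ^ r * (m * pderiv A + smult (real (Suc r)) A)"
      unfolding m(3) Suc_eq_plus1[symmetric] lemma_order_pderiv1 by (simp add: algebra_simps)
    then have eq: "b * pderiv ?a + c * ?w = m ^ r * (b * (m * pderiv A + smult (real (Suc r)) A) + c * C)"
      by (simp add: algebra_simps)
    have "m ^ (r + 1) dvd b * pderiv ?a + c * ?w \<longleftrightarrow>
        m dvd b * (m * pderiv A + smult (real (Suc r)) A) + c * C"
      unfolding eq using m(1) by (simp add: power_add)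
    also have "\<dots> \<longleftrightarrow> poly (b * (m * pderiv A + smult (real (Suc r)) A) + c * C) \<xi> = 0"
      unfolding m(3) by (rule poly_eq_0_iff_dvd[symmetric])
    finally show ?thesis by (simp add: m(3) algebra_simps)
  qed
  have sys: "real (Suc r) * poly \<beta>L \<xi> * poly A \<xi> + poly \<alpha>L \<xi> * poly C \<xi> = 0 \<and>
      real (Suc r) * poly \<beta>R \<xi> * poly A \<xi> + poly \<alpha>R \<xi> * poly C \<xi> = 0 \<longleftrightarrow>
      (poly \<beta> \<xi> = 0 \<or> poly A \<xi> = 0) \<and> poly C \<xi> = \<kappa> \<xi> * poly A \<xi>"
  proof -
    define s where "s = real (Suc r)"
    have s: "s \<noteq> 0" by (simp add: s_def)
    have C: "s * poly \<beta>L \<xi> * poly A \<xi> + poly \<alpha>L \<xi> * poly C \<xi> = 0 \<longleftrightarrow> poly C \<xi> = \<kappa> \<xi> * poly A \<xi>"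
    proof -
      have K: "\<kappa> \<xi> * poly A \<xi> = - (s * poly \<beta>L \<xi> * poly A \<xi>) / poly \<alpha>L \<xi>"
        unfolding \<kappa>_def s_def[symmetric] by simp
      have E: "s * poly \<beta>L \<xi> * poly A \<xi> + poly \<alpha>L \<xi> * poly C \<xi>
          = poly C \<xi> * poly \<alpha>L \<xi> + s * poly \<beta>L \<xi> * poly A \<xi>" by (subst add.commute, subst mult.commute[of "poly \<alpha>L \<xi>"], rule refl)
      show ?thesis
        unfolding K E nonzero_eq_divide_eq[OF nz(1)] eq_neg_iff_add_eq_0 by (rule refl)
    qed
    have "s * poly \<beta>R \<xi> * poly A \<xi> + poly \<alpha>R \<xi> * poly C \<xi> = 0 \<longleftrightarrow> poly \<beta> \<xi> = 0 \<or> poly A \<xi> = 0"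
      if h: "s * poly \<beta>L \<xi> * poly A \<xi> + poly \<alpha>L \<xi> * poly C \<xi> = 0"
    proof -
      have b: "poly \<beta> \<xi> = poly \<alpha>L \<xi> * poly \<beta>R \<xi> - poly \<alpha>R \<xi> * poly \<beta>L \<xi>"
        unfolding \<beta> by simp
      \<comment> \<open>Elimination of \<open>poly C \<xi>\<close>: what remains is the determinant,
        \<open>s\<close> times the value of \<beta>, applied to \<open>poly A \<xi>\<close>.\<close>
      have "poly \<alpha>L \<xi> * (s * poly \<beta>R \<xi> * poly A \<xi> + poly \<alpha>R \<xi> * poly C \<xi>)
          = s * (poly \<beta> \<xi> * poly A \<xi>) + poly \<alpha>R \<xi> * (s * poly \<beta>L \<xi> * poly A \<xi> + poly \<alpha>L \<xi> * poly C \<xi>)"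
        unfolding b by algebra
      then have "poly \<alpha>L \<xi> * (s * poly \<beta>R \<xi> * poly A \<xi> + poly \<alpha>R \<xi> * poly C \<xi>) = s * (poly \<beta> \<xi> * poly A \<xi>)"
        unfolding h by simp
      then have "poly \<alpha>L \<xi> * (s * poly \<beta>R \<xi> * poly A \<xi> + poly \<alpha>R \<xi> * poly C \<xi>) = 0
          \<longleftrightarrow> s * (poly \<beta> \<xi> * poly A \<xi>) = 0" by (rule arg_cong)
      then show ?thesis using s nz(1) by (simp only: mult_eq_0_iff simp_thms)
    qed
    then show ?thesis using C unfolding s_def by blast
  qed
  have *: "(?a, ?w) \<in> params i \<longleftrightarrow> ?a \<in> poly_below (p + 1) \<and> ?w \<in> poly_below (p + 1 - d\<alpha>) \<and>
      m ^ (r + 1) dvd \<beta>L * pderiv ?a + \<alpha>L * ?w \<and> m ^ (r + 1) dvd \<beta>R * pderiv ?a + \<alpha>R * ?w"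
    using poly_below_param_iff[of ?a ?w] assms(1)
    unfolding params_def jumps_iff m_def[symmetric] by (auto simp del: power_Suc)
  show ?thesis by (simp only: m_def[symmetric] * 1 2 eval sys)
qed

text \<open>\<open>pderiv a\<close> keeps \<open>r\<close> of the \<open>r + 1\<close> factors of
  \<open>a\<close>, so \<open>M i ^ r\<close> divides \<open>\<alpha>L * w\<close>. As
  \<open>\<alpha>L\<close> does not vanish at the knot, it is coprime to \<open>M i\<close>, and the
  power divides \<open>w\<close>.\<close>

lemma params_knot_shape:
  assumes "i \<in> {1..k}" "(a, w) \<in> params i"
  shows "\<exists>A C. a = M i ^ (r + 1) * A \<and> w = M i ^ r * C"
proof -
  have i: "i \<noteq> 0" using assms(1) by auto
  have \<xi>: "\<tau> i \<in> {0..1}" using tau_01[OF assms(1)] by simp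
  have a: "M i ^ (r + 1) dvd a" and L: "M i ^ (r + 1) dvd \<beta>L * pderiv a + \<alpha>L * w"
    using assms(2) i by (auto simp: params_def jumps_iff simp del: power_Suc)
  have "M i ^ r dvd \<beta>L * pderiv a"
    by (rule dvd_mult[OF power_dvd_pderiv]) (use a in simp)
  moreover have "M i ^ r dvd \<beta>L * pderiv a + \<alpha>L * w"
    by (rule dvd_trans[OF le_imp_power_dvd L]) simp
  ultimately have dvd: "M i ^ r dvd \<alpha>L * w" using dvd_add_right_iff by blast
  have "coprime (M i) \<alpha>L"
  proof (rule coprimeI)
    fix c assume c: "c dvd M i" "c dvd \<alpha>L"
    \<comment> \<open>Division with remainder: a common divisor divides the remainder, a nonzero
      constant.\<close>
    have "c dvd M i * synthetic_div \<alpha>L (\<tau> i) + [:poly \<alpha>L (\<tau> i):]"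
      unfolding synthetic_div_correct' by (rule c(2))
    then have "c dvd [:poly \<alpha>L (\<tau> i):]" using dvd_mult2[OF c(1)] dvd_add_right_iff by blast
    moreover have "is_unit [:poly \<alpha>L (\<tau> i):]"
      using alpha_nz(1)[OF \<xi>] by (simp add: is_unit_const_poly_iff dvd_field_iff)
    ultimately show "is_unit c" by (rule dvd_unit_imp_unit)
  qed
  then have "coprime (M i ^ r) \<alpha>L" by simp
  then have "M i ^ r dvd w" using dvd by (simp add: coprime_dvd_mult_right_iff)
  then show ?thesis using a by (meson dvdE)
qed

text \<open>Splitting \<open>A\<close> and \<open>C\<close> into their values at the knot and
  quotients by \<open>M i\<close> gives the coordinates of \<open>f\<close>. The values are tied by
  \<kappa>, so a single parameter \<open>c = poly A \<xi>\<close> remains, which is free if \<beta>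
  vanishes at the knot and \<open>0\<close> otherwise; \<open>Z\<close> is its range.\<close>

lemma findim_params_knot:
  assumes i: "i \<in> {1..k}"
  shows "findim (params i) (2 * p - 2 * r - 1 - d\<alpha> + (if poly \<beta> (\<tau> i) = 0 then 1 else 0))"
proof -
  define \<xi> where "\<xi> = \<tau> i"
  define f where "f = (\<lambda>z :: real poly \<times> real poly \<times> real.
    (M i ^ (r + 1) * (M i * fst z + [:snd (snd z):]),
     M i ^ r * (M i * fst (snd z) + [:\<kappa> \<xi> * snd (snd z):])))"
  define Z where "Z = (if poly \<beta> \<xi> = 0 then UNIV else {0 :: real})"
  define D where "D = poly_below (p - r - 1) \<times> poly_below (p - d\<alpha> - r) \<times> Z"
  have "findim Z (if poly \<beta> \<xi> = 0 then 1 else 0)"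
    using findim_real findim_zero[where 'a = real] by (simp add: Z_def)
  then have "findim D (p - r - 1 + (p - d\<alpha> - r + (if poly \<beta> \<xi> = 0 then 1 else 0)))"
    unfolding D_def by (intro findim_Times findim_poly_below)
  moreover have "p - r - 1 + (p - d\<alpha> - r + (if poly \<beta> \<xi> = 0 then 1 else 0))
      = 2 * p - 2 * r - 1 - d\<alpha> + (if poly \<beta> \<xi> = 0 then 1 else 0)"
    using deg r_less by (auto simp: d\<alpha>_def)
  ultimately have D: "findim D (2 * p - 2 * r - 1 - d\<alpha> + (if poly \<beta> \<xi> = 0 then 1 else 0))" by (simp only:)
  have lin: "linear f"
  proof (rule linearI)
    have c: "[:x + y:] = [:x:] + [:y:]" for x y :: real by simp
    show "f (x + y) = f x + f y" for x y
      by (simp only: f_def fst_add snd_add distrib_left c add_Pair) (simp only: add_ac)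
    show "f (c *\<^sub>R x) = c *\<^sub>R f x" for c x
    proof -
      have "[:c * y:] = smult c [:y:]" "[:\<kappa> \<xi> * (c * y):] = smult c [:\<kappa> \<xi> * y:]" for y
        by simp_all
      then show ?thesis
        by (simp only: f_def fst_scaleR snd_scaleR scaleR_real_poly real_scaleR_def mult_smult_right
            smult_add_right[symmetric] scaleR_Pair)
    qed
  qed
  have "inj_on f UNIV"
  proof -
    have "z = 0" if "f z = 0" for z
    proof -
      have 1: "M i * fst z + [:snd (snd z):] = 0"
        and 2: "M i * fst (snd z) + [:\<kappa> \<xi> * snd (snd z):] = 0"
        using that by (simp_all add: f_def zero_prod_def del: power_Suc mult_pCons_left)
      have "poly (M i * fst z + [:snd (snd z):]) \<xi> = 0" unfolding 1 by simp
      then have c: "snd (snd z) = 0" by (simp add: \<xi>_def)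
      have "fst z = 0" "fst (snd z) = 0"
        using 1 2 unfolding c by (simp_all del: mult_pCons_left)
      then show "z = 0" using c by (simp add: prod_eq_iff)
    qed
    then show ?thesis using linear_injective_0[OF lin] by blast
  qed
  then have inj: "inj_on f D" by (rule inj_on_subset) simp
  have eq: "p - r = Suc (p - r - 1)" "p + 1 - d\<alpha> - r = Suc (p - d\<alpha> - r)"
    using r_less deg r by (auto simp: d\<alpha>_def)
  have i0: "i \<noteq> 0" using i by auto
  have mem: "f (A, C, c) \<in> params i \<longleftrightarrow> (A, C, c) \<in> D" for A C c
  proof -
    have "f (A, C, c) \<in> params i \<longleftrightarrow>
      M i * A + [:c:] \<in> poly_below (p - r) \<and> M i * C + [:\<kappa> \<xi> * c:] \<in> poly_below (p + 1 - d\<alpha> - r) \<and>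
      (poly \<beta> \<xi> = 0 \<or> poly (M i * A + [:c:]) \<xi> = 0) \<and>
      poly (M i * C + [:\<kappa> \<xi> * c:]) \<xi> = \<kappa> \<xi> * poly (M i * A + [:c:]) \<xi>"
      unfolding f_def fst_conv snd_conv \<xi>_def by (rule params_knot_iff[OF i0 i])
    moreover have "poly (M i * A + [:c:]) \<xi> = c" "poly (M i * C + [:\<kappa> \<xi> * c:]) \<xi> = \<kappa> \<xi> * c"
      by (simp_all add: \<xi>_def)
    moreover have "M i * A + [:c:] \<in> poly_below (p - r) \<longleftrightarrow> A \<in> poly_below (p - r - 1)"
      using poly_below_linear_iff[of "\<tau> i" A c "p - r - 1"] unfolding eq(1)[symmetric] .
    moreover have "M i * C + [:\<kappa> \<xi> * c:] \<in> poly_below (p + 1 - d\<alpha> - r) \<longleftrightarrow> C \<in> poly_below (p - d\<alpha> - r)"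
      using poly_below_linear_iff[of "\<tau> i" C "\<kappa> \<xi> * c" "p - d\<alpha> - r"] unfolding eq(2)[symmetric] .
    ultimately have "f (A, C, c) \<in> params i \<longleftrightarrow>
        A \<in> poly_below (p - r - 1) \<and> C \<in> poly_below (p - d\<alpha> - r) \<and> (poly \<beta> \<xi> = 0 \<or> c = 0)"
      by (simp only: simp_thms)
    then show ?thesis by (simp add: D_def Z_def)
  qed
  have "params i = f ` D"
  proof
    show "f ` D \<subseteq> params i" using mem by auto
    show "params i \<subseteq> f ` D"
    proof clarify
      fix a w assume aw: "(a, w) \<in> params i"
      then obtain A C where AC: "a = M i ^ (r + 1) * A" "w = M i ^ r * C"
        using params_knot_shape[OF i] by blast
      then have C: "poly C \<xi> = \<kappa> \<xi> * poly A \<xi>"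
        using aw params_knot_iff[OF i0 i, of A C] by (simp add: \<xi>_def del: power_Suc)
      have "M i * synthetic_div A \<xi> + [:poly A \<xi>:] = A"
        unfolding \<xi>_def by (rule synthetic_div_correct')
      moreover have "M i * synthetic_div C \<xi> + [:\<kappa> \<xi> * poly A \<xi>:] = C"
        unfolding C[symmetric] unfolding \<xi>_def by (rule synthetic_div_correct')
      ultimately have z: "f (synthetic_div A \<xi>, synthetic_div C \<xi>, poly A \<xi>) = (a, w)"
        by (simp only: AC f_def fst_conv snd_conv)
      then have "(synthetic_div A \<xi>, synthetic_div C \<xi>, poly A \<xi>) \<in> D"
        unfolding mem[symmetric] z by (intro aw)
      then show "(a, w) \<in> f ` D" unfolding z[symmetric] by (rule imageI)
    qed
  qed
  then show ?thesis using findim_image[OF lin inj D] by (simp add: \<xi>_def)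
qed

lemma findim_glued:
  assumes "i \<le> k"
  shows "findim (glued i) (if i = 0 then 2 * p + 2 - d\<alpha>
    else 2 * p - 2 * r - 1 - d\<alpha> + (if poly \<beta> (\<tau> i) = 0 then 1 else 0))"
proof -
  have inj: "inj_on param (params i)" by (rule inj_on_subset[OF inj_param]) simp
  show ?thesis
    unfolding glued_eq
    by (rule findim_image[OF linear_param inj])
      (use assms findim_params_0 findim_params_knot[of i] in \<open>cases "i = 0"; simp\<close>)
qed

end

section \<open>Dimensions\<close>

locale glued_geometry = geometry k \<tau> p r FL FR \<alpha>L \<alpha>R \<beta> + gluing k \<tau> p r \<alpha>L \<alpha>R \<beta>L \<beta>R \<beta>
  for k \<tau> p r FL FR \<alpha>L \<alpha>R \<beta>L \<beta>R \<beta>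
begin

section \<open>From functions on the domain to coefficients\<close>

definition vecs :: "(nat \<Rightarrow> real) set" where
  "vecs = {x. \<forall>j. j \<notin> {..n} \<longrightarrow> x j = 0}"

definition rows :: "nat set \<Rightarrow> (nat \<Rightarrow> nat \<Rightarrow> real) set" where
  "rows I = {d. (\<forall>i\<in>I. d i \<in> vecs) \<and> (\<forall>i. i \<notin> I \<longrightarrow> d i = 0)}"

text \<open>\<open>I\<close> lists the first indices at which coefficients may be nonzero:
  \<open>{..n}\<close>, \<open>{2..n}\<close> and \<open>{0, 1}\<close> give the three spaces.
  Continuity is \<open>d 0 = e 0\<close>, because only index \<open>0\<close> contributes to the
  trace.\<close>

definition glued_coeffs :: "nat set \<Rightarrow> ((nat \<Rightarrow> nat \<Rightarrow> real) \<times> (nat \<Rightarrow> nat \<Rightarrow> real)) set" where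
  "glued_coeffs I = {(d, e). d \<in> rows I \<and> e \<in> rows I \<and> d 0 = e 0 \<and> interface_relation d e}"

text \<open>The left patch takes precedence on the interface. The value \<open>0\<close> elsewhere
  is the convention of \<open>V\<close> outside the domain.\<close>

definition glue :: "(nat \<Rightarrow> nat \<Rightarrow> real) \<times> (nat \<Rightarrow> nat \<Rightarrow> real) \<Rightarrow> real \<times> real \<Rightarrow> real" where
  "glue z y = (if y \<in> FL ` Q then tens (fst z) (the_inv_into Q FL y)
     else if y \<in> FR ` Q then tens (snd z) (the_inv_into Q FR y) else 0)"

lemma linear_glue: "linear glue"
  by (auto simp: linear_iff fun_eq_iff glue_def tens_def scaleR_fun_def sum.distrib distrib_right
      sum_distrib_left mult.assoc)

lemma Q_0: "v \<in> {0..1} \<Longrightarrow> (0, v) \<in> Q"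
  by (simp add: Q_def)

lemma glue_FL: "x \<in> Q \<Longrightarrow> glue z (FL x) = tens (fst z) x"
  by (simp add: glue_def the_inv_into_f_f[OF inj(1)])

text \<open>A point of the right patch that also lies in the left one has \<open>u = 0\<close> by
  injectivity, and there \<open>fst z 0 = snd z 0\<close> makes the two values equal.\<close>

lemma glue_FR:
  assumes "fst z 0 = snd z 0" "x \<in> Q"
  shows "glue z (FR x) = tens (snd z) x"
proof (cases "FR x \<in> FL ` Q")
  case True
  then have "FR x \<in> FL ` Q \<inter> FR ` Q" using assms(2) by simp
  then obtain v where v: "v \<in> {0..1}" "FR x = FL (0, v)" unfolding meet by blast
  have "x = (0, v)"
    using inj_onD[OF inj(2) _ assms(2) Q_0[OF v(1)]] v(2) interface[OF v(1)] by simp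
  moreover have "glue z (FL (0, v)) = tens (fst z) (0, v)" by (rule glue_FL[OF Q_0[OF v(1)]])
  ultimately show ?thesis unfolding v(2) by (simp add: tens_0 assms(1))
qed (use assms(2) in \<open>simp add: glue_def the_inv_into_f_f[OF inj(2)]\<close>)

lemma rows_mono: "I \<subseteq> J \<Longrightarrow> rows I \<subseteq> rows J"
  by (auto simp: rows_def vecs_def)

lemma rows_zero: "d \<in> rows I \<Longrightarrow> n < i \<or> n < j \<Longrightarrow> I \<subseteq> {..n} \<Longrightarrow> d i j = 0"
  by (cases "i \<in> I") (auto simp: rows_def vecs_def)

lemma rows_unique:
  assumes "d \<in> rows {..n}" "d' \<in> rows {..n}" "\<And>x. x \<in> Q \<Longrightarrow> tens d x = tens d' x"
  shows "d = d'"
proof (intro ext)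
  fix i j show "d i j = d' i j"
    using tens_unique[OF assms(3), of i j] rows_zero[OF assms(1), of i j] rows_zero[OF assms(2), of i j]
    by (cases "i \<le> n \<and> j \<le> n") (auto simp: not_le)
qed

lemma inj_glue: "inj_on glue (glued_coeffs {..n})"
proof (rule inj_onI)
  fix z z' assume z: "z \<in> glued_coeffs {..n}" "z' \<in> glued_coeffs {..n}" "glue z = glue z'"
  have "fst z = fst z'"
    using z glue_FL[of _ z] glue_FL[of _ z'] by (intro rows_unique) (auto simp: glued_coeffs_def)
  moreover have "snd z = snd z'"
    using z glue_FR[of z] glue_FR[of z'] by (intro rows_unique) (auto simp: glued_coeffs_def)
  ultimately show "z = z'" by (simp add: prod_eq_iff)
qed

lemma rows_of_coeffs:
  assumes "has_coeffs p r k \<tau> g d" and "\<And>i j. i \<le> n \<Longrightarrow> j \<le> n \<Longrightarrow> i \<notin> I \<Longrightarrow> d i j = 0" and "I \<subseteq> {..n}"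
  shows "\<exists>d' \<in> rows I. \<forall>x\<in>Q. g x = tens d' x"
proof
  let ?d = "\<lambda>i j. if i \<in> I \<and> j \<le> n then d i j else 0"
  show "?d \<in> rows I" by (auto simp: rows_def vecs_def)
  have "tens ?d x = tens d x" for x
    unfolding tens_def using assms(2) by (intro sum.cong refl) auto
  then show "\<forall>x\<in>Q. g x = tens ?d x" using assms(1) by (simp add: has_coeffs_iff)
qed

lemma glue_in_V1:
  assumes "z \<in> glued_coeffs I" "I \<subseteq> {..n}"
  shows "glue z \<in> V1 p r k \<tau> FL FR"
    "has_coeffs p r k \<tau> (glue z \<circ> FL) (fst z)" "has_coeffs p r k \<tau> (glue z \<circ> FR) (snd z)"
proof -
  have z: "fst z 0 = snd z 0" "interface_relation (fst z) (snd z)"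
    using assms(1) by (auto simp: glued_coeffs_def)
  show c: "has_coeffs p r k \<tau> (glue z \<circ> FL) (fst z)" "has_coeffs p r k \<tau> (glue z \<circ> FR) (snd z)"
    using glue_FL[of _ z] glue_FR[OF z(1)] by (auto simp: has_coeffs_iff)
  have "glue z \<in> C1 (domain FL FR)"
    using C1_iff[of "glue z" "fst z" "snd z"] glue_FL[of _ z] glue_FR[OF z(1)] z(2) by blast
  moreover have "glue z x = 0" if "x \<notin> domain FL FR" for x
    using that by (simp add: domain_def glue_def)
  ultimately show "glue z \<in> V1 p r k \<tau> FL FR"
    using c by (auto simp: V1_def V_def tensor_splines_def)
qed

text \<open>The common core of the three inclusions below. Equal traces give
  \<open>d 0 = e 0\<close> by uniqueness of coefficients, and smoothness gives the interface
  relation.\<close>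

lemma V1_obtain:
  assumes \<phi>: "\<phi> \<in> V1 p r k \<tau> FL FR" and I: "I \<subseteq> {..n}"
    and d: "has_coeffs p r k \<tau> (\<phi> \<circ> FL) d" "\<And>i j. i \<le> n \<Longrightarrow> j \<le> n \<Longrightarrow> i \<notin> I \<Longrightarrow> d i j = 0"
    and e: "has_coeffs p r k \<tau> (\<phi> \<circ> FR) e" "\<And>i j. i \<le> n \<Longrightarrow> j \<le> n \<Longrightarrow> i \<notin> I \<Longrightarrow> e i j = 0"
  shows "\<phi> \<in> glue ` glued_coeffs I"
proof -
  obtain d' where d': "d' \<in> rows I" "\<And>x. x \<in> Q \<Longrightarrow> \<phi> (FL x) = tens d' x"
    using rows_of_coeffs[OF d I] by auto
  obtain e' where e': "e' \<in> rows I" "\<And>x. x \<in> Q \<Longrightarrow> \<phi> (FR x) = tens e' x"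
    using rows_of_coeffs[OF e I] by auto
  have "spline (d' 0) v = spline (e' 0) v" if v: "v \<in> {0..1}" for v
    using d'(2)[OF Q_0[OF v]] e'(2)[OF Q_0[OF v]] interface[OF v] B_0_0 by (simp add: tens_0)
  then have "d' 0 j = e' 0 j" if "j \<le> n" for j using that by (rule spline_unique)
  then have de: "d' 0 = e' 0"
    using rows_zero[OF d'(1) _ I, of 0] rows_zero[OF e'(1) _ I, of 0] by (metis ext not_le)
  have "interface_relation d' e'"
    using C1_iff[OF d'(2) e'(2)] \<phi> by (simp add: V1_def)
  then have z: "(d', e') \<in> glued_coeffs I" using d' e' de by (simp add: glued_coeffs_def)
  have "\<phi> y = glue (d', e') y" for y
  proof (cases "y \<in> domain FL FR")
    case True
    then show ?thesis
      using glue_FL[of _ "(d', e')"] glue_FR[of "(d', e')"] de d'(2) e'(2) by (auto simp: domain_def)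
  next
    case False
    then have "\<phi> y = 0" using \<phi> unfolding V1_def V_def by blast
    then show ?thesis using False by (simp add: glue_def domain_def)
  qed
  then have "\<phi> = glue (d', e')" by (rule ext)
  then show ?thesis using z by blast
qed

lemma V1_eq: "V1 p r k \<tau> FL FR = glue ` glued_coeffs {..n}"
proof
  show "V1 p r k \<tau> FL FR \<subseteq> glue ` glued_coeffs {..n}"
  proof
    fix \<phi> assume \<phi>: "\<phi> \<in> V1 p r k \<tau> FL FR"
    then obtain d e where "has_coeffs p r k \<tau> (\<phi> \<circ> FL) d" "has_coeffs p r k \<tau> (\<phi> \<circ> FR) e"
      by (auto simp: V1_def V_def tensor_splines_def)
    then show "\<phi> \<in> glue ` glued_coeffs {..n}" by (intro V1_obtain[OF \<phi>]) auto
  qed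
qed (use glue_in_V1(1) in auto)

lemma V1_1_eq: "V1\<^sub>1 p r k \<tau> FL FR = glue ` glued_coeffs {2..n}"
proof
  show "V1\<^sub>1 p r k \<tau> FL FR \<subseteq> glue ` glued_coeffs {2..n}"
  proof
    fix \<phi> assume \<phi>: "\<phi> \<in> V1\<^sub>1 p r k \<tau> FL FR"
    then have \<phi>': "\<phi> \<in> V1 p r k \<tau> FL FR" by (simp add: V1\<^sub>1_def)
    obtain d where d: "has_coeffs p r k \<tau> (\<phi> \<circ> FL) d" "\<And>i j. i \<in> {0, 1} \<Longrightarrow> j \<le> n \<Longrightarrow> d i j = 0"
      using \<phi> unfolding V1\<^sub>1_def by blast
    obtain e where e: "has_coeffs p r k \<tau> (\<phi> \<circ> FR) e" "\<And>i j. i \<in> {0, 1} \<Longrightarrow> j \<le> n \<Longrightarrow> e i j = 0"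
      using \<phi> unfolding V1\<^sub>1_def by blast
    have "i \<in> {0, 1}" if "i \<le> n" "i \<notin> {2..n}" for i using that by auto
    then show "\<phi> \<in> glue ` glued_coeffs {2..n}"
      using d e by (intro V1_obtain[OF \<phi>' _ d(1) _ e(1)]) auto
  qed
  show "glue ` glued_coeffs {2..n} \<subseteq> V1\<^sub>1 p r k \<tau> FL FR"
  proof clarify
    fix d e assume z: "(d, e) \<in> glued_coeffs {2..n}"
    have "d i = 0" "e i = 0" if "i \<in> {0, 1}" for i
      using z that by (auto simp: glued_coeffs_def rows_def)
    then have 0: "\<forall>i\<in>{0, 1}. \<forall>j\<le>n. d i j = 0" "\<forall>i\<in>{0, 1}. \<forall>j\<le>n. e i j = 0" by auto
    have I: "{2..n} \<subseteq> {..n}" using n_ge by auto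
    show "glue (d, e) \<in> V1\<^sub>1 p r k \<tau> FL FR"
      unfolding V1\<^sub>1_def
    proof (intro CollectI conjI ballI)
      show "glue (d, e) \<in> V1 p r k \<tau> FL FR" by (rule glue_in_V1[OF z I])
      fix F assume "F \<in> {FL, FR}"
      then show "\<exists>c. has_coeffs p r k \<tau> (glue (d, e) \<circ> F) c \<and> (\<forall>i\<in>{0, 1}. \<forall>j\<le>n. c i j = 0)"
      proof (elim insertE emptyE)
        assume "F = FL"
        then show ?thesis using glue_in_V1(2)[OF z I] 0(1) by (intro exI[of _ d] conjI) simp_all
      next
        assume "F = FR"
        then show ?thesis using glue_in_V1(3)[OF z I] 0(2) by (intro exI[of _ e] conjI) simp_all
      qed
    qed
  qed
qed

lemma V1_2_eq: "V1\<^sub>2 p r k \<tau> FL FR = glue ` glued_coeffs {0, 1}"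
proof
  have I: "{0, 1} \<subseteq> {..n}" using n_ge by auto
  show "V1\<^sub>2 p r k \<tau> FL FR \<subseteq> glue ` glued_coeffs {0, 1}"
  proof
    fix \<phi> assume \<phi>: "\<phi> \<in> V1\<^sub>2 p r k \<tau> FL FR"
    then have \<phi>': "\<phi> \<in> V1 p r k \<tau> FL FR" by (simp add: V1\<^sub>2_def)
    obtain d where d: "has_coeffs p r k \<tau> (\<phi> \<circ> FL) d" "\<And>i j. i \<in> {2..n} \<Longrightarrow> j \<le> n \<Longrightarrow> d i j = 0"
      using \<phi> unfolding V1\<^sub>2_def by blast
    obtain e where e: "has_coeffs p r k \<tau> (\<phi> \<circ> FR) e" "\<And>i j. i \<in> {2..n} \<Longrightarrow> j \<le> n \<Longrightarrow> e i j = 0"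
      using \<phi> unfolding V1\<^sub>2_def by blast
    have "i \<in> {2..n}" if "i \<le> n" "i \<notin> {0, 1}" for i using that by auto
    then show "\<phi> \<in> glue ` glued_coeffs {0, 1}"
      using d e by (intro V1_obtain[OF \<phi>' I d(1) _ e(1)]) auto
  qed
  show "glue ` glued_coeffs {0, 1} \<subseteq> V1\<^sub>2 p r k \<tau> FL FR"
  proof clarify
    fix d e assume z: "(d, e) \<in> glued_coeffs {0, 1}"
    have "d i = 0" "e i = 0" if "i \<in> {2..n}" for i
      using z that by (auto simp: glued_coeffs_def rows_def)
    then have 0: "\<forall>i\<in>{2..n}. \<forall>j\<le>n. d i j = 0" "\<forall>i\<in>{2..n}. \<forall>j\<le>n. e i j = 0" by auto
    have I: "{0, 1} \<subseteq> {..n}" using n_ge by auto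
    show "glue (d, e) \<in> V1\<^sub>2 p r k \<tau> FL FR"
      unfolding V1\<^sub>2_def
    proof (intro CollectI conjI ballI)
      show "glue (d, e) \<in> V1 p r k \<tau> FL FR" by (rule glue_in_V1[OF z I])
      fix F assume "F \<in> {FL, FR}"
      then show "\<exists>c. has_coeffs p r k \<tau> (glue (d, e) \<circ> F) c \<and> (\<forall>i\<in>{2..n}. \<forall>j\<le>n. c i j = 0)"
      proof (elim insertE emptyE)
        assume "F = FL"
        then show ?thesis using glue_in_V1(2)[OF z I] 0(1) by (intro exI[of _ d] conjI) simp_all
      next
        assume "F = FR"
        then show ?thesis using glue_in_V1(3)[OF z I] 0(2) by (intro exI[of _ e] conjI) simp_all
      qed
    qed
  qed
qed

section \<open>Coefficients away from the interface\<close>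

lemma findim_vecs: "findim vecs (n + 1)"
  using findim_fun[of "{..n}"] by (simp add: vecs_def)

lemma findim_rows: "finite I \<Longrightarrow> findim (rows I) (card I * (n + 1))"
  unfolding rows_def using findim_Pi[of I "\<lambda>_. vecs" "\<lambda>_. n + 1"] findim_vecs by simp

lemma interface_relation_cong:
  assumes "d 0 = d' 0" "d 1 = d' 1" "e 0 = e' 0" "e 1 = e' 1"
  shows "interface_relation d e \<longleftrightarrow> interface_relation d' e'"
  unfolding interface_relation_def tens_0 assms by (rule refl)

text \<open>The relation sees only the indices \<open>0\<close> and \<open>1\<close>, where all
  coefficients are zero here.\<close>

lemma glued_coeffs_inner: "glued_coeffs {2..n} = rows {2..n} \<times> rows {2..n}"
proof -
  have "d 0 = e 0 \<and> interface_relation d e" if "d \<in> rows {2..n}" "e \<in> rows {2..n}" for d e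
  proof -
    have "d 0 = 0" "d 1 = 0" "e 0 = 0" "e 1 = 0" using that by (auto simp: rows_def)
    moreover have "interface_relation 0 0"
      by (simp add: interface_relation_def tens_u_def tens_v_def)
    ultimately show ?thesis using interface_relation_cong[of d 0 e 0] by simp
  qed
  then show ?thesis by (auto simp: glued_coeffs_def)
qed

lemma findim_glued_coeffs_inner: "findim (glued_coeffs {2..n}) (2 * (n - 1) * (n + 1))"
proof -
  have eq: "2 * (n - 1) * (n + 1) = (n - 1) * (n + 1) + (n - 1) * (n + 1)"
    by (simp only: mult_2 add_mult_distrib)
  have "findim (rows {2..n}) ((n - 1) * (n + 1))"
    using findim_rows[of "{2..n}"] by simp
  from findim_Times[OF this this] show ?thesis
    unfolding glued_coeffs_inner eq .
qed

section \<open>Coefficients next to the interface\<close>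

text \<open>The univariate B-spline coefficients of the trace at \<open>u = 0\<close>; those of the
  \<open>u\<close>-derivative there are in \<open>trace1\<close>.\<close>

definition trace0 :: "(nat \<Rightarrow> nat \<Rightarrow> real) \<Rightarrow> nat \<Rightarrow> real" where
  "trace0 d j = B 0 0 * d 0 j"

definition trace1 :: "(nat \<Rightarrow> nat \<Rightarrow> real) \<Rightarrow> nat \<Rightarrow> real" where
  "trace1 d j = dB 0 0 * d 0 j + dB 1 0 * d 1 j"

lemma tens_trace:
  "tens_v d (0, v) = dspline (trace0 d) v" "tens_u d (0, v) = spline (trace1 d) v"
  unfolding tens_0 trace0_def[abs_def] trace1_def[abs_def] dspline_eq spline_add spline_scale
  by (simp_all add: sum_distrib_left sum_distrib_right mult_ac)

text \<open>The trace is read off the left patch alone, since \<open>glued_coeffs\<close> makes it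
  common to both.\<close>

definition traces :: "(nat \<Rightarrow> nat \<Rightarrow> real) \<times> (nat \<Rightarrow> nat \<Rightarrow> real) \<Rightarrow> nat \<Rightarrow> real poly \<times> real poly \<times> real poly" where
  "traces z i = (famof (trace0 (fst z)) i, famof (trace1 (fst z)) i, famof (trace1 (snd z)) i)"

lemma linear_trace: "linear trace0" "linear trace1"
  by (simp_all add: linear_iff fun_eq_iff trace0_def trace1_def scaleR_fun_def algebra_simps)

lemma scaleR_apply: "(c *\<^sub>R f) i = c *\<^sub>R f i" for f :: "'i \<Rightarrow> 'v::real_vector"
  by (simp add: scaleR_fun_def)

lemma linear_traces: "linear traces"
proof -
  have "famof (t (d + d')) = famof (t d) + famof (t d')" "famof (t (c *\<^sub>R d)) = c *\<^sub>R famof (t d)"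
    if "linear t" for t :: "(nat \<Rightarrow> nat \<Rightarrow> real) \<Rightarrow> nat \<Rightarrow> real" and c d d'
    using linear_add[OF that] linear_scale[OF that] linear_add[OF linear_famof]
      linear_scale[OF linear_famof] by simp_all
  note * = this[OF linear_trace(1)] this[OF linear_trace(2)]
  show ?thesis
    by (rule linearI) (simp_all add: fun_eq_iff traces_def * scaleR_apply)
qed

definition glued_fams :: "(nat \<Rightarrow> real poly \<times> real poly \<times> real poly) set" where
  "glued_fams = {f. (\<forall>i\<in>{..k}. f i \<in> glued i) \<and> (\<forall>i. i \<notin> {..k} \<longrightarrow> f i = 0)}"

lemma pw_cong: "(\<And>i. i \<le> k \<Longrightarrow> c i = d i) \<Longrightarrow> pw c v = pw d v"
  unfolding pw_def by (intro arg_cong2[where f = "(+)"] sum.cong) auto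

text \<open>The relation says that one piecewise polynomial vanishes on the unit interval. By
  \<open>pw_eq_0\<close> this splits into one polynomial equation per index.\<close>

lemma interface_relation_iff:
  "interface_relation d e \<longleftrightarrow> traces (d, e) \<in> glued_fams"
proof -
  let ?c = "\<lambda>i. \<alpha>R * famof (trace1 d) i - \<alpha>L * famof (trace1 e) i + \<beta> * pderiv (famof (trace0 d) i)"
  have "interface_relation d e \<longleftrightarrow> (\<forall>v\<in>{0..1}. pw ?c v = 0)"
    unfolding interface_relation_def tens_trace pw_add pw_diff pw_mult dspline_def
    by (intro ball_cong refl) (simp only: pw_famof)
  also have "\<dots> \<longleftrightarrow> (\<forall>i\<le>k. ?c i = 0)"
  proof
    assume "\<forall>v\<in>{0..1}. pw ?c v = 0"
    then show "\<forall>i\<le>k. ?c i = 0" using pw_eq_0[of ?c] by blast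
  next
    assume c: "\<forall>i\<le>k. ?c i = 0"
    show "\<forall>v\<in>{0..1}. pw ?c v = 0"
    proof
      fix v
      have "pw ?c v = pw (\<lambda>i. 0) v" by (rule pw_cong) (use c in blast)
      then show "pw ?c v = 0" by (simp only: pw_0)
    qed
  qed
  also have "\<dots> \<longleftrightarrow> traces (d, e) \<in> glued_fams"
  proof -
    have "famof x i \<in> jumps p r i" if "i \<le> k" for x i
      using famof_pfam[of x] that by (simp add: pfam_def)
    moreover have "famof x i = 0" if "\<not> i \<le> k" for x i
      using famof_pfam[of x] that by (simp add: pfam_def)
    ultimately show ?thesis
      by (auto simp: glued_fams_def glued_def traces_def zero_prod_def)
  qed
  finally show ?thesis .
qed

lemma famof_eq_0:
  assumes "famof x = 0" "x \<in> vecs"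
  shows "x = 0"
proof
  fix i
  have "spline x v = 0" if "v \<in> {0..1}" for v
    using pw_famof[OF that, of x] assms(1) by (simp only: pw_0)
  then show "x i = 0 i"
    using spline_eq_0[of x i] assms(2) by (cases "i \<le> n") (auto simp: vecs_def)
qed

lemma trace_vecs: "d \<in> rows I \<Longrightarrow> {0, 1} \<subseteq> I \<Longrightarrow> trace0 d \<in> vecs \<and> trace1 d \<in> vecs"
  by (auto simp: rows_def vecs_def trace0_def trace1_def)

text \<open>The continuity conditions without the interface relation; already here
  \<open>traces\<close> is injective.\<close>

definition outer :: "((nat \<Rightarrow> nat \<Rightarrow> real) \<times> (nat \<Rightarrow> nat \<Rightarrow> real)) set" where
  "outer = {(d, e). d \<in> rows {0, 1} \<and> e \<in> rows {0, 1} \<and> d 0 = e 0}"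

lemma glued_coeffs_outer: "glued_coeffs {0, 1} = {z \<in> outer. traces z \<in> glued_fams}"
  unfolding glued_coeffs_def outer_def interface_relation_iff by auto

lemma subspace_rows: "finite I \<Longrightarrow> subspace (rows I)"
  using findim_rows findim_subspace by blast

lemma subspace_preimage: "linear f \<Longrightarrow> subspace S \<Longrightarrow> subspace {z. f z \<in> S}"
  by (simp add: subspace_def linear_0 linear_add linear_scale)

lemma subspace_outer: "subspace outer"
proof -
  note R = subspace_rows[of "{0, 1}"]
  have "linear (\<lambda>z. fst z 0 - snd z 0 :: nat \<Rightarrow> real)"
    by (rule linearI) (simp_all add: fun_eq_iff scaleR_fun_def algebra_simps)
  from subspace_inter[OF subspace_preimage[OF this subspace_single_0] subspace_Times[OF R R]]
  have "subspace ({z. fst z 0 - snd z 0 \<in> {0 :: nat \<Rightarrow> real}} \<inter> rows {0, 1} \<times> rows {0, 1})" by simp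
  moreover have "outer = {z. fst z 0 - snd z 0 \<in> {0 :: nat \<Rightarrow> real}} \<inter> rows {0, 1} \<times> rows {0, 1}"
    unfolding outer_def by auto
  ultimately show ?thesis by (simp only:)
qed

text \<open>The trace determines \<open>d 0 = e 0\<close> because \<open>B 0 0\<close> is nonzero,
  and the \<open>u\<close>-derivatives then determine \<open>d 1\<close> and \<open>e 1\<close>
  because \<open>dB 1 0\<close> is nonzero.\<close>

lemma inj_traces: "inj_on traces outer"
proof (rule inj_onI)
  fix z z' assume z: "z \<in> outer" "z' \<in> outer" "traces z = traces z'"
  define y where "y = z - z'"
  have y: "y \<in> outer" using z(1,2) subspace_diff[OF subspace_outer] by (simp add: y_def)
  have 0: "traces y = 0" using linear_diff[OF linear_traces, of z z'] z(3) by (simp add: y_def)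
  obtain d e where de: "y = (d, e)" by (cases y)
  have rows: "d \<in> rows {0, 1}" "e \<in> rows {0, 1}" "d 0 = e 0" using y by (auto simp: outer_def de)
  have "famof (trace0 d) = 0" "famof (trace1 d) = 0" "famof (trace1 e) = 0"
    using fun_cong[OF 0] by (auto simp: traces_def de fun_eq_iff zero_prod_def)
  then have "trace0 d = 0" "trace1 d = 0" "trace1 e = 0"
    using trace_vecs[OF rows(1)] trace_vecs[OF rows(2)] famof_eq_0 by auto
  note t = this[THEN fun_cong]
  have d0: "d 0 = 0" using t(1) B_0_0 by (simp add: fun_eq_iff trace0_def)
  have d1: "d 1 = 0" using t(2) dB_1_0 d0 by (simp add: fun_eq_iff trace1_def)
  have e1: "e 1 = 0" using t(3) dB_1_0 d0 rows(3) by (simp add: fun_eq_iff trace1_def)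
  have "f = 0" if "f \<in> rows {0, 1}" "f 0 = 0" "f 1 = 0" for f :: "nat \<Rightarrow> nat \<Rightarrow> real"
  proof
    show "f i = 0 i" for i using that by (cases "i \<in> {0, 1}") (auto simp: rows_def)
  qed
  then have "y = 0" using rows d0 d1 e1 by (simp add: de zero_prod_def)
  then show "z = z'" by (simp add: y_def)
qed

lemma traces_surj: "traces ` glued_coeffs {0, 1} = glued_fams"
proof
  show "traces ` glued_coeffs {0, 1} \<subseteq> glued_fams" unfolding glued_coeffs_outer by auto
  show "glued_fams \<subseteq> traces ` glued_coeffs {0, 1}"
  proof
    fix f assume f: "f \<in> glued_fams"
    have "f i \<in> jumps p r i \<times> jumps p r i \<times> jumps p r i" if "i \<le> k" for i
    proof -
      have "f i \<in> glued i" using f that by (simp add: glued_fams_def)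
      then show ?thesis by (cases "f i") (simp add: glued_def)
    qed
    moreover have "f i = 0" if "\<not> i \<le> k" for i using f that by (auto simp: glued_fams_def)
    ultimately have pf: "(\<lambda>i. fst (f i)) \<in> pfam p r" "(\<lambda>i. fst (snd (f i))) \<in> pfam p r"
      "(\<lambda>i. snd (snd (f i))) \<in> pfam p r"
      by (auto simp: pfam_def mem_Times_iff)
    obtain x where x: "x \<in> vecs" "famof x = (\<lambda>i. fst (f i))"
      using pfam_famof[OF pf(1)] unfolding vecs_def by blast
    obtain y where y: "y \<in> vecs" "famof y = (\<lambda>i. fst (snd (f i)))"
      using pfam_famof[OF pf(2)] unfolding vecs_def by blast
    obtain z where z: "z \<in> vecs" "famof z = (\<lambda>i. snd (snd (f i)))"
      using pfam_famof[OF pf(3)] unfolding vecs_def by blast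
    \<comment> \<open>The solution of the triangular system with trace \<open>x\<close> and
      \<open>u\<close>-derivative \<open>w\<close>. Both patches use the same \<open>x\<close>, so
      their entries at index \<open>0\<close> agree.\<close>
    define c where "c = (\<lambda>w (i :: nat) (j :: nat). if i = 0 then x j / B 0 0
      else if i = 1 then (w j - dB 0 0 * (x j / B 0 0)) / dB 1 0 else 0)"
    have c: "c w \<in> rows {0, 1}" "trace0 (c w) = x" "trace1 (c w) = w" if "w \<in> vecs" for w
      using that x(1) B_0_0 dB_1_0
      by (auto simp: c_def rows_def vecs_def trace0_def trace1_def fun_eq_iff)
    have tr: "traces (c y, c z) = f"
      by (simp add: fun_eq_iff traces_def c y(1) z(1) x(2) y(2) z(2))
    have "(c y, c z) \<in> outer" using c(1)[OF y(1)] c(1)[OF z(1)] by (simp add: outer_def c_def)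
    then have "(c y, c z) \<in> glued_coeffs {0, 1}" unfolding glued_coeffs_outer using tr f by simp
    then show "f \<in> traces ` glued_coeffs {0, 1}" using tr by (metis imageI)
  qed
qed

section \<open>Dimension count\<close>

definition z\<beta> :: nat where "z\<beta> = card {v \<in> \<tau> ` {1..k}. poly \<beta> v = 0}"

lemma findim_glued_fams: "findim glued_fams (2 * (p + k * (p - r - 1)) + 1 + (1 - d\<alpha>) * (k + 1) + z\<beta>)"
proof -
  let ?d = "\<lambda>i. if i = 0 then 2 * p + 2 - d\<alpha>
    else 2 * p - 2 * r - 1 - d\<alpha> + (if poly \<beta> (\<tau> i) = 0 then 1 else 0)"
  have "findim glued_fams (\<Sum>i\<in>{..k}. ?d i)"
    unfolding glued_fams_def by (rule findim_Pi, simp, rule findim_glued, simp)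
  moreover have "(\<Sum>i\<in>{..k}. ?d i) = 2 * (p + k * (p - r - 1)) + 1 + (1 - d\<alpha>) * (k + 1) + z\<beta>"
  proof -
    \<comment> \<open>The knots are distinct, so zeros of \<beta> may be counted by index instead of
      by value.\<close>
    have "inj_on \<tau> {1..k}"
      using inner_knots by (auto simp: inner_knots_def intro: strict_mono_on_imp_inj_on)
    then have "inj_on \<tau> {i \<in> {1..k}. poly \<beta> (\<tau> i) = 0}" by (rule inj_on_subset) auto
    moreover have "{v \<in> \<tau> ` {1..k}. poly \<beta> v = 0} = \<tau> ` {i \<in> {1..k}. poly \<beta> (\<tau> i) = 0}" by auto
    ultimately have z: "z\<beta> = card {i \<in> {1..k}. poly \<beta> (\<tau> i) = 0}"
      unfolding z\<beta>_def by (simp only: card_image)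
    have "{..k} = insert 0 {1..k}" by auto
    then have "(\<Sum>i\<in>{..k}. ?d i) = 2 * p + 2 - d\<alpha> + (\<Sum>i\<in>{1..k}. ?d i)" by simp
    also have "(\<Sum>i\<in>{1..k}. ?d i)
        = (\<Sum>i\<in>{1..k}. 2 * p - 2 * r - 1 - d\<alpha>) + (\<Sum>i\<in>{1..k}. if poly \<beta> (\<tau> i) = 0 then 1 else 0)"
      unfolding sum.distrib[symmetric] by (rule sum.cong) auto
    also have "(\<Sum>i\<in>{1..k}. if poly \<beta> (\<tau> i) = 0 then 1 else 0) = z\<beta>"
      unfolding z by (simp add: sum.If_cases Int_def)
    also have "(\<Sum>i\<in>{1..k}. 2 * p - 2 * r - 1 - d\<alpha>) = k * (2 * p - 2 * r - 1 - d\<alpha>)" by simp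
    finally have eq: "(\<Sum>i\<in>{..k}. ?d i) = 2 * p + 2 - d\<alpha> + (k * (2 * p - 2 * r - 1 - d\<alpha>) + z\<beta>)" .
    \<comment> \<open>This substitution and the two possible values of \<open>d\<alpha>\<close>
      resolve the truncated subtractions.\<close>
    obtain s where s: "p = r + s + 1" using r_less by (metis less_iff_Suc_add add_Suc_right Suc_eq_plus1)
    have "d\<alpha> = 0 \<or> d\<alpha> = 1" using deg by (auto simp: d\<alpha>_def)
    then show ?thesis unfolding eq unfolding s by (auto simp: algebra_simps)
  qed
  ultimately show ?thesis by simp
qed

lemma findim_glued_coeffs_outer:
  "findim (glued_coeffs {0, 1}) (2 * (p + k * (p - r - 1)) + 1 + (1 - d\<alpha>) * (k + 1) + z\<beta>)"
proof (rule findim_of_image[OF linear_traces])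
  show "inj_on traces (glued_coeffs {0, 1})"
    unfolding glued_coeffs_outer by (rule inj_on_subset[OF inj_traces]) blast
  have "subspace {z. traces z \<in> glued_fams}"
    by (rule subspace_preimage[OF linear_traces findim_subspace[OF findim_glued_fams]])
  from subspace_inter[OF subspace_outer this] show "subspace (glued_coeffs {0, 1})"
    unfolding glued_coeffs_outer Int_def by (simp only: mem_Collect_eq)
qed (simp only: traces_surj findim_glued_fams)

text \<open>The part at the indices \<open>0\<close> and \<open>1\<close> inherits the interface
  relation, which sees nothing else; the remaining part is unconstrained.\<close>

lemma glued_coeffs_sum:
  "glued_coeffs {..n} = {x + y | x y. x \<in> glued_coeffs {2..n} \<and> y \<in> glued_coeffs {0, 1}}"
proof
  show "glued_coeffs {..n} \<subseteq> {x + y | x y. x \<in> glued_coeffs {2..n} \<and> y \<in> glued_coeffs {0, 1}}"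
  proof (rule subsetI, unfold mem_Collect_eq)
    fix w assume w: "w \<in> glued_coeffs {..n}"
    obtain d e where de': "w = (d, e)" by (cases w)
    have de: "(d, e) \<in> glued_coeffs {..n}" using w de' by simp
    define lo where "lo = (\<lambda>d :: nat \<Rightarrow> nat \<Rightarrow> real. \<lambda>i. if i \<in> {0, 1} then d i else 0)"
    define hi where "hi = (\<lambda>d :: nat \<Rightarrow> nat \<Rightarrow> real. \<lambda>i. if i \<in> {0, 1} then 0 else d i)"
    have "hi f \<in> rows {2..n}" "lo f \<in> rows {0, 1}" "f = hi f + lo f" if "f \<in> rows {..n}" for f
      using that n_ge by (auto simp: rows_def hi_def lo_def fun_eq_iff)
    note split = this
    have lo: "lo f 0 = f 0" "lo f 1 = f 1" for f by (simp_all add: lo_def)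
    have D: "d \<in> rows {..n}" "e \<in> rows {..n}" "d 0 = e 0" "interface_relation d e"
      using de by (simp_all only: glued_coeffs_def mem_Collect_eq prod.case)
    have "interface_relation (lo d) (lo e)"
      unfolding interface_relation_cong[of "lo d" d "lo e" e, OF lo lo] by (rule D(4))
    then have "(lo d, lo e) \<in> glued_coeffs {0, 1}"
      using split(2)[OF D(1)] split(2)[OF D(2)] D(3)
      by (simp only: glued_coeffs_def mem_Collect_eq prod.case lo simp_thms)
    moreover have "(hi d, hi e) \<in> glued_coeffs {2..n}"
      unfolding glued_coeffs_inner using split(1)[OF D(1)] split(1)[OF D(2)] by (rule SigmaI)
    moreover have "(d, e) = (hi d, hi e) + (lo d, lo e)"
      unfolding add_Pair using split(3)[OF D(1)] split(3)[OF D(2)] by (rule arg_cong2)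
    ultimately show "\<exists>x y. w = x + y \<and> x \<in> glued_coeffs {2..n} \<and> y \<in> glued_coeffs {0, 1}" unfolding de' by blast
  qed
  show "{x + y | x y. x \<in> glued_coeffs {2..n} \<and> y \<in> glued_coeffs {0, 1}} \<subseteq> glued_coeffs {..n}"
  proof
    fix w assume "w \<in> {x + y | x y. x \<in> glued_coeffs {2..n} \<and> y \<in> glued_coeffs {0, 1}}"
    then obtain d e d' e' where w: "w = (d, e) + (d', e')"
      and a: "(d, e) \<in> glued_coeffs {2..n}" "(d', e') \<in> glued_coeffs {0, 1}" by auto
    have "d 0 = 0" "d 1 = 0" "e 0 = 0" "e 1 = 0" using a(1) by (auto simp: glued_coeffs_def rows_def)
    then have r: "(d + d') 0 = d' 0" "(d + d') 1 = d' 1" "(e + e') 0 = e' 0" "(e + e') 1 = e' 1"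
      by simp_all
    have D: "d \<in> rows {2..n}" "e \<in> rows {2..n}" "d' \<in> rows {0, 1}" "e' \<in> rows {0, 1}"
      "d' 0 = e' 0" "interface_relation d' e'"
      using a by (simp_all only: glued_coeffs_def mem_Collect_eq prod.case)
    have I: "{2..n} \<subseteq> {..n}" "{0, 1} \<subseteq> {..n}" using n_ge by auto
    note S = subspace_add[OF subspace_rows[OF finite_atMost]]
    have "d + d' \<in> rows {..n}" "e + e' \<in> rows {..n}"
      using S[OF subsetD[OF rows_mono[OF I(1)] D(1)] subsetD[OF rows_mono[OF I(2)] D(3)]]
        S[OF subsetD[OF rows_mono[OF I(1)] D(2)] subsetD[OF rows_mono[OF I(2)] D(4)]] .
    moreover have "interface_relation (d + d') (e + e')"
      unfolding interface_relation_cong[OF r] by (rule D(6))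
    ultimately show "w \<in> glued_coeffs {..n}"
      unfolding w add_Pair using r D(5) by (simp only: glued_coeffs_def mem_Collect_eq prod.case simp_thms)
  qed
qed

lemma dimensions:
  "dim (V1\<^sub>1 p r k \<tau> FL FR) = 2 * (n - 1) * (n + 1)"
  "dim (V1\<^sub>2 p r k \<tau> FL FR) = 2 * (p + k * (p - r - 1)) + 1 + (1 - d\<alpha>) * (k + 1) + z\<beta>"
  "dim (V1 p r k \<tau> FL FR) = 2 * (n - 1) * (n + 1)
    + (2 * (p + k * (p - r - 1)) + 1 + (1 - d\<alpha>) * (k + 1) + z\<beta>)"
proof -
  have "glued_coeffs {2..n} \<inter> glued_coeffs {0, 1} \<subseteq> {0}"
  proof
    fix w assume w: "w \<in> glued_coeffs {2..n} \<inter> glued_coeffs {0, 1}"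
    obtain d e where de: "w = (d, e)" by (cases w)
    have a: "(d, e) \<in> glued_coeffs {2..n}" "(d, e) \<in> glued_coeffs {0, 1}" using w de by auto
    have "d i = 0" "e i = 0" for i
      using a by (cases "i \<in> {0, 1}"; auto simp: glued_coeffs_def rows_def)+
    then show "w \<in> {0}" unfolding de by (simp add: fun_eq_iff zero_prod_def)
  qed
  from findim_direct_sum[OF findim_glued_coeffs_inner findim_glued_coeffs_outer this]
  have all: "findim (glued_coeffs {..n}) (2 * (n - 1) * (n + 1)
      + (2 * (p + k * (p - r - 1)) + 1 + (1 - d\<alpha>) * (k + 1) + z\<beta>))"
    unfolding glued_coeffs_sum .
  have 0: "0 \<in> glued_coeffs {2..n}" "0 \<in> glued_coeffs {0, 1}"
    using findim_subspace[OF findim_glued_coeffs_inner] findim_subspace[OF findim_glued_coeffs_outer]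
      subspace_0 by blast+
  have "glued_coeffs {2..n} \<subseteq> glued_coeffs {..n}" "glued_coeffs {0, 1} \<subseteq> glued_coeffs {..n}"
  proof -
    have "x = x + 0" "x = 0 + x" for x :: "(nat \<Rightarrow> nat \<Rightarrow> real) \<times> (nat \<Rightarrow> nat \<Rightarrow> real)"
      by simp_all
    then show "glued_coeffs {2..n} \<subseteq> glued_coeffs {..n}" "glued_coeffs {0, 1} \<subseteq> glued_coeffs {..n}"
      unfolding glued_coeffs_sum using 0 by blast+
  qed
  then have inj: "inj_on glue (glued_coeffs {2..n})" "inj_on glue (glued_coeffs {0, 1})"
    using inj_on_subset[OF inj_glue] by auto
  show "dim (V1\<^sub>1 p r k \<tau> FL FR) = 2 * (n - 1) * (n + 1)"
    unfolding V1_1_eq by (rule findim_dim[OF findim_image[OF linear_glue inj(1) findim_glued_coeffs_inner]])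
  show "dim (V1\<^sub>2 p r k \<tau> FL FR) = 2 * (p + k * (p - r - 1)) + 1 + (1 - d\<alpha>) * (k + 1) + z\<beta>"
    unfolding V1_2_eq by (rule findim_dim[OF findim_image[OF linear_glue inj(2) findim_glued_coeffs_outer]])
  show "dim (V1 p r k \<tau> FL FR) = 2 * (n - 1) * (n + 1)
      + (2 * (p + k * (p - r - 1)) + 1 + (1 - d\<alpha>) * (k + 1) + z\<beta>)"
    unfolding V1_eq by (rule findim_dim[OF findim_image[OF linear_glue inj_glue all]])
qed

end

theorem theorem11:
  fixes p r k :: nat and \<tau> :: "nat \<Rightarrow> real"
    and FL FR :: "real \<times> real \<Rightarrow> real \<times> real"
    and \<alpha>L \<alpha>R \<beta> :: "real poly" and d\<^sub>\<alpha> z\<^sub>\<beta> :: nat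
  assumes "p \<ge> 3" and "1 \<le> r" and "r \<le> p - 2"
    and "inner_knots k \<tau>"
    and "two_patch p r k \<tau> FL FR"
    and "AS_G1 FL FR \<alpha>L \<alpha>R \<beta>"
    and "d\<^sub>\<alpha> = max (degree \<alpha>L) (degree \<alpha>R)"
    and "z\<^sub>\<beta> = card {v \<in> \<tau> ` {1..k}. poly \<beta> v = 0}"
  shows "dim (V1 p r k \<tau> FL FR)
           = 2 * (p + k * (p - r) - 1) * (p + k * (p - r) + 1)
             + (2 * (p + k * (p - r - 1)) + 1 + (1 - d\<^sub>\<alpha>) * (k + 1) + z\<^sub>\<beta>)
         \<and> dim (V1\<^sub>1 p r k \<tau> FL FR) = 2 * (p + k * (p - r) - 1) * (p + k * (p - r) + 1)
         \<and> dim (V1\<^sub>2 p r k \<tau> FL FR) = 2 * (p + k * (p - r - 1)) + 1 + (1 - d\<^sub>\<alpha>) * (k + 1) + z\<^sub>\<beta>"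
proof -
  \<comment> \<open>Any decomposition of \<beta> serves, as the dimensions depend only on \<beta>
    itself.\<close>
  obtain \<beta>L \<beta>R where \<beta>: "degree \<beta>L \<le> 1" "degree \<beta>R \<le> 1" "\<beta> = \<alpha>L * \<beta>R - \<alpha>R * \<beta>L"
    using assms(6) unfolding AS_G1_def by blast
  interpret glued_geometry k \<tau> p r FL FR \<alpha>L \<alpha>R \<beta>L \<beta>R \<beta>
    by unfold_locales (use assms \<beta> in \<open>simp_all add: AS_G1_def\<close>)
  show ?thesis using dimensions unfolding d\<alpha>_def z\<beta>_def assms(7,8) by simp
qed

end
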